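(* Let $M_t$ be a family of smooth closed strictly convex surfaces in $\mathbb{R}^3$ moving according to $\frac{d}{dt}X=\frac{H^3}{K^3}\nu$. Then $$\max_{M_t}\frac{(\lambda_1+\lambda_2)^6(\lambda_1-\lambda_2)^2}{16(\lambda_1^2+\lambda_2^2)(\lambda_1^2+\lambda_1\lambda_2+\lambda_2^2)\lambda_1^3\lambda_2^3}$$ is non-increasing in time.
   Context: $X$ denotes the embedding, $\nu$ the outer unit normal, $\lambda_1,\lambda_2>0$ the principal curvatures, $H=\lambda_1+\lambda_2$, $K=\lambda_1\lambda_2$. *)

theory Defs
  imports "HOL-Analysis.Analysis"
begin

fun C_k_on :: "nat \<Rightarrow> ('a::euclidean_space) set \<Rightarrow> ('a \<Rightarrow> 'b::euclidean_space) \<Rightarrow> bool" where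
  "C_k_on 0 U f = continuous_on U f"
| "C_k_on (Suc k) U f =
     (\<exists>f'. (\<forall>x\<in>U. (f has_derivative f' x) (at x)) \<and> (\<forall>v. C_k_on k U (\<lambda>x. f' x v)))"

definition smooth_on :: "('a::euclidean_space) set \<Rightarrow> ('a \<Rightarrow> 'b::euclidean_space) \<Rightarrow> bool" where
  "smooth_on U f \<longleftrightarrow> (\<forall>k. C_k_on k U f)"

definition tframe :: "real^3 \<Rightarrow> (real^3) \<times> (real^3)" where
  "tframe p = (SOME (e1, e2). e1 \<bullet> p = 0 \<and> e2 \<bullet> p = 0 \<and> e1 \<bullet> e2 = 0 \<and> norm e1 = 1 \<and> norm e2 = 1)"

text \<open>Local chart of S^2 around p (gnomonic chart), (u,v) near (0,0).\<close>
definition chart :: "real^3 \<Rightarrow> real \<Rightarrow> real \<Rightarrow> real^3" where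
  "chart p u v = (let w = p + u *\<^sub>R fst (tframe p) + v *\<^sub>R snd (tframe p) in w /\<^sub>R norm w)"

definition locY :: "(real^3 \<Rightarrow> real \<Rightarrow> real^3) \<Rightarrow> real^3 \<Rightarrow> real \<Rightarrow> real \<Rightarrow> real \<Rightarrow> real^3" where
  "locY X p t u v = X (chart p u v) t"

definition Yu :: "(real^3 \<Rightarrow> real \<Rightarrow> real^3) \<Rightarrow> real^3 \<Rightarrow> real \<Rightarrow> real \<Rightarrow> real \<Rightarrow> real^3" where
  "Yu X p t u v = vector_derivative (\<lambda>s. locY X p t s v) (at u)"

definition Yv :: "(real^3 \<Rightarrow> real \<Rightarrow> real^3) \<Rightarrow> real^3 \<Rightarrow> real \<Rightarrow> real \<Rightarrow> real \<Rightarrow> real^3" where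
  "Yv X p t u v = vector_derivative (\<lambda>s. locY X p t u s) (at v)"

definition Yuu where "Yuu X p t = vector_derivative (\<lambda>s. Yu X p t s 0) (at 0)"
definition Yuv where "Yuv X p t = vector_derivative (\<lambda>s. Yu X p t 0 s) (at 0)"
definition Yvv where "Yvv X p t = vector_derivative (\<lambda>s. Yv X p t 0 s) (at 0)"

definition outer_normal :: "(real^3 \<Rightarrow> real \<Rightarrow> real^3) \<Rightarrow> real^3 \<Rightarrow> real \<Rightarrow> real^3" where
  "outer_normal X p t = (SOME n. norm n = 1 \<and> n \<bullet> Yu X p t 0 0 = 0 \<and> n \<bullet> Yv X p t 0 0 = 0 \<and>
      (\<exists>e>0. \<forall>s\<in>{0<..<e}. X p t + s *\<^sub>R n \<in> outside ((\<lambda>q. X q t) ` sphere 0 1)))"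

text \<open>First and second fundamental forms in the chart (second w.r.t. the outer normal,
  sign chosen so that the round sphere has positive curvatures).\<close>
definition g11 where "g11 X p t = Yu X p t 0 0 \<bullet> Yu X p t 0 0"
definition g12 where "g12 X p t = Yu X p t 0 0 \<bullet> Yv X p t 0 0"
definition g22 where "g22 X p t = Yv X p t 0 0 \<bullet> Yv X p t 0 0"
definition h11 where "h11 X p t = - (Yuu X p t \<bullet> outer_normal X p t)"
definition h12 where "h12 X p t = - (Yuv X p t \<bullet> outer_normal X p t)"
definition h22 where "h22 X p t = - (Yvv X p t \<bullet> outer_normal X p t)"

text \<open>Mean curvature H = trace and Gauss curvature K = det of the Weingarten map g^{-1} h.\<close>
definition meanH :: "(real^3 \<Rightarrow> real \<Rightarrow> real^3) \<Rightarrow> real^3 \<Rightarrow> real \<Rightarrow> real" where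
  "meanH X p t = (g22 X p t * h11 X p t - 2 * g12 X p t * h12 X p t + g11 X p t * h22 X p t)
                 / (g11 X p t * g22 X p t - (g12 X p t)\<^sup>2)"

definition gaussK :: "(real^3 \<Rightarrow> real \<Rightarrow> real^3) \<Rightarrow> real^3 \<Rightarrow> real \<Rightarrow> real" where
  "gaussK X p t = (h11 X p t * h22 X p t - (h12 X p t)\<^sup>2) / (g11 X p t * g22 X p t - (g12 X p t)\<^sup>2)"

text \<open>Principal curvatures: the two eigenvalues of the Weingarten map
  (roots of lambda^2 - H lambda + K), lambda1 \<ge> lambda2.\<close>
definition kappa1 where "kappa1 X p t = (meanH X p t + sqrt ((meanH X p t)\<^sup>2 - 4 * gaussK X p t)) / 2"
definition kappa2 where "kappa2 X p t = (meanH X p t - sqrt ((meanH X p t)\<^sup>2 - 4 * gaussK X p t)) / 2"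

definition Qfun :: "real \<Rightarrow> real \<Rightarrow> real" where
  "Qfun l1 l2 = (l1 + l2) ^ 6 * (l1 - l2)\<^sup>2 /
     (16 * (l1\<^sup>2 + l2\<^sup>2) * (l1\<^sup>2 + l1 * l2 + l2\<^sup>2) * l1 ^ 3 * l2 ^ 3)"

end

theory Submission
  imports Defs
begin

text \<open>
  The quotient is a function of \<open>s = H / K = 1/\<lambda>\<^sub>1 + 1/\<lambda>\<^sub>2\<close> and \<open>P = 1 / K\<close>, and it is even in the
  normal. In gnomonic coordinates \<open>y\<close> of the Gauss map the support function \<open>\<sigma>\<close> satisfies \<open>\<sigma>\<^sub>t = w s\<^sup>3\<close>
  with \<open>w = sqrt (1 + |y|\<^sup>2)\<close>, \<open>s = w tr ((1 + y y\<^sup>T) D\<^sup>2\<sigma>)\<close> and \<open>P = w\<^sup>4 det D\<^sup>2\<sigma>\<close>. No inverse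
  function is needed for the change of coordinates: \<open>\<partial>/\<partial>y\<close> and \<open>\<partial>/\<partial>t\<close> at fixed \<open>y\<close> are the commuting
  vector fields dual to \<open>(y, t)\<close>. At a spatial maximum with \<open>y = 0\<close> and \<open>D\<^sup>2\<sigma>\<close> diagonal, the fourth
  derivatives of \<open>\<sigma>\<close> in the time derivative combine to \<open>3 s\<^sup>2\<close> times a Laplacian, the zeroth order
  terms are nonpositive, and the first order conditions leave for each direction a quadratic form in
  the third derivatives whose sign is that of a fixed binary form of degree 18. Hence the maximum has
  nonpositive backward derivative at every time.
\<close>

section \<open>Calculus of smooth functions\<close>

text \<open>\<open>outer_normal\<close> is picked by \<open>SOME\<close>, so its values at
  neighbouring points are a priori unrelated. A witness exists at every point by the Jordan-Brouwer
  theorem, so the picked vector is a unit normal. Near a point it therefore agrees with a smooth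
  normal field \<open>N\<close> up to a sign that may vary from point to point. Reversing the normal
  changes only the sign of \<open>H\<close>; the quotient and the velocity, \<open>(H / K)^3\<close>
  times the normal, stay the same. Hence everything is differentiated with \<open>N\<close>.

  The curvatures are defined only at the centre of the chart around each point. Before they can be
  differentiated they must be rewritten in one fixed chart.

  The quotient itself is not differentiated: at a maximum it is replaced by \<open>\<Phi>\<close>, a
  combination of its numerator and denominator with constant coefficients, which is polynomial in
  \<open>s\<close> and \<open>P\<close>.

  The comparison in time keeps the maximising point fixed and looks backward, where the supremum
  dominates the value at that point; the maximiser need not depend continuously on time. At an
  umbilic maximum the quotient has its least value 0 and there is nothing to compare.\<close>

lemma C_k_on_SucE:
  assumes "C_k_on (Suc k) U f"
  obtains f' where "\<forall>x\<in>U. (f has_derivative f' x) (at x)" "\<forall>v. C_k_on k U (\<lambda>x. f' x v)"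
  using assms by auto

lemma C_k_on_SucI:
  assumes "\<And>x. x \<in> U \<Longrightarrow> (f has_derivative f' x) (at x)"
    "\<And>v. C_k_on k U (\<lambda>x. f' x v)"
  shows "C_k_on (Suc k) U f"
  using assms by auto

lemma C_k_on_cong:
  assumes "open U" "\<And>x. x \<in> U \<Longrightarrow> f x = g x" "C_k_on k U f"
  shows "C_k_on k U g"
proof (cases k)
  case 0
  then have "continuous_on U f" using assms(3) by simp
  then have "continuous_on U g" by (rule continuous_on_eq) (rule assms(2))
  then show ?thesis using 0 by simp
next
  case (Suc n)
  obtain f' where "\<forall>x\<in>U. (f has_derivative f' x) (at x)" "\<forall>v. C_k_on n U (\<lambda>x. f' x v)"
    by (rule C_k_on_SucE[OF assms(3)[unfolded Suc]])
  note f' = this[rule_format]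
  have "(g has_derivative f' x) (at x)" if "x \<in> U" for x
    by (rule has_derivative_transform_within_open[OF f'(1)[OF that] assms(1) that assms(2)])
  then show ?thesis unfolding Suc using f'(2) by (rule C_k_on_SucI)
qed

lemma C_k_on_subset: "C_k_on k U f \<Longrightarrow> V \<subseteq> U \<Longrightarrow> C_k_on k V f"
proof (induction k arbitrary: f)
  case 0
  then show ?case by (simp add: continuous_on_subset)
next
  case (Suc k)
  obtain f' where "\<forall>x\<in>U. (f has_derivative f' x) (at x)" "\<forall>v. C_k_on k U (\<lambda>x. f' x v)"
    by (rule C_k_on_SucE[OF Suc.prems(1)])
  note f' = this[rule_format]
  show ?case
    using f'(1)[OF subsetD[OF Suc.prems(2)]] Suc.IH[OF f'(2) Suc.prems(2)] by (rule C_k_on_SucI)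
qed

lemma C_k_on_Suc_imp: "C_k_on (Suc k) U f \<Longrightarrow> C_k_on k U f"
proof (induction k arbitrary: f)
  case 0
  obtain f' where "\<forall>x\<in>U. (f has_derivative f' x) (at x)"
    using 0 by auto
  note f' = this[rule_format]
  have "continuous_on U f"
    by (intro continuous_at_imp_continuous_on ballI has_derivative_continuous[OF f'])
  then show ?case by simp
next
  case (Suc k)
  obtain f' where "\<forall>x\<in>U. (f has_derivative f' x) (at x)" "\<forall>v. C_k_on (Suc k) U (\<lambda>x. f' x v)"
    by (rule C_k_on_SucE[OF Suc.prems(1)])
  note f' = this[rule_format]
  show ?case using f'(1) Suc.IH[OF f'(2)] by (rule C_k_on_SucI)
qed

lemma C_k_on_const [simp]: "C_k_on k U (\<lambda>x. c)"
proof (induction k arbitrary: c)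
  case (Suc k)
  show ?case using Suc by (auto intro!: exI[of _ "\<lambda>x v. 0"])
qed auto

lemma C_k_on_bounded_linear: "bounded_linear L \<Longrightarrow> C_k_on k U f \<Longrightarrow> C_k_on k U (\<lambda>x. L (f x))"
proof (induction k arbitrary: f)
  case 0
  then show ?case by (auto intro: bounded_linear.continuous_on)
next
  case (Suc k)
  obtain f' where "\<forall>x\<in>U. (f has_derivative f' x) (at x)" "\<forall>v. C_k_on k U (\<lambda>x. f' x v)"
    by (rule C_k_on_SucE[OF Suc.prems(2)])
  note f' = this[rule_format]
  have "((\<lambda>x. L (f x)) has_derivative (\<lambda>v. L (f' x v))) (at x)" if "x \<in> U" for x
    using bounded_linear.has_derivative[OF Suc.prems(1) f'(1)[OF that]] .
  then show ?case using Suc.IH[OF Suc.prems(1) f'(2)] by (rule C_k_on_SucI)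
qed

lemma C_k_on_id: "bounded_linear L \<Longrightarrow> C_k_on k U L"
proof (cases k)
  case (Suc n)
  assume "bounded_linear L"
  then show ?thesis using Suc by (auto intro!: exI[of _ "\<lambda>x. L"] bounded_linear_imp_has_derivative)
qed (auto intro: linear_continuous_on)

lemma C_k_on_add: "C_k_on k U f \<Longrightarrow> C_k_on k U g \<Longrightarrow> C_k_on k U (\<lambda>x. f x + g x)"
proof (induction k arbitrary: f g)
  case 0
  then show ?case by (auto intro: continuous_intros)
next
  case (Suc k)
  obtain f' where "\<forall>x\<in>U. (f has_derivative f' x) (at x)" "\<forall>v. C_k_on k U (\<lambda>x. f' x v)"
    by (rule C_k_on_SucE[OF Suc.prems(1)])
  note f' = this[rule_format]
  obtain g' where "\<forall>x\<in>U. (g has_derivative g' x) (at x)" "\<forall>v. C_k_on k U (\<lambda>x. g' x v)"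
    by (rule C_k_on_SucE[OF Suc.prems(2)])
  note g' = this[rule_format]
  show ?case
    using has_derivative_add[OF f'(1) g'(1)] Suc.IH[OF f'(2) g'(2)] by (rule C_k_on_SucI)
qed

lemma C_k_on_sum: "(\<And>i. i \<in> I \<Longrightarrow> C_k_on k U (f i)) \<Longrightarrow> C_k_on k U (\<lambda>x. \<Sum>i\<in>I. f i x)"
  by (induction I rule: infinite_finite_induct) (auto intro: C_k_on_add)

lemma C_k_on_bilinear:
  assumes "bounded_bilinear B"
  shows "C_k_on k U f \<Longrightarrow> C_k_on k U g \<Longrightarrow> C_k_on k U (\<lambda>x. B (f x) (g x))"
proof (induction k arbitrary: f g)
  case 0
  then show ?case using bounded_bilinear.continuous_on[OF assms] by auto
next
  case (Suc k)
  obtain f' where "\<forall>x\<in>U. (f has_derivative f' x) (at x)" "\<forall>v. C_k_on k U (\<lambda>x. f' x v)"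
    by (rule C_k_on_SucE[OF Suc.prems(1)])
  note f' = this[rule_format]
  obtain g' where "\<forall>x\<in>U. (g has_derivative g' x) (at x)" "\<forall>v. C_k_on k U (\<lambda>x. g' x v)"
    by (rule C_k_on_SucE[OF Suc.prems(2)])
  note g' = this[rule_format]
  have "((\<lambda>x. B (f x) (g x)) has_derivative (\<lambda>v. B (f x) (g' x v) + B (f' x v) (g x))) (at x)"
    if "x \<in> U" for x
    by (rule bounded_bilinear.FDERIV[OF assms f'(1)[OF that] g'(1)[OF that]])
  moreover have "C_k_on k U (\<lambda>x. B (f x) (g' x v) + B (f' x v) (g x))" for v
    by (rule C_k_on_add[OF Suc.IH[OF C_k_on_Suc_imp[OF Suc.prems(1)] g'(2)]
          Suc.IH[OF f'(2) C_k_on_Suc_imp[OF Suc.prems(2)]]])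
  ultimately show ?case by (rule C_k_on_SucI)
qed

lemma C_k_on_compose:
  fixes f :: "'b::euclidean_space \<Rightarrow> 'c::euclidean_space" and g :: "'a::euclidean_space \<Rightarrow> 'b"
  shows "C_k_on k U f \<Longrightarrow> C_k_on k V g \<Longrightarrow> g ` V \<subseteq> U \<Longrightarrow> C_k_on k V (\<lambda>x. f (g x))"
proof (induction k arbitrary: f)
  case 0
  then show ?case by (auto intro: continuous_on_compose2)
next
  case (Suc k)
  obtain f' where "\<forall>x\<in>U. (f has_derivative f' x) (at x)" "\<forall>v. C_k_on k U (\<lambda>x. f' x v)"
    by (rule C_k_on_SucE[OF Suc.prems(1)])
  note f' = this[rule_format]
  obtain g' where "\<forall>x\<in>V. (g has_derivative g' x) (at x)" "\<forall>v. C_k_on k V (\<lambda>x. g' x v)"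
    by (rule C_k_on_SucE[OF Suc.prems(2)])
  note g' = this[rule_format]
  have der: "((\<lambda>x. f (g x)) has_derivative (\<lambda>v. f' (g x) (g' x v))) (at x)" if "x \<in> V" for x
    using has_derivative_compose[OF g'(1)[OF that] f'(1)] Suc.prems that by auto
  \<comment> \<open>The induction hypothesis covers \<open>f' y v\<close> only for a fixed
    \<open>v\<close>, but here the vector \<open>g' x v\<close> moves with \<open>x\<close>.
    Expanding in the basis leaves fixed vectors with varying scalar coefficients.\<close>
  have eq: "f' (g x) (g' x v) = (\<Sum>b\<in>Basis. (g' x v \<bullet> b) *\<^sub>R f' (g x) b)" if "x \<in> V" for x v
  proof -
    have l: "linear (f' (g x))"
      using f'(1)[of "g x"] Suc.prems that has_derivative_bounded_linear bounded_linear.linear by blast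
    have "f' (g x) (g' x v) = f' (g x) (\<Sum>b\<in>Basis. (g' x v \<bullet> b) *\<^sub>R b)"
      by (simp add: euclidean_representation)
    also have "\<dots> = (\<Sum>b\<in>Basis. (g' x v \<bullet> b) *\<^sub>R f' (g x) b)"
      using l by (simp add: linear_sum linear_scale)
    finally show ?thesis .
  qed
  have "C_k_on k V (\<lambda>x. \<Sum>b\<in>Basis. (g' x v \<bullet> b) *\<^sub>R f' (g x) b)" for v
  proof (intro C_k_on_sum C_k_on_bilinear[OF bounded_bilinear_scaleR])
    fix b :: 'b
    show "C_k_on k V (\<lambda>x. g' x v \<bullet> b)"
      by (rule C_k_on_bounded_linear[OF bounded_linear_inner_left g'(2)])
    show "C_k_on k V (\<lambda>x. f' (g x) b)"
      by (rule Suc.IH[OF f'(2) C_k_on_Suc_imp[OF Suc.prems(2)] Suc.prems(3)])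
  qed
  moreover have "((\<lambda>x. f (g x)) has_derivative (\<lambda>v. \<Sum>b\<in>Basis. (g' x v \<bullet> b) *\<^sub>R f' (g x) b)) (at x)"
    if "x \<in> V" for x
    using der[OF that] unfolding eq[OF that] .
  ultimately show ?case by (intro C_k_on_SucI)
qed

text \<open>The derivative is a product of \<open>f'\<close> with two copies of the function itself,
  so the induction closes.\<close>

lemma C_k_on_inverse:
  fixes f :: "'a::euclidean_space \<Rightarrow> real"
  shows "C_k_on k U f \<Longrightarrow> \<forall>x\<in>U. f x \<noteq> 0 \<Longrightarrow> C_k_on k U (\<lambda>x. inverse (f x))"
proof (induction k arbitrary: f)
  case 0
  then show ?case by (auto intro: continuous_intros)
next
  case (Suc k)
  obtain f' where "\<forall>x\<in>U. (f has_derivative f' x) (at x)" "\<forall>v. C_k_on k U (\<lambda>x. f' x v)"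
    by (rule C_k_on_SucE[OF Suc.prems(1)])
  note f' = this[rule_format]
  have "((\<lambda>x. inverse (f x)) has_derivative (\<lambda>v. (-1) * (inverse (f x) * f' x v * inverse (f x)))) (at x)" if "x \<in> U" for x
    using f'(1)[OF that] Suc.prems(2) that by (auto intro!: derivative_eq_intros)
  moreover have "C_k_on k U (\<lambda>x. (-1) * (inverse (f x) * f' x v * inverse (f x)))" for v
    by (intro C_k_on_bilinear[OF bounded_bilinear_mult] C_k_on_const f'(2)
        Suc.IH[OF C_k_on_Suc_imp[OF Suc.prems(1)] Suc.prems(2)])
  ultimately show ?case by (rule C_k_on_SucI)
qed

text \<open>The exponent -1/2 is preferred to 1/2 because the derivative is then \<open>f'\<close>
  times the cube of the same function, so the induction closes. The square root is recovered as
  \<open>f\<close> times this function.\<close>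

lemma C_k_on_inverse_sqrt:
  fixes f :: "'a::euclidean_space \<Rightarrow> real"
  shows "C_k_on k U f \<Longrightarrow> \<forall>x\<in>U. f x > 0 \<Longrightarrow> C_k_on k U (\<lambda>x. inverse (sqrt (f x)))"
proof (induction k arbitrary: f)
  case 0
  then show ?case by (force intro: continuous_intros)
next
  case (Suc k)
  obtain f' where "\<forall>x\<in>U. (f has_derivative f' x) (at x)" "\<forall>v. C_k_on k U (\<lambda>x. f' x v)"
    by (rule C_k_on_SucE[OF Suc.prems(1)])
  note f' = this[rule_format]
  let ?D = "\<lambda>x v. (-1/2) * (f' x v * (inverse (sqrt (f x)) * (inverse (sqrt (f x)) * inverse (sqrt (f x)))))"
  have "((\<lambda>x. inverse (sqrt (f x))) has_derivative ?D x) (at x)" if "x \<in> U" for x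
  proof -
    have "f x > 0" using Suc.prems that by auto
    then show ?thesis using f'(1)[OF that]
      by (auto intro!: derivative_eq_intros simp: field_simps)
  qed
  moreover have "C_k_on k U (\<lambda>x. ?D x v)" for v
    by (intro C_k_on_bilinear[OF bounded_bilinear_mult] C_k_on_const f'(2)
        Suc.IH[OF C_k_on_Suc_imp[OF Suc.prems(1)] Suc.prems(2)])
  ultimately show ?case by (rule C_k_on_SucI)
qed

section \<open>Closure properties of smooth functions\<close>

lemma smooth_on_cong:
  "open U \<Longrightarrow> (\<And>x. x \<in> U \<Longrightarrow> f x = g x) \<Longrightarrow> smooth_on U f \<Longrightarrow> smooth_on U g"
  unfolding smooth_on_def using C_k_on_cong[of U f g] by simp

lemma smooth_on_subset: "smooth_on U f \<Longrightarrow> V \<subseteq> U \<Longrightarrow> smooth_on V f"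
  unfolding smooth_on_def using C_k_on_subset[of _ U f V] by simp

lemma smooth_on_const [simp, intro]: "smooth_on U (\<lambda>x. c)"
  unfolding smooth_on_def by simp

lemma smooth_on_bounded_linear: "bounded_linear L \<Longrightarrow> smooth_on U f \<Longrightarrow> smooth_on U (\<lambda>x. L (f x))"
  by (simp add: smooth_on_def C_k_on_bounded_linear)

lemma smooth_on_linear: "bounded_linear L \<Longrightarrow> smooth_on U L"
  by (simp add: smooth_on_def C_k_on_id)

lemma smooth_on_id [simp, intro]: "smooth_on U (\<lambda>x. x)"
  by (rule smooth_on_linear) (rule bounded_linear_ident)

lemma smooth_on_add [intro]: "smooth_on U f \<Longrightarrow> smooth_on U g \<Longrightarrow> smooth_on U (\<lambda>x. f x + g x)"
  by (simp add: smooth_on_def C_k_on_add)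

lemma smooth_on_sum: "(\<And>i. i \<in> I \<Longrightarrow> smooth_on U (f i)) \<Longrightarrow> smooth_on U (\<lambda>x. \<Sum>i\<in>I. f i x)"
  by (simp add: smooth_on_def C_k_on_sum)

lemma smooth_on_bilinear:
  "bounded_bilinear B \<Longrightarrow> smooth_on U f \<Longrightarrow> smooth_on U g \<Longrightarrow> smooth_on U (\<lambda>x. B (f x) (g x))"
  by (simp add: smooth_on_def C_k_on_bilinear)

lemma smooth_on_mult [intro]:
  fixes f g :: "'a::euclidean_space \<Rightarrow> real"
  shows "smooth_on U f \<Longrightarrow> smooth_on U g \<Longrightarrow> smooth_on U (\<lambda>x. f x * g x)"
  by (rule smooth_on_bilinear[OF bounded_bilinear_mult])

lemma smooth_on_scaleR [intro]:
  "smooth_on U f \<Longrightarrow> smooth_on U g \<Longrightarrow> smooth_on U (\<lambda>x. f x *\<^sub>R g x)"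
  by (rule smooth_on_bilinear[OF bounded_bilinear_scaleR])

lemma smooth_on_inner [intro]:
  "smooth_on U f \<Longrightarrow> smooth_on U g \<Longrightarrow> smooth_on U (\<lambda>x. f x \<bullet> g x)"
  by (rule smooth_on_bilinear[OF bounded_bilinear_inner])

lemma smooth_on_minus [intro]: "smooth_on U f \<Longrightarrow> smooth_on U (\<lambda>x. - f x)"
  by (rule smooth_on_bounded_linear[OF bounded_linear_minus[OF bounded_linear_ident]])

lemma smooth_on_diff [intro]: "smooth_on U f \<Longrightarrow> smooth_on U g \<Longrightarrow> smooth_on U (\<lambda>x. f x - g x)"
  using smooth_on_add[OF _ smooth_on_minus, of U f g] by simp

lemma smooth_on_power [intro]:
  fixes f :: "'a::euclidean_space \<Rightarrow> real"
  shows "smooth_on U f \<Longrightarrow> smooth_on U (\<lambda>x. f x ^ n)"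
  by (induction n) auto

lemma smooth_on_compose:
  "smooth_on U f \<Longrightarrow> smooth_on V g \<Longrightarrow> g ` V \<subseteq> U \<Longrightarrow> smooth_on V (\<lambda>x. f (g x))"
  unfolding smooth_on_def using C_k_on_compose[of _ U f V g] by simp

lemma smooth_on_inverse:
  fixes f :: "'a::euclidean_space \<Rightarrow> real"
  shows "smooth_on U f \<Longrightarrow> (\<And>x. x \<in> U \<Longrightarrow> f x \<noteq> 0) \<Longrightarrow> smooth_on U (\<lambda>x. inverse (f x))"
  by (simp add: smooth_on_def C_k_on_inverse)

lemma smooth_on_divide:
  fixes f g :: "'a::euclidean_space \<Rightarrow> real"
  shows "smooth_on U f \<Longrightarrow> smooth_on U g \<Longrightarrow> (\<And>x. x \<in> U \<Longrightarrow> g x \<noteq> 0) \<Longrightarrow> smooth_on U (\<lambda>x. f x / g x)"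
  unfolding divide_inverse by (intro smooth_on_mult smooth_on_inverse)

lemma smooth_on_inverse_sqrt:
  fixes f :: "'a::euclidean_space \<Rightarrow> real"
  shows "smooth_on U f \<Longrightarrow> (\<And>x. x \<in> U \<Longrightarrow> f x > 0) \<Longrightarrow> smooth_on U (\<lambda>x. inverse (sqrt (f x)))"
  by (simp add: smooth_on_def C_k_on_inverse_sqrt)

lemma smooth_on_sqrt:
  fixes f :: "'a::euclidean_space \<Rightarrow> real"
  assumes "open U" "smooth_on U f" "\<And>x. x \<in> U \<Longrightarrow> f x > 0"
  shows "smooth_on U (\<lambda>x. sqrt (f x))"
  by (rule smooth_on_cong[OF assms(1) _ smooth_on_mult[OF assms(2) smooth_on_inverse_sqrt[OF assms(2,3)]]])
    (use assms(3) in \<open>force simp: field_simps\<close>)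

lemma smooth_on_fst [intro]: "smooth_on U f \<Longrightarrow> smooth_on U (\<lambda>x. fst (f x))"
  by (rule smooth_on_bounded_linear[OF bounded_linear_fst])

lemma smooth_on_snd [intro]: "smooth_on U f \<Longrightarrow> smooth_on U (\<lambda>x. snd (f x))"
  by (rule smooth_on_bounded_linear[OF bounded_linear_snd])

lemma smooth_on_Pair [intro]:
  assumes "smooth_on U f" "smooth_on U g"
  shows "smooth_on U (\<lambda>x. (f x, g x))"
proof -
  have "bounded_linear (\<lambda>x::'b. (x, 0::'c))" "bounded_linear (\<lambda>x::'c. (0::'b, x))"
    by (auto intro!: bounded_linear_Pair bounded_linear_ident bounded_linear_zero)
  from smooth_on_add[OF smooth_on_bounded_linear[OF this(1) assms(1)] smooth_on_bounded_linear[OF this(2) assms(2)]]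
  show ?thesis by simp
qed

lemma smooth_on_continuous_on: "smooth_on U f \<Longrightarrow> continuous_on U f"
  unfolding smooth_on_def by (drule spec[of _ 0]) simp

lemma smooth_on_has_derivative:
  assumes "smooth_on U f" "x \<in> U"
  shows "(f has_derivative frechet_derivative f (at x)) (at x)"
proof -
  have "C_k_on (Suc 0) U f" using assms unfolding smooth_on_def by blast
  then have "f differentiable at x" using assms unfolding differentiable_def by auto
  then show ?thesis using frechet_derivative_works by blast
qed

lemma smooth_on_frechet_derivative:
  assumes "open U" "smooth_on U f"
  shows "smooth_on U (\<lambda>x. frechet_derivative f (at x) v)"
  unfolding smooth_on_def
proof
  fix k
  have "C_k_on (Suc k) U f" using assms unfolding smooth_on_def by blast
  then obtain f' where "\<forall>x\<in>U. (f has_derivative f' x) (at x)" "\<forall>v. C_k_on k U (\<lambda>x. f' x v)"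
    by (rule C_k_on_SucE)
  note f' = this[rule_format]
  have "f' x = frechet_derivative f (at x)" if "x \<in> U" for x
    by (rule frechet_derivative_at[OF f'(1)[OF that]])
  then show "C_k_on k U (\<lambda>x. frechet_derivative f (at x) v)"
    using C_k_on_cong[OF assms(1) _ f'(2)[of v]] by auto
qed

lemma frechet_expand:
  fixes f :: "'a::euclidean_space \<Rightarrow> 'b::real_normed_vector"
  assumes "f differentiable at x"
  shows "frechet_derivative f (at x) v = (\<Sum>b\<in>Basis. (v \<bullet> b) *\<^sub>R frechet_derivative f (at x) b)"
proof -
  have l: "linear (frechet_derivative f (at x))" using assms linear_frechet_derivative by blast
  have "frechet_derivative f (at x) v = frechet_derivative f (at x) (\<Sum>b\<in>Basis. (v \<bullet> b) *\<^sub>R b)"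
    by (simp add: euclidean_representation)
  then show ?thesis by (simp only: linear_sum[OF l] linear_scale[OF l])
qed

section \<open>Derivatives along vector fields\<close>

definition dird :: "('a::euclidean_space \<Rightarrow> 'a) \<Rightarrow> ('a \<Rightarrow> real) \<Rightarrow> 'a \<Rightarrow> real" where
  "dird c f x = frechet_derivative f (at x) (c x)"

lemma smooth_on_differentiable: "smooth_on U f \<Longrightarrow> x \<in> U \<Longrightarrow> f differentiable at x"
  using smooth_on_has_derivative differentiable_def by blast

lemma smooth_on_dird [intro]:
  assumes "open U" "smooth_on U f" "smooth_on U c"
  shows "smooth_on U (dird c f)"
proof -
  have "smooth_on U (\<lambda>x. \<Sum>b\<in>Basis. (c x \<bullet> b) *\<^sub>R frechet_derivative f (at x) b)"
    using assms by (intro smooth_on_sum smooth_on_scaleR smooth_on_inner smooth_on_frechet_derivative) auto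
  moreover have "(\<Sum>b\<in>Basis. (c x \<bullet> b) *\<^sub>R frechet_derivative f (at x) b) = dird c f x" if "x \<in> U" for x
    unfolding dird_def using frechet_expand[OF smooth_on_differentiable[OF assms(2) that], of "c x"] by simp
  ultimately show ?thesis using smooth_on_cong[OF assms(1)] by (metis (no_types, lifting))
qed

text \<open>Two applications of the mean value theorem turn the quotient into the second derivative
  at an intermediate point. The quotient is symmetric in \<open>v\<close> and \<open>w\<close>,
  which yields the symmetry of second derivatives; with \<open>w = - v\<close> it yields the second
  derivative test.\<close>

lemma second_difference_tendsto:
  fixes f :: "'a::euclidean_space \<Rightarrow> real"
  assumes "open U" "smooth_on U f" "x \<in> U"
  shows "((\<lambda>h. (f (x + h *\<^sub>R v + h *\<^sub>R w) - f (x + h *\<^sub>R v) - f (x + h *\<^sub>R w) + f x) / h\<^sup>2)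
    \<longlongrightarrow> frechet_derivative (\<lambda>y. frechet_derivative f (at y) v) (at x) w) (at_right 0)"
proof (rule tendstoI)
  fix e :: real
  assume "0 < e"
  define fv where "fv = (\<lambda>y. frechet_derivative f (at y) v)"
  define fvw where "fvw = (\<lambda>y. frechet_derivative fv (at y) w)"
  have sfv: "smooth_on U fv" unfolding fv_def by (rule smooth_on_frechet_derivative[OF assms(1,2)])
  have sfvw: "smooth_on U fvw" unfolding fvw_def by (rule smooth_on_frechet_derivative[OF assms(1) sfv])
  have "isCont fvw x"
    using smooth_on_continuous_on[OF sfvw] assms by (simp add: continuous_on_eq_continuous_at)
  then obtain d where d: "d > 0" "\<And>y. dist y x < d \<Longrightarrow> dist (fvw y) (fvw x) < e"
    using \<open>0 < e\<close> unfolding continuous_at_eps_delta by metis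
  obtain r where r: "r > 0" "ball x r \<subseteq> U" using assms openE by blast
  define m where "m = min d r"
  \<comment> \<open>The summand 1 keeps \<open>m / N\<close> a positive radius when both vectors are
    zero.\<close>
  define N where "N = norm v + norm w + 1"
  have N: "N > 0" unfolding N_def by (smt (verit) norm_ge_zero)
  have m: "m > 0" using d r by (simp add: m_def)
  have near: "x + s *\<^sub>R v + t *\<^sub>R w \<in> U \<and> dist (x + s *\<^sub>R v + t *\<^sub>R w) x < d"
    if "0 \<le> s" "s \<le> h" "0 \<le> t" "t \<le> h" "h < m / N" for s t h
  proof -
    have "norm (s *\<^sub>R v + t *\<^sub>R w) \<le> s * norm v + t * norm w"
      using norm_triangle_ineq[of "s *\<^sub>R v" "t *\<^sub>R w"] that by simp
    also have "\<dots> \<le> h * norm v + h * norm w" using that by (intro add_mono mult_right_mono) auto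
    also have "\<dots> \<le> h * N" using that by (simp add: N_def algebra_simps)
    also have "\<dots> < m" using that N by (simp add: field_simps)
    finally have "norm (s *\<^sub>R v + t *\<^sub>R w) < m" .
    then have "dist (x + s *\<^sub>R v + t *\<^sub>R w) x < m" by (simp add: dist_norm algebra_simps)
    then have "dist (x + s *\<^sub>R v + t *\<^sub>R w) x < d" "dist (x + s *\<^sub>R v + t *\<^sub>R w) x < r"
      by (simp_all add: m_def)
    then show ?thesis using r(2) by (auto simp: dist_commute)
  qed
  have lineder: "((\<lambda>s. g (p + s *\<^sub>R z)) has_real_derivative frechet_derivative g (at (p + s *\<^sub>R z)) z) (at s)"
    if "smooth_on U g" "p + s *\<^sub>R z \<in> U" for g :: "'a \<Rightarrow> real" and p z s
  proof -
    have "((\<lambda>s. p + s *\<^sub>R z) has_derivative (\<lambda>h. h *\<^sub>R z)) (at s)"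
      by (auto intro!: derivative_eq_intros)
    from has_derivative_compose[OF this smooth_on_has_derivative[OF that]]
    have "((\<lambda>s. g (p + s *\<^sub>R z)) has_derivative (\<lambda>h. frechet_derivative g (at (p + s *\<^sub>R z)) (h *\<^sub>R z))) (at s)" .
    moreover have "linear (frechet_derivative g (at (p + s *\<^sub>R z)))"
      using linear_frechet_derivative[OF smooth_on_differentiable[OF that]] .
    ultimately show ?thesis
      by (simp add: has_field_derivative_def linear_scale mult.commute[of _ "frechet_derivative _ _ _"])
  qed
  have "dist ((f (x + h *\<^sub>R v + h *\<^sub>R w) - f (x + h *\<^sub>R v) - f (x + h *\<^sub>R w) + f x) / h\<^sup>2) (fvw x) < e"
    if h: "0 < h" "h < m / N" for h
  proof -
    define a where "a = (\<lambda>s. f (x + h *\<^sub>R w + s *\<^sub>R v) - f (x + s *\<^sub>R v))"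
    have "(a has_real_derivative fv (x + h *\<^sub>R w + s *\<^sub>R v) - fv (x + s *\<^sub>R v)) (at s)" if s: "0 \<le> s" "s \<le> h" for s
    proof -
      have 1: "x + h *\<^sub>R w + s *\<^sub>R v \<in> U" using near[of s h h] s h by (simp add: algebra_simps)
      have 2: "x + s *\<^sub>R v \<in> U" using near[of s h 0] s h by simp
      show ?thesis unfolding a_def fv_def
        by (rule DERIV_diff[OF lineder[OF assms(2) 1] lineder[OF assms(2) 2]])
    qed
    then obtain s where s: "0 < s" "s < h"
      "a h - a 0 = (h - 0) * (fv (x + h *\<^sub>R w + s *\<^sub>R v) - fv (x + s *\<^sub>R v))"
      using MVT2[of 0 h a "\<lambda>s. fv (x + h *\<^sub>R w + s *\<^sub>R v) - fv (x + s *\<^sub>R v)"] h by auto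
    have "((\<lambda>t. fv (x + s *\<^sub>R v + t *\<^sub>R w)) has_real_derivative fvw (x + s *\<^sub>R v + t *\<^sub>R w)) (at t)" if "0 \<le> t" "t \<le> h" for t
    proof -
      have "x + s *\<^sub>R v + t *\<^sub>R w \<in> U" using near[of s h t] s h that by simp
      from lineder[OF sfv this] show ?thesis by (simp add: fvw_def)
    qed
    then obtain t where t: "0 < t" "t < h"
      "fv (x + s *\<^sub>R v + h *\<^sub>R w) - fv (x + s *\<^sub>R v + 0 *\<^sub>R w) = (h - 0) * fvw (x + s *\<^sub>R v + t *\<^sub>R w)"
      using MVT2[of 0 h "\<lambda>t. fv (x + s *\<^sub>R v + t *\<^sub>R w)" "\<lambda>t. fvw (x + s *\<^sub>R v + t *\<^sub>R w)"] h by auto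
    have "a h - a 0 = h\<^sup>2 * fvw (x + s *\<^sub>R v + t *\<^sub>R w)"
      using s(3) t(3) by (simp add: algebra_simps power2_eq_square)
    moreover have "a h - a 0 = f (x + h *\<^sub>R v + h *\<^sub>R w) - f (x + h *\<^sub>R v) - f (x + h *\<^sub>R w) + f x"
      by (simp add: a_def algebra_simps)
    ultimately have "(f (x + h *\<^sub>R v + h *\<^sub>R w) - f (x + h *\<^sub>R v) - f (x + h *\<^sub>R w) + f x) / h\<^sup>2 = fvw (x + s *\<^sub>R v + t *\<^sub>R w)"
      using h by simp
    then show ?thesis using d(2)[of "x + s *\<^sub>R v + t *\<^sub>R w"] near[of s h t] s t h by simp
  qed
  then show "\<forall>\<^sub>F h in at_right 0. dist ((f (x + h *\<^sub>R v + h *\<^sub>R w) - f (x + h *\<^sub>R v) - f (x + h *\<^sub>R w) + f x) / h\<^sup>2)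
       (frechet_derivative (\<lambda>y. frechet_derivative f (at y) v) (at x) w) < e"
    unfolding eventually_at_right_field fvw_def[symmetric] fv_def[symmetric]
    using m N by (intro exI[of _ "m / N"]) (auto simp: fvw_def fv_def)
qed

lemma frechet_derivative_commute:
  fixes f :: "'a::euclidean_space \<Rightarrow> real"
  assumes "open U" "smooth_on U f" "x \<in> U"
  shows "frechet_derivative (\<lambda>y. frechet_derivative f (at y) v) (at x) w
       = frechet_derivative (\<lambda>y. frechet_derivative f (at y) w) (at x) v"
proof -
  have eq: "(\<lambda>h. (f (x + h *\<^sub>R w + h *\<^sub>R v) - f (x + h *\<^sub>R w) - f (x + h *\<^sub>R v) + f x) / h\<^sup>2)
    = (\<lambda>h. (f (x + h *\<^sub>R v + h *\<^sub>R w) - f (x + h *\<^sub>R v) - f (x + h *\<^sub>R w) + f x) / h\<^sup>2)"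
    by (rule ext) (simp add: add.commute add.left_commute add.assoc)
  show ?thesis
    using second_difference_tendsto[OF assms, of v w] second_difference_tendsto[OF assms, of w v]
    unfolding eq by (rule tendsto_unique[OF trivial_limit_at_right_real])
qed

text \<open>Splits off the first order term caused by the variation of the inner field
  \<open>d\<close>. The remaining sum is the second derivative as a symmetric bilinear form, so it
  cancels in commutators.\<close>

lemma dird_dird:
  fixes f :: "'a::euclidean_space \<Rightarrow> real"
  assumes U: "open U" and f: "smooth_on U f" and d: "smooth_on U d" and x: "x \<in> U"
  shows "dird c (dird d f) x = frechet_derivative f (at x) (frechet_derivative d (at x) (c x))
     + (\<Sum>b\<in>Basis. \<Sum>e\<in>Basis. (d x \<bullet> b) * (c x \<bullet> e) * frechet_derivative (\<lambda>y. frechet_derivative f (at y) b) (at x) e)"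
proof -
  define fb where "fb b = (\<lambda>y. frechet_derivative f (at y) b)" for b
  have sfb: "smooth_on U (fb b)" for b unfolding fb_def by (rule smooth_on_frechet_derivative[OF U f])
  have eq: "dird d f y = (\<Sum>b\<in>Basis. (d y \<bullet> b) * fb b y)" if "y \<in> U" for y
    unfolding dird_def fb_def using frechet_expand[OF smooth_on_differentiable[OF f that], of "d y"] by simp
  have "((\<lambda>y. \<Sum>b\<in>Basis. (d y \<bullet> b) * fb b y) has_derivative
     (\<lambda>h. \<Sum>b\<in>Basis. (d x \<bullet> b) * frechet_derivative (fb b) (at x) h + (frechet_derivative d (at x) h \<bullet> b) * fb b x)) (at x)"
    by (intro has_derivative_sum has_derivative_mult has_derivative_inner_left
       smooth_on_has_derivative[OF sfb x] smooth_on_has_derivative[OF d x])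
  then have "(dird d f has_derivative
     (\<lambda>h. \<Sum>b\<in>Basis. (d x \<bullet> b) * frechet_derivative (fb b) (at x) h + (frechet_derivative d (at x) h \<bullet> b) * fb b x)) (at x)"
    by (rule has_derivative_transform_within_open[OF _ U x]) (simp add: eq)
  then have "dird c (dird d f) x = (\<Sum>b\<in>Basis. (d x \<bullet> b) * frechet_derivative (fb b) (at x) (c x) + (frechet_derivative d (at x) (c x) \<bullet> b) * fb b x)"
    unfolding dird_def[of c] by (simp add: frechet_derivative_at[symmetric])
  moreover have "frechet_derivative f (at x) (frechet_derivative d (at x) (c x)) = (\<Sum>b\<in>Basis. (frechet_derivative d (at x) (c x) \<bullet> b) * fb b x)"
    using frechet_expand[OF smooth_on_differentiable[OF f x], of "frechet_derivative d (at x) (c x)"] by (simp add: fb_def)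
  moreover have "frechet_derivative (fb b) (at x) (c x) = (\<Sum>e\<in>Basis. (c x \<bullet> e) * frechet_derivative (fb b) (at x) e)" for b
    using frechet_expand[OF smooth_on_differentiable[OF sfb x], of _ "c x"] by simp
  ultimately show ?thesis
    by (simp add: sum.distrib fb_def sum_distrib_left mult.assoc)
qed

text \<open>The argument of the derivative on the right is the Lie bracket of the two
  fields.\<close>

lemma dird_commutator:
  fixes f :: "'a::euclidean_space \<Rightarrow> real"
  assumes U: "open U" and f: "smooth_on U f" and c: "smooth_on U c" and d: "smooth_on U d" and x: "x \<in> U"
  shows "dird c (dird d f) x - dird d (dird c f) x
    = frechet_derivative f (at x) (frechet_derivative d (at x) (c x) - frechet_derivative c (at x) (d x))"
proof -
  have l: "linear (frechet_derivative f (at x))"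
    by (rule linear_frechet_derivative[OF smooth_on_differentiable[OF f x]])
  have "(\<Sum>b\<in>Basis. \<Sum>e\<in>Basis. (d x \<bullet> b) * (c x \<bullet> e) * frechet_derivative (\<lambda>y. frechet_derivative f (at y) b) (at x) e)
     = (\<Sum>b\<in>Basis. \<Sum>e\<in>Basis. (c x \<bullet> b) * (d x \<bullet> e) * frechet_derivative (\<lambda>y. frechet_derivative f (at y) b) (at x) e)"
    by (subst sum.swap) (simp add: frechet_derivative_commute[OF U f x] mult.commute[of "c x \<bullet> _"])
  then show ?thesis
    unfolding dird_dird[OF U f d x] dird_dird[OF U f c x] by (simp add: linear_diff[OF l])
qed

text \<open>A relation that carries differentiability together with the value along
  \<open>c\<close>, so that the derivative of a long expression can be assembled by resolution with
  one rule per operation.\<close>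

definition has_dird :: "('a::euclidean_space \<Rightarrow> 'a) \<Rightarrow> 'a set \<Rightarrow> ('a \<Rightarrow> real) \<Rightarrow> ('a \<Rightarrow> real) \<Rightarrow> bool" where
  "has_dird c U f f' \<longleftrightarrow> (\<forall>x\<in>U. \<exists>L. (f has_derivative L) (at x) \<and> L (c x) = f' x)"

lemma has_dird_dird:
  "smooth_on U f \<Longrightarrow> has_dird c U f (dird c f)"
  unfolding has_dird_def dird_def by (auto intro: smooth_on_has_derivative)

lemma has_dird_imp_dird: "has_dird c U f f' \<Longrightarrow> x \<in> U \<Longrightarrow> dird c f x = f' x"
  unfolding has_dird_def dird_def by (metis frechet_derivative_at)

lemma dird_cong:
  assumes "open U" "\<And>x. x \<in> U \<Longrightarrow> f x = g x" "x \<in> U" "f differentiable at x"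
  shows "dird c f x = dird c g x"
proof -
  have "(f has_derivative frechet_derivative f (at x)) (at x)" using assms(4) frechet_derivative_works by blast
  then have "(g has_derivative frechet_derivative f (at x)) (at x)"
    by (rule has_derivative_transform_within_open[OF _ assms(1,3,2)])
  then show ?thesis unfolding dird_def by (simp add: frechet_derivative_at[symmetric])
qed

lemma has_dird_const: "has_dird c U (\<lambda>x. k) (\<lambda>x. 0)"
  unfolding has_dird_def by (auto intro!: exI[of _ "\<lambda>h. 0"])

lemma has_dird_add:
  assumes "has_dird c U f f'" "has_dird c U g g'"
  shows "has_dird c U (\<lambda>x. f x + g x) (\<lambda>x. f' x + g' x)"
  unfolding has_dird_def
proof
  fix x assume "x \<in> U"
  then obtain L M where "(f has_derivative L) (at x)" "L (c x) = f' x" "(g has_derivative M) (at x)" "M (c x) = g' x"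
    using assms unfolding has_dird_def by blast
  then show "\<exists>L. ((\<lambda>x. f x + g x) has_derivative L) (at x) \<and> L (c x) = f' x + g' x"
    by (intro exI[of _ "\<lambda>h. L h + M h"]) (auto intro: has_derivative_add)
qed

lemma has_dird_mult:
  assumes "has_dird c U f f'" "has_dird c U g g'"
  shows "has_dird c U (\<lambda>x. f x * g x) (\<lambda>x. f x * g' x + f' x * g x)"
  unfolding has_dird_def
proof
  fix x assume "x \<in> U"
  then obtain L M where "(f has_derivative L) (at x)" "L (c x) = f' x" "(g has_derivative M) (at x)" "M (c x) = g' x"
    using assms unfolding has_dird_def by blast
  then show "\<exists>L. ((\<lambda>x. f x * g x) has_derivative L) (at x) \<and> L (c x) = f x * g' x + f' x * g x"
    by (intro exI[of _ "\<lambda>h. f x * M h + L h * g x"]) (auto intro: has_derivative_mult)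
qed

lemma has_dird_chain:
  assumes "has_dird c U f f'" "\<And>x. x \<in> U \<Longrightarrow> (\<phi> has_real_derivative \<phi>' (f x)) (at (f x))"
  shows "has_dird c U (\<lambda>x. \<phi> (f x)) (\<lambda>x. \<phi>' (f x) * f' x)"
  unfolding has_dird_def
proof
  fix x assume x: "x \<in> U"
  then obtain L where L: "(f has_derivative L) (at x)" "L (c x) = f' x"
    using assms unfolding has_dird_def by blast
  have "((\<lambda>x. \<phi> (f x)) has_derivative (\<lambda>h. \<phi>' (f x) * L h)) (at x)"
    using has_derivative_compose[OF L(1)] assms(2)[OF x] by (auto simp: has_field_derivative_def)
  then show "\<exists>L. ((\<lambda>x. \<phi> (f x)) has_derivative L) (at x) \<and> L (c x) = \<phi>' (f x) * f' x"
    using L(2) by (intro exI[of _ "\<lambda>h. \<phi>' (f x) * L h"]) auto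
qed

lemma has_dird_power:
  assumes "has_dird c U f f'"
  shows "has_dird c U (\<lambda>x. f x ^ n) (\<lambda>x. real n * f x ^ (n - 1) * f' x)"
  by (rule has_dird_chain[OF assms]) (auto intro!: derivative_eq_intros)

lemma has_dird_minus:
  assumes "has_dird c U f f'"
  shows "has_dird c U (\<lambda>x. - f x) (\<lambda>x. - f' x)"
  using has_dird_mult[OF has_dird_const[of _ _ "-1"] assms] by simp

lemma has_dird_diff:
  assumes "has_dird c U f f'" "has_dird c U g g'"
  shows "has_dird c U (\<lambda>x. f x - g x) (\<lambda>x. f' x - g' x)"
  using has_dird_add[OF assms(1) has_dird_minus[OF assms(2)]] by simp

section \<open>The algebraic inequality at a maximum\<close>

lemma trinomial_nonneg:
  fixes x y p q r :: real
  assumes "0 < p" "q\<^sup>2 \<le> 4 * p * r"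
  shows "0 \<le> p * x\<^sup>2 + q * (x * y) + r * y\<^sup>2"
proof -
  have "0 \<le> (2 * p * x + q * y)\<^sup>2 + (4 * p * r - q\<^sup>2) * y\<^sup>2" using assms by simp
  also have "\<dots> = 4 * p * (p * x\<^sup>2 + q * (x * y) + r * y\<^sup>2)" by (simp add: power2_eq_square algebra_simps)
  finally show ?thesis using assms(1) by (simp add: zero_le_mult_iff)
qed

text \<open>All coefficients of even powers of \<open>y\<close> are positive and every negative one
  stands at an odd power, between two even ones. It is absorbed by its neighbours through a
  nonnegative binary quadratic form.\<close>

lemma gradient_poly_pos:
  fixes x y :: real
  assumes "0 < x" "0 < y"
  shows "0 < 54*x^18 - 336*x^17*y + 756*x^16*y^2 - 2040*x^15*y^3 + 5232*x^14*y^4 - 4632*x^13*y^5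
    + 16056*x^12*y^6 - 3672*x^11*y^7 + 29652*x^10*y^8 + 1032*x^9*y^9 + 28704*x^8*y^10 - 936*x^7*y^11
    + 12912*x^6*y^12 - 2568*x^5*y^13 + 3048*x^4*y^14 - 648*x^3*y^15 + 342*x^2*y^16 - 24*x*y^17 + 12*y^18"
proof -
  let ?T = "\<lambda>p q r. p * x\<^sup>2 + q * (x * y) + r * y\<^sup>2"
  \<comment> \<open>In each triple the last entry is the least integer that makes the discriminant
    condition true. What is left of that coefficient of the polynomial is the first entry of the
    next triple. The chain restarts after the coefficient of \<open>x^10*y^8\<close>, where the next
    odd coefficient is positive.\<close>
  have "0 \<le> ?T 54 (-336) 523" "0 \<le> ?T 233 (-2040) 4466" "0 \<le> ?T 766 (-4632) 7003"
    "0 \<le> ?T 9053 (-3672) 373" "0 \<le> ?T 28704 (-936) 8" "0 \<le> ?T 12904 (-2568) 128"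
    "0 \<le> ?T 2920 (-648) 36" "0 \<le> ?T 306 (-24) 1"
    by (rule trinomial_nonneg; simp)+
  then have "0 \<le> x^16 * ?T 54 (-336) 523" "0 \<le> x^14*y^2 * ?T 233 (-2040) 4466" "0 \<le> x^12*y^4 * ?T 766 (-4632) 7003"
    "0 \<le> x^10*y^6 * ?T 9053 (-3672) 373" "0 \<le> x^6*y^10 * ?T 28704 (-936) 8" "0 \<le> x^4*y^12 * ?T 12904 (-2568) 128"
    "0 \<le> x^2*y^14 * ?T 2920 (-648) 36" "0 \<le> y^16 * ?T 306 (-24) 1"
    using assms by (intro mult_nonneg_nonneg; simp)+
  moreover have "0 < 29279*x^10*y^8 + 1032*x^9*y^9 + 11*y^18"
    using assms by (intro add_pos_pos) auto
  ultimately have "0 < x^16 * ?T 54 (-336) 523 + x^14*y^2 * ?T 233 (-2040) 4466 + x^12*y^4 * ?T 766 (-4632) 7003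
    + x^10*y^6 * ?T 9053 (-3672) 373 + x^6*y^10 * ?T 28704 (-936) 8 + x^4*y^12 * ?T 12904 (-2568) 128
    + x^2*y^14 * ?T 2920 (-648) 36 + y^16 * ?T 306 (-24) 1 + (29279*x^10*y^8 + 1032*x^9*y^9 + 11*y^18)"
    by linarith
  also have "\<dots> = 54*x^18 - 336*x^17*y + 756*x^16*y^2 - 2040*x^15*y^3 + 5232*x^14*y^4 - 4632*x^13*y^5
    + 16056*x^12*y^6 - 3672*x^11*y^7 + 29652*x^10*y^8 + 1032*x^9*y^9 + 28704*x^8*y^10 - 936*x^7*y^11
    + 12912*x^6*y^12 - 2568*x^5*y^13 + 3048*x^4*y^14 - 648*x^3*y^15 + 342*x^2*y^16 - 24*x*y^17 + 12*y^18"
    by algebra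
  finally show ?thesis .
qed

text \<open>Here \<open>\<Phi>(s, P) = k (s\<^sup>8 - 4 P s\<^sup>6) - n (P s\<^sup>4 - 3 P\<^sup>2 s\<^sup>2 + 2 P\<^sup>3)\<close>, with \<open>k\<close> and \<open>n\<close> the values of the
  subtracted and the leading polynomial at the maximum, so that \<open>\<Phi>\<close> vanishes there.
  The quantities \<open>S5\<close>, \<dots> are the first and second partial derivatives of \<open>\<Phi>(s, P)\<close>
  at \<open>s = x + y\<close>, \<open>P = x * y\<close>, divided by a power of \<open>s\<close>.\<close>
locale phi_values =
  fixes x y s S5 P6 SS4 SP5 PP6 :: real
  assumes pos: "0 < x" "0 < y" "x \<noteq> y"
    and s_def: "s = x + y"
    and S5: "S5 = 4*x^7*y - 2*x^6*y^2 + 20*x^5*y^3 + 4*x^4*y^4 + 20*x^3*y^5 - 2*x^2*y^6 + 4*x*y^7"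
    and P6: "P6 = - (x^6 + 9*x^4*y^2 + 4*x^3*y^3 + 9*x^2*y^4 + y^6)"
    and SS4: "SS4 = 44*x^7*y + 30*x^6*y^2 + 172*x^5*y^3 + 132*x^4*y^4 + 172*x^3*y^5 + 30*x^2*y^6 + 44*x*y^7"
    and SP5: "SP5 = - (4*x^6 + 20*x^5*y + 20*x^4*y^2 + 56*x^3*y^3 + 20*x^2*y^4 + 20*x*y^5 + 4*y^6)"
    and PP6: "PP6 = 6*x^4 - 12*x^3*y + 12*x^2*y^2 - 12*x*y^3 + 6*y^4"
begin

text \<open>These are the terms free of derivatives of the radii: \<open>2 * s^3\<close> and
  \<open>s^4\<close> come from the evolution of \<open>s\<close> and \<open>P\<close>, and
  \<open>3 * s^2 * (s^2 - 4 * (x * y))\<close> from trading second derivatives of \<open>s\<close>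
  for those of \<open>P\<close>. The factor \<open>(x-y)^2\<close> splits off with a positive
  cofactor.\<close>

lemma zeroth_order_nonpos: "2 * s^3 * (s^5 * S5) + (s^6 * P6) * (4 * s^4 - 12 * s^2 * (x * y)) \<le> 0"
proof -
  have "2 * s^3 * (s^5 * S5) + (s^6 * P6) * (4 * s^4 - 12 * s^2 * (x * y))
     = s^8 * (2 * S5 + P6 * (4 * s^2 - 12 * (x * y)))" by algebra
  also have "2 * S5 + P6 * (4 * s^2 - 12 * (x * y))
    = - 4 * (x-y)^2 * (x^6 - x^5*y + 8*x^4*y^2 + 2*x^3*y^3 + 8*x^2*y^4 - x*y^5 + y^6)"
    unfolding S5 P6 s_def by algebra
  finally have e: "2 * s^3 * (s^5 * S5) + (s^6 * P6) * (4 * s^4 - 12 * s^2 * (x * y))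
    = - (4 * s^8 * (x-y)^2 * (x^6 - x^5*y + 8*x^4*y^2 + 2*x^3*y^3 + 8*x^2*y^4 - x*y^5 + y^6))" by algebra
  have "0 \<le> x^4 * (1 * x^2 + (-1) * (x*y) + 1 * y^2) + y^4 * (1 * x^2 + (-1) * (x*y) + 1 * y^2)
     + 7*x^4*y^2 + 2*x^3*y^3 + 7*x^2*y^4"
    using pos by (intro add_nonneg_nonneg mult_nonneg_nonneg trinomial_nonneg) auto
  also have "\<dots> = x^6 - x^5*y + 8*x^4*y^2 + 2*x^3*y^3 + 8*x^2*y^4 - x*y^5 + y^6" by algebra
  finally have "0 \<le> 4 * s^8 * (x-y)^2 * (x^6 - x^5*y + 8*x^4*y^2 + 2*x^3*y^3 + 8*x^2*y^4 - x*y^5 + y^6)"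
    by (intro mult_nonneg_nonneg) auto
  then show ?thesis using e by linarith
qed

text \<open>Criticality confines \<open>(a, b)\<close>, the derivatives of the two radii in one
  direction, to a line. On that line the quadratic form is a square times a fixed polynomial in
  \<open>x\<close> and \<open>y\<close>. The last bracket is the second derivative of
  \<open>\<Phi>\<close> in \<open>(s, P)\<close>, subtracted in order to use the Hessian
  condition.\<close>

lemma gradient_form_nonpos:
  assumes crit: "(s^5 * S5) * (a + b) + (s^6 * P6) * (y * a + x * b) = 0"
  defines "s1 \<equiv> a + b" and "P1 \<equiv> y * a + x * b"
  shows "6 * s * (s^5 * S5) * s1^2 + 6 * s * (s^6 * P6) * y * s1^2 - 6 * s^2 * (s^6 * P6) * (a * b - b^2)
    - 3 * s^2 * ((s^4 * SS4) * s1^2 + 2 * (s^5 * SP5) * s1 * P1 + (s^6 * PP6) * P1^2) \<le> 0"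
proof -
  \<comment> \<open>Up to the factor \<open>s^5\<close>, the coefficients of \<open>a\<close> and
    \<open>b\<close> in \<open>crit\<close> are \<open>- (x - y) * b0\<close> and
    \<open>(x - y) * a0\<close>. So \<open>(a0, b0)\<close> spans the solutions; cancelling
    \<open>x - y\<close> is where unequal radii enter.\<close>
  define a0 where "a0 = -(x^7) + 2*x^6*y - 9*x^5*y^2 - 2*x^4*y^3 - 11*x^3*y^4 - 3*x*y^6"
  define b0 where "b0 = - (3*x^6*y + 11*x^4*y^3 + 2*x^3*y^4 + 9*x^2*y^5 - 2*x*y^6 + y^7)"
  have s: "s > 0" using pos s_def by simp
  have "S5 + s * y * P6 = - (x - y) * b0" unfolding S5 P6 s_def b0_def by algebra
  moreover have "S5 + s * x * P6 = (x - y) * a0" unfolding S5 P6 s_def a0_def by algebra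
  moreover have "s^5 * ((S5 + s * y * P6) * a + (S5 + s * x * P6) * b) = 0" using crit by algebra
  ultimately have "s^5 * (x - y) * (a0 * b - b0 * a) = 0" by algebra
  then have ab: "a0 * b = b0 * a" using s pos(3) by simp
  have "0 < 3*x^6*y + 11*x^4*y^3 + 2*x^3*y^4 + y^5 * (8 * x^2 + (1 * x^2 + (-2) * (x*y) + 1 * y^2))"
    using pos by (intro add_pos_nonneg mult_nonneg_nonneg add_nonneg_nonneg trinomial_nonneg) auto
  also have "\<dots> = - b0" unfolding b0_def by algebra
  finally have b0: "b0 \<noteq> 0" by simp
  define k where "k = b / b0"
  have b: "b = k * b0" and a: "a = k * a0" using ab b0 by (auto simp: k_def field_simps)
  \<comment> \<open>After division by \<open>s^5\<close>, \<open>crit\<close> reads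
    \<open>S5 * s1 + s * P6 * P1 = 0\<close>. Hence \<open>(s1, P1)\<close> is parallel to
    \<open>(s * P6, - S5)\<close>, and the scale is again \<open>k\<close>.\<close>
  have s1: "s1 = k * s * P6" unfolding s1_def a b a0_def b0_def P6 s_def by algebra
  have P1: "P1 = - (k * S5)" unfolding P1_def a b a0_def b0_def S5 by algebra
  have "6 * s * (s^5 * S5) * s1^2 + 6 * s * (s^6 * P6) * y * s1^2 - 6 * s^2 * (s^6 * P6) * (a * b - b^2)
    - 3 * s^2 * ((s^4 * SS4) * s1^2 + 2 * (s^5 * SP5) * s1 * P1 + (s^6 * PP6) * P1^2)
    = s^8 * k^2 * (6 * S5 * P6^2 + 6 * s * y * P6^3 - 6 * P6 * (b0 * (a0 - b0)) - 3 * SS4 * P6^2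
       + 6 * SP5 * P6 * S5 - 3 * PP6 * S5^2)"
    unfolding s1 P1 a b by algebra
  also have "6 * S5 * P6^2 + 6 * s * y * P6^3 - 6 * P6 * (b0 * (a0 - b0)) - 3 * SS4 * P6^2
       + 6 * SP5 * P6 * S5 - 3 * PP6 * S5^2
    = - (y^2 * (54*x^18 - 336*x^17*y + 756*x^16*y^2 - 2040*x^15*y^3 + 5232*x^14*y^4 - 4632*x^13*y^5
    + 16056*x^12*y^6 - 3672*x^11*y^7 + 29652*x^10*y^8 + 1032*x^9*y^9 + 28704*x^8*y^10 - 936*x^7*y^11
    + 12912*x^6*y^12 - 2568*x^5*y^13 + 3048*x^4*y^14 - 648*x^3*y^15 + 342*x^2*y^16 - 24*x*y^17 + 12*y^18))"
    unfolding S5 P6 SS4 SP5 PP6 s_def a0_def b0_def by algebra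
  also have "s^8 * k^2 * \<dots> \<le> 0"
    using gradient_poly_pos[OF pos(1,2)] s by (simp add: mult_le_0_iff zero_le_mult_iff)
  finally show ?thesis .
qed

end

section \<open>The support function equation\<close>

context phi_values
begin

text \<open>All five polynomials are symmetric in \<open>x\<close> and \<open>y\<close>, so the
  second direction is the first one with the radii exchanged.\<close>

lemma swapped: "phi_values y x s S5 P6 SS4 SP5 PP6"
  using pos by unfold_locales (simp_all add: s_def S5 P6 SS4 SP5 PP6)

text \<open>Fourth derivatives occur only in \<open>s11\<close>, \<open>s22\<close>,
  \<open>P11\<close> and \<open>P22\<close>. By \<open>rel\<close> the weighted sum in
  \<open>Pt\<close> becomes \<open>P11 + P22\<close>; then \<open>3 * s^2\<close> times the two
  Hessian conditions accounts for all of them, and the rest separates into zeroth order terms and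
  one gradient form per direction.\<close>

lemma evolution_inequality:
  assumes st: "st = 2 * s^3 + 3 * s^2 * (s11 + s22) + 6 * s * ((a1 + b1)^2 + (a2 + b2)^2)"
    and Pt: "Pt = s^4 + 3 * s^2 * (y * s11 + x * s22) + 6 * s * (y * (a1 + b1)^2 + x * (a2 + b2)^2)"
    and rel: "y * s11 + x * s22 = P11 + P22 + s^2 - 4 * (x * y) - 2 * (a1 * b1 - b2^2 + a2 * b2 - b1^2)"
    and grad1: "(s^5 * S5) * (a1 + b1) + (s^6 * P6) * (y * a1 + x * b1) = 0"
    and grad2: "(s^5 * S5) * (a2 + b2) + (s^6 * P6) * (x * a2 + y * b2) = 0"
    and hess1: "(s^5 * S5) * s11 + (s^6 * P6) * P11 + ((s^4 * SS4) * (a1 + b1)^2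
       + 2 * (s^5 * SP5) * (a1 + b1) * (y * a1 + x * b1) + (s^6 * PP6) * (y * a1 + x * b1)^2) \<le> 0"
    and hess2: "(s^5 * S5) * s22 + (s^6 * P6) * P22 + ((s^4 * SS4) * (a2 + b2)^2
       + 2 * (s^5 * SP5) * (a2 + b2) * (x * a2 + y * b2) + (s^6 * PP6) * (x * a2 + y * b2)^2) \<le> 0"
  shows "(s^5 * S5) * st + (s^6 * P6) * Pt \<le> 0"
proof -
  have s2: "0 \<le> 3 * s^2" by simp
  have "(s^5 * S5) * st + (s^6 * P6) * Pt
    = (2 * s^3 * (s^5 * S5) + (s^6 * P6) * (4 * s^4 - 12 * s^2 * (x * y)))
    + 3 * s^2 * ((s^5 * S5) * s11 + (s^6 * P6) * P11 + ((s^4 * SS4) * (a1 + b1)^2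
       + 2 * (s^5 * SP5) * (a1 + b1) * (y * a1 + x * b1) + (s^6 * PP6) * (y * a1 + x * b1)^2))
    + 3 * s^2 * ((s^5 * S5) * s22 + (s^6 * P6) * P22 + ((s^4 * SS4) * (a2 + b2)^2
       + 2 * (s^5 * SP5) * (a2 + b2) * (x * a2 + y * b2) + (s^6 * PP6) * (x * a2 + y * b2)^2))
    + (6 * s * (s^5 * S5) * (a1 + b1)^2 + 6 * s * (s^6 * P6) * y * (a1 + b1)^2 - 6 * s^2 * (s^6 * P6) * (a1 * b1 - b1^2)
      - 3 * s^2 * ((s^4 * SS4) * (a1 + b1)^2 + 2 * (s^5 * SP5) * (a1 + b1) * (y * a1 + x * b1) + (s^6 * PP6) * (y * a1 + x * b1)^2))
    + (6 * s * (s^5 * S5) * (a2 + b2)^2 + 6 * s * (s^6 * P6) * x * (a2 + b2)^2 - 6 * s^2 * (s^6 * P6) * (a2 * b2 - b2^2)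
      - 3 * s^2 * ((s^4 * SS4) * (a2 + b2)^2 + 2 * (s^5 * SP5) * (a2 + b2) * (x * a2 + y * b2) + (s^6 * PP6) * (x * a2 + y * b2)^2))"
    unfolding st Pt rel by (simp add: algebra_simps power_numeral_reduce)
  also have "\<dots> \<le> 0"
    using zeroth_order_nonpos mult_nonneg_nonpos[OF s2 hess1] mult_nonneg_nonpos[OF s2 hess2]
      gradient_form_nonpos[OF grad1] phi_values.gradient_form_nonpos[OF swapped grad2]
    by linarith
  finally show ?thesis .
qed

end

section \<open>Second-order jets of the curvature functions along a field\<close>

lemma has_dird_eq:
  "has_dird c U f f' \<Longrightarrow> (\<And>x. x \<in> U \<Longrightarrow> f' x = g' x) \<Longrightarrow> has_dird c U f g'"
  unfolding has_dird_def by metis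

lemmas has_dird_intros = has_dird_const has_dird_add has_dird_diff has_dird_mult has_dird_power

lemma has_dird_inverse_sqrt:
  assumes "has_dird c U f f'" "\<And>x. x \<in> U \<Longrightarrow> f x > 0"
  shows "has_dird c U (\<lambda>x. inverse (sqrt (f x))) (\<lambda>x. - (inverse (sqrt (f x)) ^ 3) * f' x / 2)"
proof (rule has_dird_eq[OF has_dird_chain[OF assms(1), where \<phi> = "\<lambda>v. inverse (sqrt v)" and \<phi>' = "\<lambda>v. - (inverse (sqrt v) ^ 3) / 2"]])
  fix x assume "x \<in> U"
  then have "f x > 0" by (rule assms(2))
  then show "((\<lambda>v. inverse (sqrt v)) has_real_derivative - (inverse (sqrt (f x)) ^ 3) / 2) (at (f x))"
    by (auto intro!: derivative_eq_intros simp: field_simps power3_eq_cube)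
qed simp

lemma has_dird_sqrt:
  assumes "has_dird c U f f'" "\<And>x. x \<in> U \<Longrightarrow> f x > 0"
  shows "has_dird c U (\<lambda>x. sqrt (f x)) (\<lambda>x. inverse (sqrt (f x)) * f' x / 2)"
proof (rule has_dird_eq[OF has_dird_chain[OF assms(1), where \<phi> = sqrt and \<phi>' = "\<lambda>v. inverse (sqrt v) / 2"]])
  fix x assume "x \<in> U"
  then have "f x > 0" by (rule assms(2))
  then show "(sqrt has_real_derivative inverse (sqrt (f x)) / 2) (at (f x))"
    by (auto intro!: derivative_eq_intros)
qed simp

text \<open>Instantiated with \<open>(\<alpha>, \<beta>)\<close> equal to \<open>(1, 0)\<close>,
  \<open>(0, 1)\<close> and \<open>(0, 0)\<close> for the two spatial fields and the time field. The
  functions \<open>w\<close>, \<open>s\<close>, \<open>P\<close>, \<open>F\<close> and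
  \<open>\<Phi>\<close> do not mention the direction, so the three instances share them and only the
  primed functions differ.\<close>

locale direction_jet =
  fixes c :: "'a::euclidean_space \<Rightarrow> 'a" and U y1 y2 \<alpha> \<beta> A A' A'' B B' B'' C C' C''
  assumes y: "has_dird c U y1 (\<lambda>x. \<alpha>)" "has_dird c U y2 (\<lambda>x. \<beta>)"
    and A: "has_dird c U A A'" "has_dird c U A' A''"
    and B: "has_dird c U B B'" "has_dird c U B' B''"
    and C: "has_dird c U C C'" "has_dird c U C' C''"
begin

definition "w = (\<lambda>x. sqrt (1 + (y1 x)^2 + (y2 x)^2))"
definition "iw = (\<lambda>x. inverse (sqrt (1 + (y1 x)^2 + (y2 x)^2)))"
definition "w' = (\<lambda>x. (\<alpha> * y1 x + \<beta> * y2 x) * iw x)"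
definition "w'' = (\<lambda>x. (\<alpha>^2 + \<beta>^2) * iw x - (\<alpha> * y1 x + \<beta> * y2 x)^2 * iw x ^ 3)"
definition "T = (\<lambda>x. (1 + (y1 x)^2) * A x + 2 * y1 x * y2 x * B x + (1 + (y2 x)^2) * C x)"
definition "T' = (\<lambda>x. 2 * \<alpha> * y1 x * A x + (1 + (y1 x)^2) * A' x + 2 * (\<alpha> * y2 x + \<beta> * y1 x) * B x
  + 2 * y1 x * y2 x * B' x + 2 * \<beta> * y2 x * C x + (1 + (y2 x)^2) * C' x)"
definition "T'' = (\<lambda>x. 2 * \<alpha>^2 * A x + 4 * \<alpha> * y1 x * A' x + (1 + (y1 x)^2) * A'' x + 4 * \<alpha> * \<beta> * B x
  + 4 * (\<alpha> * y2 x + \<beta> * y1 x) * B' x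
  + 2 * y1 x * y2 x * B'' x + 2 * \<beta>^2 * C x + 4 * \<beta> * y2 x * C' x + (1 + (y2 x)^2) * C'' x)"
definition "s = (\<lambda>x. w x * T x)"
definition "s' = (\<lambda>x. w' x * T x + w x * T' x)"
definition "s'' = (\<lambda>x. w'' x * T x + 2 * w' x * T' x + w x * T'' x)"
definition "P = (\<lambda>x. w x ^ 4 * (A x * C x - (B x)^2))"
definition "P' = (\<lambda>x. 4 * w x ^ 3 * w' x * (A x * C x - (B x)^2) + w x ^ 4 * (A' x * C x + A x * C' x - 2 * B x * B' x))"
definition "P'' = (\<lambda>x. (12 * w x ^ 2 * (w' x)^2 + 4 * w x ^ 3 * w'' x) * (A x * C x - (B x)^2)
  + 8 * w x ^ 3 * w' x * (A' x * C x + A x * C' x - 2 * B x * B' x)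
  + w x ^ 4 * (A'' x * C x + 2 * A' x * C' x + A x * C'' x - 2 * (B' x)^2 - 2 * B x * B'' x))"

lemma pos: "0 < 1 + (y1 x)^2 + (y2 x)^2"
  by (smt (verit) zero_le_power2)

lemma w: "has_dird c U w w'"
  unfolding w_def
  by (rule has_dird_eq, rule has_dird_sqrt, (rule has_dird_intros y pos)+)
    (simp add: w'_def iw_def algebra_simps)

lemma iw: "has_dird c U iw (\<lambda>x. - (iw x ^ 3) * (\<alpha> * y1 x + \<beta> * y2 x))"
  unfolding iw_def
  by (rule has_dird_eq, rule has_dird_inverse_sqrt, (rule has_dird_intros y pos)+)
    (simp add: add_divide_distrib diff_divide_distrib algebra_simps)

lemma w': "has_dird c U w' w''"
  unfolding w'_def
  by (rule has_dird_eq, (rule has_dird_intros y iw)+)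
    (simp add: w''_def algebra_simps power_numeral_reduce)

lemma T: "has_dird c U T T'"
  unfolding T_def
  by (rule has_dird_eq, (rule has_dird_intros y A B C)+) (simp add: T'_def algebra_simps)

lemma T': "has_dird c U T' T''"
  unfolding T'_def
  by (rule has_dird_eq, (rule has_dird_intros y A B C)+) (simp add: T''_def algebra_simps power2_eq_square)

lemma s: "has_dird c U s s'"
  unfolding s_def
  by (rule has_dird_eq, (rule has_dird_intros w T)+) (simp add: s'_def algebra_simps)

lemma s': "has_dird c U s' s''"
  unfolding s'_def
  by (rule has_dird_eq, (rule has_dird_intros w w' T T')+) (simp add: s''_def algebra_simps)

lemma P: "has_dird c U P P'"
  unfolding P_def
  by (rule has_dird_eq, (rule has_dird_intros w A B C)+) (simp add: P'_def algebra_simps)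

lemma P': "has_dird c U P' P''"
  unfolding P'_def
  by (rule has_dird_eq, (rule has_dird_intros w w' A B C)+)
    (simp add: P''_def algebra_simps power_numeral_reduce)

definition "F = (\<lambda>x. w x * s x ^ 3)"
definition "F' = (\<lambda>x. w' x * s x ^ 3 + 3 * w x * s x ^ 2 * s' x)"
definition "F'' = (\<lambda>x. w'' x * s x ^ 3 + 6 * w' x * s x ^ 2 * s' x + 6 * w x * s x * (s' x)^2 + 3 * w x * s x ^ 2 * s'' x)"

lemma F: "has_dird c U F F'"
  unfolding F_def
  by (rule has_dird_eq, (rule has_dird_intros w s)+) (simp add: F'_def algebra_simps)

lemma F': "has_dird c U F' F''"
  unfolding F'_def
  by (rule has_dird_eq, (rule has_dird_intros w w' s s')+) (simp add: F''_def algebra_simps power_numeral_reduce)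

definition "\<Phi> k n = (\<lambda>x. k * (s x ^ 8 - 4 * P x * s x ^ 6) - n * (P x * s x ^ 4 - 3 * P x ^ 2 * s x ^ 2 + 2 * P x ^ 3))"
definition "\<Phi>S k n = (\<lambda>x. k * (8 * s x ^ 7 - 24 * P x * s x ^ 5) - n * (4 * P x * s x ^ 3 - 6 * P x ^ 2 * s x))"
definition "\<Phi>P k n = (\<lambda>x. - 4 * k * s x ^ 6 - n * (s x ^ 4 - 6 * P x * s x ^ 2 + 6 * P x ^ 2))"
definition "\<Phi>SS k n = (\<lambda>x. k * (56 * s x ^ 6 - 120 * P x * s x ^ 4) - n * (12 * P x * s x ^ 2 - 6 * P x ^ 2))"
definition "\<Phi>SP k n = (\<lambda>x. - 24 * k * s x ^ 5 - n * (4 * s x ^ 3 - 12 * P x * s x))"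
definition "\<Phi>PP k n = (\<lambda>x. - n * (- 6 * s x ^ 2 + 12 * P x))"

lemma \<Phi>: "has_dird c U (\<Phi> k n) (\<lambda>x. \<Phi>S k n x * s' x + \<Phi>P k n x * P' x)"
  unfolding \<Phi>_def
  by (rule has_dird_eq, (rule has_dird_intros s P)+)
    (simp add: \<Phi>S_def \<Phi>P_def algebra_simps power_numeral_reduce)

lemma \<Phi>S: "has_dird c U (\<Phi>S k n) (\<lambda>x. \<Phi>SS k n x * s' x + \<Phi>SP k n x * P' x)"
  unfolding \<Phi>S_def
  by (rule has_dird_eq, (rule has_dird_intros s P)+)
    (simp add: \<Phi>SS_def \<Phi>SP_def algebra_simps power_numeral_reduce)

lemma \<Phi>P: "has_dird c U (\<Phi>P k n) (\<lambda>x. \<Phi>SP k n x * s' x + \<Phi>PP k n x * P' x)"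
  unfolding \<Phi>P_def
  by (rule has_dird_eq, (rule has_dird_intros s P)+)
    (simp add: \<Phi>PP_def \<Phi>SP_def algebra_simps power_numeral_reduce)

lemma \<Phi>': "has_dird c U (\<lambda>x. \<Phi>S k n x * s' x + \<Phi>P k n x * P' x)
   (\<lambda>x. \<Phi>S k n x * s'' x + \<Phi>P k n x * P'' x
     + (\<Phi>SS k n x * (s' x)^2 + 2 * \<Phi>SP k n x * s' x * P' x + \<Phi>PP k n x * (P' x)^2))"
  by (rule has_dird_eq, (rule has_dird_intros \<Phi>S \<Phi>P s s' P P')+)
    (simp add: algebra_simps power2_eq_square)

context
  fixes x0
  assumes y0: "y1 x0 = 0" "y2 x0 = 0" and B0: "B x0 = 0"
begin

lemma values_at:
  "w x0 = 1" "w' x0 = 0" "w'' x0 = \<alpha>^2 + \<beta>^2"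
  "s x0 = A x0 + C x0" "s' x0 = A' x0 + C' x0"
  "s'' x0 = (\<alpha>^2 + \<beta>^2) * (A x0 + C x0) + 2 * \<alpha>^2 * A x0 + 2 * \<beta>^2 * C x0 + A'' x0 + C'' x0"
  "P x0 = A x0 * C x0" "P' x0 = A' x0 * C x0 + A x0 * C' x0"
  "P'' x0 = 4 * (\<alpha>^2 + \<beta>^2) * (A x0 * C x0) + A'' x0 * C x0 + 2 * A' x0 * C' x0 + A x0 * C'' x0 - 2 * (B' x0)^2"
  unfolding s_def s'_def s''_def P_def P'_def P''_def T_def T'_def T''_def w_def w'_def w''_def iw_def
  by (simp_all add: y0 B0 algebra_simps)

lemma F''_at:
  "F'' x0 = (\<alpha>^2 + \<beta>^2) * s x0 ^ 3 + 6 * s x0 * (s' x0)^2 + 3 * s x0 ^ 2 * s'' x0"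
  unfolding F''_def values_at(1,2,3) by simp

end

end

section \<open>Evolution at a spatial maximum in commuting coordinate fields\<close>

lemma has_dird_differentiable: "has_dird c U f f' \<Longrightarrow> x \<in> U \<Longrightarrow> f differentiable at x"
  unfolding has_dird_def differentiable_def by blast

lemma has_dird_second:
  assumes "open U" "has_dird c U f f'" "has_dird c U f' f''" "x \<in> U"
  shows "dird c (dird c f) x = f'' x"
proof -
  have "dird c f' x = dird c (dird c f) x"
    by (rule dird_cong[OF assms(1) _ assms(4) has_dird_differentiable[OF assms(3,4)]])
      (simp add: has_dird_imp_dird[OF assms(2)])
  then show ?thesis using has_dird_imp_dird[OF assms(3,4)] by simp
qed

lemma dird_cong2:
  assumes "open U" "\<And>x. x \<in> U \<Longrightarrow> f x = g x" "x \<in> U" "smooth_on U f" "smooth_on U d"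
  shows "dird c (dird d f) x = dird c (dird d g) x"
  by (rule dird_cong[OF assms(1) _ assms(3)])
    (auto intro: dird_cong[OF assms(1,2)] smooth_on_differentiable[OF assms(4)] smooth_on_differentiable[OF smooth_on_dird[OF assms(1,4,5)]] assms(3))

text \<open>The fields stand for the coordinate fields of \<open>(y1, y2, t)\<close>. They are
  described only by their commutation and their action on \<open>y1\<close> and \<open>y2\<close>,
  so that the computation at the maximum is free of the embedding.\<close>

locale flow_coords =
  fixes U :: "'a::euclidean_space set" and c1 c2 c3 :: "'a \<Rightarrow> 'a" and \<sigma> y1 y2 :: "'a \<Rightarrow> real"
  assumes U: "open U"
    and c: "smooth_on U c1" "smooth_on U c2" "smooth_on U c3"
    and comm12: "\<And>f x. smooth_on U f \<Longrightarrow> x \<in> U \<Longrightarrow> dird c1 (dird c2 f) x = dird c2 (dird c1 f) x"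
    and comm13: "\<And>f x. smooth_on U f \<Longrightarrow> x \<in> U \<Longrightarrow> dird c1 (dird c3 f) x = dird c3 (dird c1 f) x"
    and comm23: "\<And>f x. smooth_on U f \<Longrightarrow> x \<in> U \<Longrightarrow> dird c2 (dird c3 f) x = dird c3 (dird c2 f) x"
    and y1: "has_dird c1 U y1 (\<lambda>x. 1)" "has_dird c2 U y1 (\<lambda>x. 0)" "has_dird c3 U y1 (\<lambda>x. 0)"
    and y2: "has_dird c1 U y2 (\<lambda>x. 0)" "has_dird c2 U y2 (\<lambda>x. 1)" "has_dird c3 U y2 (\<lambda>x. 0)"
    and \<sigma>: "smooth_on U \<sigma>"
begin

definition "A = dird c1 (dird c1 \<sigma>)"
definition "B = dird c1 (dird c2 \<sigma>)"
definition "C = dird c2 (dird c2 \<sigma>)"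

lemma smooth_ABC: "smooth_on U A" "smooth_on U B" "smooth_on U C"
  unfolding A_def B_def C_def by (intro smooth_on_dird U c \<sigma>)+

lemma jet: 
  assumes "has_dird c' U y1 (\<lambda>x. \<alpha>)" "has_dird c' U y2 (\<lambda>x. \<beta>)" "smooth_on U c'"
  shows "direction_jet c' U y1 y2 \<alpha> \<beta> A (dird c' A) (dird c' (dird c' A)) B (dird c' B) (dird c' (dird c' B))
      C (dird c' C) (dird c' (dird c' C))"
  by unfold_locales (intro assms has_dird_dird smooth_on_dird smooth_ABC U)+

sublocale D1: direction_jet c1 U y1 y2 1 0 A "dird c1 A" "dird c1 (dird c1 A)" B "dird c1 B" "dird c1 (dird c1 B)"
      C "dird c1 C" "dird c1 (dird c1 C)"
  by (rule jet[OF y1(1) y2(1) c(1)])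

sublocale D2: direction_jet c2 U y1 y2 0 1 A "dird c2 A" "dird c2 (dird c2 A)" B "dird c2 B" "dird c2 (dird c2 B)"
      C "dird c2 C" "dird c2 (dird c2 C)"
  by (rule jet[OF y1(2) y2(2) c(2)])

sublocale D3: direction_jet c3 U y1 y2 0 0 A "dird c3 A" "dird c3 (dird c3 A)" B "dird c3 B" "dird c3 (dird c3 B)"
      C "dird c3 C" "dird c3 (dird c3 C)"
  by (rule jet[OF y1(3) y2(3) c(3)])

lemma third: 
  assumes "x \<in> U"
  shows "dird c1 B x = dird c2 A x" "dird c2 B x = dird c1 C x"
proof -
  note s = smooth_on_dird[OF U _ c(1)] smooth_on_dird[OF U _ c(2)]
  have "dird c1 B x = dird c1 (dird c2 (dird c1 \<sigma>)) x"
    unfolding B_def by (rule dird_cong[OF U comm12[OF \<sigma>] assms]) (auto intro: smooth_on_differentiable[OF _ assms] s \<sigma>)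
  also have "\<dots> = dird c2 A x" unfolding A_def by (rule comm12[OF s(1)[OF \<sigma>] assms])
  finally show "dird c1 B x = dird c2 A x" .
  show "dird c2 B x = dird c1 C x"
    unfolding B_def C_def by (rule comm12[OF s(2)[OF \<sigma>] assms, symmetric])
qed

text \<open>Both sides are the derivative of \<open>\<sigma>\<close> taken twice in each direction.
  This is what lets the weighted second derivatives of \<open>s\<close> be replaced by those of
  \<open>P\<close>.\<close>

lemma fourth: 
  assumes x: "x \<in> U"
  shows "dird c1 (dird c1 C) x = dird c2 (dird c2 A) x"
proof -
  note s = smooth_on_dird[OF U _ c(1)] smooth_on_dird[OF U _ c(2)]
  have "dird c1 (dird c1 C) x = dird c1 (dird c2 B) x"
    by (rule dird_cong[OF U third(2)[symmetric] x]) (auto intro: smooth_on_differentiable[OF _ x] s smooth_ABC)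
  also have "\<dots> = dird c2 (dird c1 B) x" by (rule comm12[OF smooth_ABC(2) x])
  also have "\<dots> = dird c2 (dird c2 A) x"
    by (rule dird_cong[OF U third(1) x]) (auto intro: smooth_on_differentiable[OF _ x] s smooth_ABC)
  finally show ?thesis .
qed

context
  assumes flow: "\<And>x. x \<in> U \<Longrightarrow> dird c3 \<sigma> x = D1.F x"
begin

text \<open>Since \<open>c3\<close> commutes with \<open>c'\<close>, both spatial derivatives can be
  moved onto \<open>dird c3 \<sigma>\<close>, which \<open>flow\<close> replaces by
  \<open>F\<close>.\<close>

lemma dird_c3_second:
  assumes x: "x \<in> U" and c': "smooth_on U c'"
    and comm: "\<And>f x. smooth_on U f \<Longrightarrow> x \<in> U \<Longrightarrow> dird c' (dird c3 f) x = dird c3 (dird c' f) x"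
  shows "dird c3 (dird c' (dird c' \<sigma>)) x = dird c' (dird c' D1.F) x"
proof -
  note s = smooth_on_dird[OF U _ c'] smooth_on_dird[OF U _ c(3)]
  have "dird c3 (dird c' (dird c' \<sigma>)) x = dird c' (dird c3 (dird c' \<sigma>)) x"
    by (rule comm[symmetric, OF s(1)[OF \<sigma>] x])
  also have "\<dots> = dird c' (dird c' (dird c3 \<sigma>)) x"
    by (rule dird_cong[OF U comm[symmetric, OF \<sigma>] x]) (auto intro: smooth_on_differentiable[OF _ x] s \<sigma>)
  also have "\<dots> = dird c' (dird c' D1.F) x"
    by (rule dird_cong2[OF U flow x s(2)[OF \<sigma>] c'])
  finally show ?thesis .
qed

lemma time_derivative_nonpos:
  assumes x0: "x0 \<in> U" and y0: "y1 x0 = 0" "y2 x0 = 0" and B0: "B x0 = 0"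
    and pos: "0 < A x0" "0 < C x0" "A x0 \<noteq> C x0"
    and k: "k = D1.P x0 * ((D1.s x0)^2 - 2 * D1.P x0) * ((D1.s x0)^2 - D1.P x0)"
    and n: "n = (D1.s x0)^6 * ((D1.s x0)^2 - 4 * D1.P x0)"
    and crit: "dird c1 (D1.\<Phi> k n) x0 = 0" "dird c2 (D1.\<Phi> k n) x0 = 0"
    and hess: "dird c1 (dird c1 (D1.\<Phi> k n)) x0 \<le> 0" "dird c2 (dird c2 (D1.\<Phi> k n)) x0 \<le> 0"
  shows "dird c3 (D1.\<Phi> k n) x0 \<le> 0"
proof -
  \<comment> \<open>At the base point \<open>w = 1\<close> and the mixed entry is 0, so
    \<open>x\<close> and \<open>y\<close> are the principal radii of curvature.\<close>
  define x where "x = A x0"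
  define y where "y = C x0"
  define S5 P6 SS4 SP5 PP6 where
    "S5 = 4*x^7*y - 2*x^6*y^2 + 20*x^5*y^3 + 4*x^4*y^4 + 20*x^3*y^5 - 2*x^2*y^6 + 4*x*y^7"
    and "P6 = - (x^6 + 9*x^4*y^2 + 4*x^3*y^3 + 9*x^2*y^4 + y^6)"
    and "SS4 = 44*x^7*y + 30*x^6*y^2 + 172*x^5*y^3 + 132*x^4*y^4 + 172*x^3*y^5 + 30*x^2*y^6 + 44*x*y^7"
    and "SP5 = - (4*x^6 + 20*x^5*y + 20*x^4*y^2 + 56*x^3*y^3 + 20*x^2*y^4 + 20*x*y^5 + 4*y^6)"
    and "PP6 = 6*x^4 - 12*x^3*y + 12*x^2*y^2 - 12*x*y^3 + 6*y^4"
  note defs = this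
  define s where "s = x + y"
  interpret phi_values x y s S5 P6 SS4 SP5 PP6
    using pos by unfold_locales (simp_all add: x_def y_def defs s_def)
  note v1 = D1.values_at[OF y0 B0, folded x_def y_def, folded s_def]
  note v2 = D2.values_at[OF y0 B0, folded x_def y_def, folded s_def]
  note v3 = D3.values_at[OF y0 B0, folded x_def y_def, folded s_def]
  have k': "k = x * y * (s^2 - 2 * (x * y)) * (s^2 - x * y)" and n': "n = s^6 * (s^2 - 4 * (x * y))"
    using k n unfolding v1 by simp_all
  have ph: "D1.\<Phi>S k n x0 = s^5 * S5" "D1.\<Phi>P k n x0 = s^6 * P6" "D1.\<Phi>SS k n x0 = s^4 * SS4"
    "D1.\<Phi>SP k n x0 = s^5 * SP5" "D1.\<Phi>PP k n x0 = s^6 * PP6"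
    unfolding D1.\<Phi>S_def D1.\<Phi>P_def D1.\<Phi>SS_def D1.\<Phi>SP_def D1.\<Phi>PP_def v1 k' n' defs s_def
    by algebra+
  define a1 b1 a2 b2 where "a1 = dird c1 A x0" and "b1 = dird c1 C x0" and "a2 = dird c2 C x0" and "b2 = dird c2 A x0"
  note ab = this
  have d1: "D1.s' x0 = a1 + b1" "D1.P' x0 = y * a1 + x * b1"
    and d2: "D2.s' x0 = a2 + b2" "D2.P' x0 = x * a2 + y * b2"
    unfolding v1 v2 ab by (simp_all add: algebra_simps)
  have grad1: "(s^5 * S5) * (a1 + b1) + (s^6 * P6) * (y * a1 + x * b1) = 0"
    using crit(1) unfolding has_dird_imp_dird[OF D1.\<Phi> x0] d1 ph .
  have grad2: "(s^5 * S5) * (a2 + b2) + (s^6 * P6) * (x * a2 + y * b2) = 0"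
    using crit(2) unfolding has_dird_imp_dird[OF D2.\<Phi> x0] d2 ph .
  have hess1: "(s^5 * S5) * D1.s'' x0 + (s^6 * P6) * D1.P'' x0 + ((s^4 * SS4) * (a1 + b1)^2
       + 2 * (s^5 * SP5) * (a1 + b1) * (y * a1 + x * b1) + (s^6 * PP6) * (y * a1 + x * b1)^2) \<le> 0"
    using hess(1) unfolding has_dird_second[OF U D1.\<Phi> D1.\<Phi>' x0] d1 ph .
  have hess2: "(s^5 * S5) * D2.s'' x0 + (s^6 * P6) * D2.P'' x0 + ((s^4 * SS4) * (a2 + b2)^2
       + 2 * (s^5 * SP5) * (a2 + b2) * (x * a2 + y * b2) + (s^6 * PP6) * (x * a2 + y * b2)^2) \<le> 0"
    using hess(2) unfolding has_dird_second[OF U D2.\<Phi> D2.\<Phi>' x0] d2 ph .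
  \<comment> \<open>By the symmetry of third derivatives \<open>B\<close> has derivatives
    \<open>b2\<close> and \<open>b1\<close> in the two directions; these give the squares. Each
    square is later grouped with the other direction than the one that produced it.\<close>
  have rel: "y * D1.s'' x0 + x * D2.s'' x0 = D1.P'' x0 + D2.P'' x0 + s^2 - 4 * (x * y) - 2 * (a1 * b1 - b2^2 + a2 * b2 - b1^2)"
    unfolding v1 v2 third[OF x0] fourth[OF x0] ab[symmetric]
    by (simp add: s_def algebra_simps power2_eq_square)
  have A3: "dird c3 A x0 = s^3 + 6 * s * (a1 + b1)^2 + 3 * s^2 * D1.s'' x0"
    using dird_c3_second[OF x0 c(1) comm13] has_dird_second[OF U D1.F D1.F' x0] D1.F''_at[OF y0 B0]
    unfolding A_def[symmetric] d1 v1(4) by simp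
  have C3: "dird c3 C x0 = s^3 + 6 * s * (a2 + b2)^2 + 3 * s^2 * D2.s'' x0"
    using dird_c3_second[OF x0 c(2) comm23] has_dird_second[OF U D2.F D2.F' x0] D2.F''_at[OF y0 B0]
    unfolding C_def[symmetric] d2 v2(4) by simp
  have st: "D3.s' x0 = 2 * s^3 + 3 * s^2 * (D1.s'' x0 + D2.s'' x0) + 6 * s * ((a1 + b1)^2 + (a2 + b2)^2)"
    unfolding v3 A3 C3 by (simp add: algebra_simps)
  have Pt: "D3.P' x0 = s^4 + 3 * s^2 * (y * D1.s'' x0 + x * D2.s'' x0) + 6 * s * (y * (a1 + b1)^2 + x * (a2 + b2)^2)"
  proof -
    have "D3.P' x0 = (x + y) * s^3 + 3 * s^2 * (y * D1.s'' x0 + x * D2.s'' x0) + 6 * s * (y * (a1 + b1)^2 + x * (a2 + b2)^2)"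
      unfolding v3 A3 C3 by (simp add: algebra_simps)
    then show ?thesis by (simp add: s_def[symmetric] power_numeral_reduce)
  qed
  show ?thesis
    unfolding has_dird_imp_dird[OF D3.\<Phi> x0] ph
    by (rule evolution_inequality[OF st Pt rel grad1 grad2 hess1 hess2])
qed

end

end

section \<open>Gnomonic coordinates of the Gauss map\<close>

type_synonym coords = "real \<times> real \<times> real"

abbreviation pu :: "(coords \<Rightarrow> real) \<Rightarrow> coords \<Rightarrow> real" where "pu \<equiv> dird (\<lambda>_. (1, 0, 0))"
abbreviation pv :: "(coords \<Rightarrow> real) \<Rightarrow> coords \<Rightarrow> real" where "pv \<equiv> dird (\<lambda>_. (0, 1, 0))"
abbreviation pt :: "(coords \<Rightarrow> real) \<Rightarrow> coords \<Rightarrow> real" where "pt \<equiv> dird (\<lambda>_. (0, 0, 1))"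

lemma frechet_coords:
  fixes f :: "coords \<Rightarrow> real"
  assumes "f differentiable at x"
  shows "frechet_derivative f (at x) v = fst v * pu f x + fst (snd v) * pv f x + snd (snd v) * pt f x"
proof -
  have l: "linear (frechet_derivative f (at x))" using assms by (rule linear_frechet_derivative)
  have "v = fst v *\<^sub>R (1, 0, 0) + (fst (snd v) *\<^sub>R (0, 1, 0) + snd (snd v) *\<^sub>R (0, 0, 1))"
    by (simp add: prod_eq_iff)
  then have "frechet_derivative f (at x) v = frechet_derivative f (at x) (fst v *\<^sub>R (1, 0, 0) + (fst (snd v) *\<^sub>R (0, 1, 0) + snd (snd v) *\<^sub>R (0, 0, 1)))"
    by simp
  then show ?thesis unfolding dird_def by (simp add: linear_add[OF l] linear_scale[OF l] del: scaleR_Pair)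
qed

lemma dird_coords:
  fixes f :: "coords \<Rightarrow> real"
  assumes "f differentiable at x"
  shows "dird c f x = fst (c x) * pu f x + fst (snd (c x)) * pv f x + snd (snd (c x)) * pt f x"
  unfolding dird_def[of c] by (rule frechet_coords[OF assms])

lemma linear_system_trivial:
  fixes a b c d p q :: real
  assumes "a * p + b * q = 0" "c * p + d * q = 0" "a * d - b * c \<noteq> 0"
  shows "p = 0" "q = 0"
proof -
  have "(a * d - b * c) * p = 0" "(a * d - b * c) * q = 0" using assms(1,2) by algebra+
  then show "p = 0" "q = 0" using assms(3) by simp_all
qed

text \<open>The functions \<open>f1\<close>, \<open>f2\<close>, \<open>f3\<close> are the components
  of the moving surface in a fixed orthonormal frame. The condition \<open>graph\<close> keeps the
  third component of the normal away from 0, as gnomonic coordinates require.\<close>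

locale graph_coords =
  fixes V :: "coords set" and f1 f2 f3 :: "coords \<Rightarrow> real"
  assumes V: "open V" and f: "smooth_on V f1" "smooth_on V f2" "smooth_on V f3"
    and graph: "\<And>x. x \<in> V \<Longrightarrow> pu f1 x * pv f2 x - pv f1 x * pu f2 x \<noteq> 0"
begin

text \<open>\<open>(m1, m2, m3)\<close> is the cross product of the two tangent vectors; dividing by
  \<open>m3\<close> gives the gnomonic coordinates of its direction.\<close>

definition "m1 = (\<lambda>x. pu f2 x * pv f3 x - pv f2 x * pu f3 x)"
definition "m2 = (\<lambda>x. pu f3 x * pv f1 x - pv f3 x * pu f1 x)"
definition "m3 = (\<lambda>x. pu f1 x * pv f2 x - pv f1 x * pu f2 x)"
definition "y1 = (\<lambda>x. m1 x / m3 x)"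
definition "y2 = (\<lambda>x. m2 x / m3 x)"
definition "J = (\<lambda>x. pu y1 x * pv y2 x - pv y1 x * pu y2 x)"
text \<open>\<open>c1\<close> and \<open>c2\<close> are the columns of the inverse Jacobian matrix
  of \<open>(y1, y2)\<close> in \<open>(u, v)\<close>, that is, the fields of differentiation by
  \<open>y1\<close> and \<open>y2\<close>. \<open>c3\<close> is the time direction corrected so as
  to keep \<open>y1\<close> and \<open>y2\<close> fixed.\<close>

definition "c1 = (\<lambda>x. (pv y2 x / J x, - pu y2 x / J x, 0 :: real))"
definition "c2 = (\<lambda>x. (- pv y1 x / J x, pu y1 x / J x, 0 :: real))"
definition "c3 = (\<lambda>x. (0, 0, 1) - (pt y1 x *\<^sub>R c1 x + pt y2 x *\<^sub>R c2 x))"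
text \<open>The support function in its extension homogeneous of degree one, evaluated at
  \<open>(y1, y2, 1)\<close>; hence \<open>w\<close> times its value at the unit normal.\<close>

definition "\<sigma> = (\<lambda>x. f1 x * y1 x + f2 x * y2 x + f3 x)"

definition "ff11 = (\<lambda>x. (pu f1 x)^2 + (pu f2 x)^2 + (pu f3 x)^2)"
definition "ff12 = (\<lambda>x. pu f1 x * pv f1 x + pu f2 x * pv f2 x + pu f3 x * pv f3 x)"
definition "ff22 = (\<lambda>x. (pv f1 x)^2 + (pv f2 x)^2 + (pv f3 x)^2)"
definition "w = (\<lambda>x. sqrt (1 + (y1 x)^2 + (y2 x)^2))"
text \<open>Coefficients of the second fundamental form for the unit normal
  \<open>(y1, y2, 1) / w\<close>, with \<open>p\<close> and \<open>q\<close> ranging over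
  \<open>pu\<close> and \<open>pv\<close>.\<close>

definition "sf p q = (\<lambda>x. - (p (q f1) x * y1 x + p (q f2) x * y2 x + p (q f3) x) / w x)"
definition "Hf = (\<lambda>x. (ff22 x * sf pu pu x - 2 * ff12 x * sf pv pu x + ff11 x * sf pv pv x) / (ff11 x * ff22 x - (ff12 x)^2))"
definition "Kf = (\<lambda>x. (sf pu pu x * sf pv pv x - (sf pv pu x)^2) / (ff11 x * ff22 x - (ff12 x)^2))"

lemma smooth_p [intro]: "smooth_on V g \<Longrightarrow> smooth_on V (pu g)" "smooth_on V g \<Longrightarrow> smooth_on V (pv g)" "smooth_on V g \<Longrightarrow> smooth_on V (pt g)"
  by (rule smooth_on_dird[OF V], auto)+

lemma smooth_m: "smooth_on V m1" "smooth_on V m2" "smooth_on V m3"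
  unfolding m1_def m2_def m3_def by (intro smooth_on_diff smooth_on_mult smooth_p f)+

lemma w_pos: "w x > 0" "(w x)^2 = 1 + (y1 x)^2 + (y2 x)^2"
proof -
  have "0 < 1 + (y1 x)^2 + (y2 x)^2" by (smt (verit) zero_le_power2)
  then show "w x > 0" "(w x)^2 = 1 + (y1 x)^2 + (y2 x)^2" unfolding w_def by auto
qed

lemma m3: "x \<in> V \<Longrightarrow> m3 x \<noteq> 0"
  unfolding m3_def by (rule graph)

lemma smooth_y: "smooth_on V y1" "smooth_on V y2"
  unfolding y1_def y2_def by (intro smooth_on_divide smooth_m m3; assumption)+

lemma diff: "x \<in> V \<Longrightarrow> smooth_on V g \<Longrightarrow> g differentiable at x"
  by (rule smooth_on_differentiable)

lemma tangent:
  assumes "x \<in> V"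
  shows "pu f1 x * y1 x + pu f2 x * y2 x + pu f3 x = 0" "pv f1 x * y1 x + pv f2 x * y2 x + pv f3 x = 0"
proof -
  have "pu f1 x * m1 x + pu f2 x * m2 x + pu f3 x * m3 x = 0" "pv f1 x * m1 x + pv f2 x * m2 x + pv f3 x * m3 x = 0"
    unfolding m1_def m2_def m3_def by algebra+
  then have "(pu f1 x * y1 x + pu f2 x * y2 x + pu f3 x) * m3 x = 0" "(pv f1 x * y1 x + pv f2 x * y2 x + pv f3 x) * m3 x = 0"
    using m3[OF assms] unfolding y1_def y2_def by (simp_all add: field_simps)
  then show "pu f1 x * y1 x + pu f2 x * y2 x + pu f3 x = 0" "pv f1 x * y1 x + pv f2 x * y2 x + pv f3 x = 0"
    using m3[OF assms] by simp_all
qed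

text \<open>Differentiating the tangency relations moves the second derivatives onto the normal.\<close>
lemma tangent_deriv:
  assumes x: "x \<in> V"
  shows "dird c (pu f1) x * y1 x + dird c (pu f2) x * y2 x + dird c (pu f3) x = - (pu f1 x * dird c y1 x + pu f2 x * dird c y2 x)"
    "dird c (pv f1) x * y1 x + dird c (pv f2) x * y2 x + dird c (pv f3) x = - (pv f1 x * dird c y1 x + pv f2 x * dird c y2 x)"
proof -
  have *: "dird c a x * y1 x + dird c b x * y2 x + dird c d x = - (a x * dird c y1 x + b x * dird c y2 x)"
    if t: "\<And>x. x \<in> V \<Longrightarrow> a x * y1 x + b x * y2 x + d x = 0" and s: "smooth_on V a" "smooth_on V b" "smooth_on V d" for a b d
  proof -
    have "has_dird c V (\<lambda>x. a x * y1 x + b x * y2 x + d x)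
       (\<lambda>x. a x * dird c y1 x + dird c a x * y1 x + (b x * dird c y2 x + dird c b x * y2 x) + dird c d x)"
      by (intro has_dird_add has_dird_mult has_dird_dird smooth_y s)
    from has_dird_imp_dird[OF this x] dird_cong[OF V t x has_dird_differentiable[OF this x], of c]
      has_dird_imp_dird[OF has_dird_const[of c V 0] x]
    show ?thesis by simp
  qed
  show "dird c (pu f1) x * y1 x + dird c (pu f2) x * y2 x + dird c (pu f3) x = - (pu f1 x * dird c y1 x + pu f2 x * dird c y2 x)"
    by (rule *[OF tangent(1)]) (auto intro: f)
  show "dird c (pv f1) x * y1 x + dird c (pv f2) x * y2 x + dird c (pv f3) x = - (pv f1 x * dird c y1 x + pv f2 x * dird c y2 x)"
    by (rule *[OF tangent(2)]) (auto intro: f)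
qed

lemma sf_eq:
  assumes x: "x \<in> V"
  shows "sf pu pu x = (pu f1 x * pu y1 x + pu f2 x * pu y2 x) / w x"
    "sf pv pu x = (pu f1 x * pv y1 x + pu f2 x * pv y2 x) / w x"
    "sf pv pv x = (pv f1 x * pv y1 x + pv f2 x * pv y2 x) / w x"
  unfolding sf_def tangent_deriv[OF x] by simp_all

lemma pv_pu: "x \<in> V \<Longrightarrow> smooth_on V g \<Longrightarrow> pv (pu g) x = pu (pv g) x"
  unfolding dird_def by (rule frechet_derivative_commute[OF V])

lemma sf_sym:
  assumes x: "x \<in> V"
  shows "sf pv pu x = (pv f1 x * pu y1 x + pv f2 x * pu y2 x) / w x"
proof -
  have "sf pv pu x = sf pu pv x" unfolding sf_def using pv_pu[OF x] f by simp
  also have "\<dots> = (pv f1 x * pu y1 x + pv f2 x * pu y2 x) / w x"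
    unfolding sf_def tangent_deriv[OF x] by simp
  finally show ?thesis .
qed

text \<open>Up to the factor \<open>1 / w\<close>, the second fundamental form is the transposed
  Jacobian matrix of \<open>(f1, f2)\<close> times that of \<open>(y1, y2)\<close>; each of the two
  expressions for the mixed entry is used once. Positive Gauss curvature therefore forces
  \<open>J\<close> to be nonzero.\<close>

lemma det_sf: 
  assumes x: "x \<in> V"
  shows "(w x)^2 * (sf pu pu x * sf pv pv x - (sf pv pu x)^2) = m3 x * J x"
proof -
  have "(w x)^2 * (sf pu pu x * sf pv pv x - (sf pv pu x)^2)
     = (w x * sf pu pu x) * (w x * sf pv pv x) - (w x * sf pv pu x) * (w x * sf pv pu x)"
    by (simp add: power2_eq_square algebra_simps)
  also have "\<dots> = (pu f1 x * pu y1 x + pu f2 x * pu y2 x) * (pv f1 x * pv y1 x + pv f2 x * pv y2 x)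
     - (pu f1 x * pv y1 x + pu f2 x * pv y2 x) * (pv f1 x * pu y1 x + pv f2 x * pu y2 x)"
    using sf_eq[OF x] sf_sym[OF x] w_pos(1)[of x] by simp
  also have "\<dots> = m3 x * J x" unfolding m3_def J_def by algebra
  finally show ?thesis .
qed

end

section \<open>Coordinate fields, support function and curvatures where the Gauss map is
  regular\<close>

locale regular_graph_coords = graph_coords +
  assumes J: "\<And>x. x \<in> V \<Longrightarrow> J x \<noteq> 0"
begin

lemma smooth_J: "smooth_on V J"
  unfolding J_def by (intro smooth_on_diff smooth_on_mult smooth_p smooth_y)

lemma smooth_c: "smooth_on V c1" "smooth_on V c2" "smooth_on V c3"
proof -
  show 1: "smooth_on V c1" "smooth_on V c2"
    unfolding c1_def c2_def
    by (intro smooth_on_Pair smooth_on_divide smooth_on_minus smooth_p smooth_y smooth_J smooth_on_const J; assumption)+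
  show "smooth_on V c3" unfolding c3_def
    by (intro smooth_on_diff smooth_on_add smooth_on_scaleR smooth_p smooth_y smooth_on_const 1)
qed

lemma dird_c:
  assumes x: "x \<in> V" and g: "smooth_on V g"
  shows "dird c1 g x = (pv y2 x * pu g x - pu y2 x * pv g x) / J x"
    "dird c2 g x = (pu y1 x * pv g x - pv y1 x * pu g x) / J x"
    "dird c3 g x = pt g x - pt y1 x * dird c1 g x - pt y2 x * dird c2 g x"
proof -
  have c: "fst (c1 x) = pv y2 x / J x" "fst (snd (c1 x)) = - pu y2 x / J x" "snd (snd (c1 x)) = 0"
    "fst (c2 x) = - pv y1 x / J x" "fst (snd (c2 x)) = pu y1 x / J x" "snd (snd (c2 x)) = 0"
    unfolding c1_def c2_def by simp_all
  have c3: "fst (c3 x) = - (pt y1 x * fst (c1 x) + pt y2 x * fst (c2 x))"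
    "fst (snd (c3 x)) = - (pt y1 x * fst (snd (c1 x)) + pt y2 x * fst (snd (c2 x)))" "snd (snd (c3 x)) = 1"
    unfolding c3_def by (simp_all add: c)
  note d = dird_coords[OF diff[OF x g]]
  show "dird c1 g x = (pv y2 x * pu g x - pu y2 x * pv g x) / J x"
    "dird c2 g x = (pu y1 x * pv g x - pv y1 x * pu g x) / J x"
    unfolding d[of c1] d[of c2] c using J[OF x] by (simp_all add: field_simps)
  show "dird c3 g x = pt g x - pt y1 x * dird c1 g x - pt y2 x * dird c2 g x"
    unfolding d[of c1] d[of c2] d[of c3] c3 by (simp add: c algebra_simps)
qed

lemma dird_y:
  assumes x: "x \<in> V"
  shows "dird c1 y1 x = 1" "dird c2 y1 x = 0" "dird c3 y1 x = 0"
    "dird c1 y2 x = 0" "dird c2 y2 x = 1" "dird c3 y2 x = 0"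
proof -
  note d = dird_c[OF x smooth_y(1)] dird_c[OF x smooth_y(2)]
  show 1: "dird c1 y1 x = 1" "dird c2 y1 x = 0" "dird c1 y2 x = 0" "dird c2 y2 x = 1"
    using J[OF x] unfolding d by (simp_all add: J_def algebra_simps)
  show "dird c3 y1 x = 0" "dird c3 y2 x = 0" unfolding d(3,6) 1 by simp_all
qed

text \<open>Both fields send \<open>y1\<close>, \<open>y2\<close> and the time coordinate to
  constants, so their bracket annihilates all three. The differentials of these functions are
  independent because \<open>J\<close> is nonzero, hence the bracket is 0.\<close>

lemma bracket_zero:
  assumes x: "x \<in> V" and c: "smooth_on V c" "smooth_on V d"
    and const: "\<And>z. z \<in> V \<Longrightarrow> dird c y1 z = k1" "\<And>z. z \<in> V \<Longrightarrow> dird c y2 z = k2" "\<And>z. z \<in> V \<Longrightarrow> snd (snd (c z)) = k3"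
    "\<And>z. z \<in> V \<Longrightarrow> dird d y1 z = l1" "\<And>z. z \<in> V \<Longrightarrow> dird d y2 z = l2" "\<And>z. z \<in> V \<Longrightarrow> snd (snd (d z)) = l3"
    and g: "smooth_on V g"
  shows "dird c (dird d g) x = dird d (dird c g) x"
proof -
  define B where "B = frechet_derivative d (at x) (c x) - frechet_derivative c (at x) (d x)"
  have brk: "dird c (dird d h) x - dird d (dird c h) x = frechet_derivative h (at x) B" if "smooth_on V h" for h :: "coords \<Rightarrow> real"
    unfolding B_def by (rule dird_commutator[OF V that c x])
  have const0: "dird e h x = 0" if h: "\<And>z. z \<in> V \<Longrightarrow> h z = k" for e and h :: "coords \<Rightarrow> real" and k
  proof -
    have "dird e (\<lambda>_. k) x = dird e h x"
      by (rule dird_cong[OF V h[symmetric] x]) auto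
    then show ?thesis using has_dird_imp_dird[OF has_dird_const[of e V k] x] by simp
  qed
  define \<tau> where "\<tau> = (\<lambda>z::coords. snd (snd z))"
  have bl: "bounded_linear \<tau>" unfolding \<tau>_def by (intro bounded_linear_snd_comp bounded_linear_snd)
  have s\<tau>: "smooth_on V \<tau>" by (rule smooth_on_linear[OF bl])
  have f\<tau>: "frechet_derivative \<tau> (at z) = \<tau>" for z
    by (rule frechet_derivative_at[OF bounded_linear_imp_has_derivative[OF bl], symmetric])
  have d\<tau>: "dird e \<tau> z = snd (snd (e z))" for e z unfolding dird_def f\<tau> by (simp add: \<tau>_def)
  have z: "dird e (dird c y1) x = 0" "dird e (dird c y2) x = 0" "dird e (dird d y1) x = 0" "dird e (dird d y2) x = 0" for e
    by (rule const0, rule const, assumption)+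
  have B0: "frechet_derivative y1 (at x) B = 0" "frechet_derivative y2 (at x) B = 0"
    unfolding brk[OF smooth_y(1), symmetric] brk[OF smooth_y(2), symmetric] z by simp_all
  have c\<tau>: "dird c \<tau> z = k3" "dird d \<tau> z = l3" if "z \<in> V" for z
    unfolding d\<tau> using const(3,6)[OF that] by simp_all
  have z\<tau>: "dird e (dird c \<tau>) x = 0" "dird e (dird d \<tau>) x = 0" for e
    by (rule const0, rule c\<tau>, assumption)+
  have "frechet_derivative \<tau> (at x) B = 0"
    unfolding brk[OF s\<tau>, symmetric] z\<tau> by simp
  then have "\<tau> B = 0" using f\<tau> by simp
  then have B3: "snd (snd B) = 0" by (simp add: \<tau>_def)
  have sys: "pu y1 x * fst B + pv y1 x * fst (snd B) = 0" "pu y2 x * fst B + pv y2 x * fst (snd B) = 0"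
    using B0(1,2) unfolding frechet_coords[OF diff[OF x smooth_y(1)]] frechet_coords[OF diff[OF x smooth_y(2)]] B3
    by (simp_all add: mult.commute)
  have "fst B = 0" "fst (snd B) = 0"
    using linear_system_trivial[OF sys J[OF x, unfolded J_def]] .
  then have "B = 0" using B3 by (simp add: prod_eq_iff)
  then show ?thesis
    using brk[OF g] linear_0[OF linear_frechet_derivative[OF diff[OF x g]]] by simp
qed

lemma c_time: "snd (snd (c1 z)) = 0" "snd (snd (c2 z)) = 0" "snd (snd (c3 z)) = 1"
  by (simp_all add: c1_def c2_def c3_def)

lemma smooth_\<sigma>: "smooth_on V \<sigma>"
  unfolding \<sigma>_def by (intro smooth_on_add smooth_on_mult smooth_y f)

lemma flow_coords: "flow_coords V c1 c2 c3 \<sigma> y1 y2"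
proof
  show "has_dird c1 V y1 (\<lambda>x. 1)" "has_dird c2 V y1 (\<lambda>x. 0)" "has_dird c3 V y1 (\<lambda>x. 0)"
    by (rule has_dird_eq[OF has_dird_dird[OF smooth_y(1)]], rule dird_y, assumption)+
  show "has_dird c1 V y2 (\<lambda>x. 0)" "has_dird c2 V y2 (\<lambda>x. 1)" "has_dird c3 V y2 (\<lambda>x. 0)"
    by (rule has_dird_eq[OF has_dird_dird[OF smooth_y(2)]], rule dird_y, assumption)+
  fix g :: "coords \<Rightarrow> real" and x assume g: "smooth_on V g" "x \<in> V"
  show "dird c1 (dird c2 g) x = dird c2 (dird c1 g) x"
    by (rule bracket_zero[OF g(2) smooth_c(1,2) dird_y(1) dird_y(4) c_time(1) dird_y(2) dird_y(5) c_time(2) g(1)])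
  show "dird c1 (dird c3 g) x = dird c3 (dird c1 g) x"
    by (rule bracket_zero[OF g(2) smooth_c(1,3) dird_y(1) dird_y(4) c_time(1) dird_y(3) dird_y(6) c_time(3) g(1)])
  show "dird c2 (dird c3 g) x = dird c3 (dird c2 g) x"
    by (rule bracket_zero[OF g(2) smooth_c(2,3) dird_y(2) dird_y(5) c_time(2) dird_y(3) dird_y(6) c_time(3) g(1)])
qed (rule V smooth_c smooth_\<sigma>)+

sublocale flow_coords V c1 c2 c3 \<sigma> y1 y2 by (rule flow_coords)

lemma dird_tangent:
  assumes x: "x \<in> V"
  shows "dird c1 f1 x * y1 x + dird c1 f2 x * y2 x + dird c1 f3 x = 0"
    "dird c2 f1 x * y1 x + dird c2 f2 x * y2 x + dird c2 f3 x = 0"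
    "dird c3 f1 x * y1 x + dird c3 f2 x * y2 x + dird c3 f3 x = pt f1 x * y1 x + pt f2 x * y2 x + pt f3 x"
proof -
  note d = dird_c[OF x f(1)] dird_c[OF x f(2)] dird_c[OF x f(3)]
  let ?a = "\<lambda>p. p f1 x * y1 x + p f2 x * y2 x + p f3 x"
  have "?a (dird c1) = (pv y2 x * ?a pu - pu y2 x * ?a pv) / J x"
    "?a (dird c2) = (pu y1 x * ?a pv - pv y1 x * ?a pu) / J x"
    unfolding d(1,2,4,5,7,8) using J[OF x] by (simp_all add: field_simps)
  then show 1: "?a (dird c1) = 0" "?a (dird c2) = 0" unfolding tangent[OF x] by simp_all
  have "?a (dird c3) = ?a pt - pt y1 x * ?a (dird c1) - pt y2 x * ?a (dird c2)"
    unfolding d(3,6,9) by (simp add: algebra_simps)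
  then show "?a (dird c3) = ?a pt" unfolding 1 by simp
qed

text \<open>Derivatives of the position along the surface are orthogonal to
  \<open>(y1, y2, 1)\<close> and drop out. The spatial gradient of \<open>\<sigma>\<close> is thus
  the position, and its time derivative is \<open>w\<close> times the normal velocity.\<close>

lemma dird_\<sigma>:
  assumes x: "x \<in> V"
  shows "dird c1 \<sigma> x = f1 x" "dird c2 \<sigma> x = f2 x"
    "dird c3 \<sigma> x = pt f1 x * y1 x + pt f2 x * y2 x + pt f3 x"
proof -
  have "has_dird c V \<sigma> (\<lambda>x. (f1 x * dird c y1 x + dird c f1 x * y1 x) + (f2 x * dird c y2 x + dird c f2 x * y2 x) + dird c f3 x)" for c
    unfolding \<sigma>_def by (intro has_dird_add has_dird_mult has_dird_dird smooth_y f)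
  note h = has_dird_imp_dird[OF this x]
  show "dird c1 \<sigma> x = f1 x" "dird c2 \<sigma> x = f2 x"
    "dird c3 \<sigma> x = pt f1 x * y1 x + pt f2 x * y2 x + pt f3 x"
    using dird_tangent[OF x] unfolding h dird_y[OF x] by simp_all
qed

lemma ABC_eq:
  assumes x: "x \<in> V"
  shows "A x = dird c1 f1 x" "B x = dird c1 f2 x" "B x = dird c2 f1 x" "C x = dird c2 f2 x"
proof -
  have s: "dird c1 \<sigma> differentiable at x" "dird c2 \<sigma> differentiable at x"
    by (rule diff[OF x smooth_on_dird[OF V smooth_\<sigma>]], rule smooth_c)+
  note d1 = dird_cong[of V "dird c1 \<sigma>" f1, OF V dird_\<sigma>(1) x s(1)]
    and d2 = dird_cong[of V "dird c2 \<sigma>" f2, OF V dird_\<sigma>(2) x s(2)]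
  show "A x = dird c1 f1 x" "B x = dird c1 f2 x" "C x = dird c2 f2 x"
    unfolding A_def B_def C_def by (rule d1 d2; assumption)+
  show "B x = dird c2 f1 x"
    unfolding B_def comm12[OF smooth_\<sigma> x] by (rule d1)
qed

lemma partials:
  assumes x: "x \<in> V"
  shows "pu f1 x = pu y1 x * A x + pu y2 x * B x" "pv f1 x = pv y1 x * A x + pv y2 x * B x"
    "pu f2 x = pu y1 x * B x + pu y2 x * C x" "pv f2 x = pv y1 x * B x + pv y2 x * C x"
    "pu f3 x = - (pu f1 x * y1 x + pu f2 x * y2 x)" "pv f3 x = - (pv f1 x * y1 x + pv f2 x * y2 x)"
proof -
  have *: "pu g x = pu y1 x * dird c1 g x + pu y2 x * dird c2 g x" "pv g x = pv y1 x * dird c1 g x + pv y2 x * dird c2 g x"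
    if g: "smooth_on V g" for g
  proof -
    have "pu y1 x * dird c1 g x + pu y2 x * dird c2 g x = pu g x * J x / J x"
      "pv y1 x * dird c1 g x + pv y2 x * dird c2 g x = pv g x * J x / J x"
      unfolding dird_c(1,2)[OF x g] times_divide_eq_right add_divide_distrib[symmetric]
      unfolding J_def by (simp_all add: algebra_simps)
    then show "pu g x = pu y1 x * dird c1 g x + pu y2 x * dird c2 g x" "pv g x = pv y1 x * dird c1 g x + pv y2 x * dird c2 g x"
      using J[OF x] by simp_all
  qed
  show "pu f1 x = pu y1 x * A x + pu y2 x * B x" "pv f1 x = pv y1 x * A x + pv y2 x * B x"
    unfolding ABC_eq(1,3)[OF x] by (rule *[OF f(1)])+
  show "pu f2 x = pu y1 x * B x + pu y2 x * C x" "pv f2 x = pv y1 x * B x + pv y2 x * C x"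
    unfolding ABC_eq(2,4)[OF x] by (rule *[OF f(2)])+
  show "pu f3 x = - (pu f1 x * y1 x + pu f2 x * y2 x)" "pv f3 x = - (pv f1 x * y1 x + pv f2 x * y2 x)"
    using tangent[OF x] by simp_all
qed

lemma m3_eq: "x \<in> V \<Longrightarrow> m3 x = J x * (A x * C x - (B x)^2)"
  unfolding m3_def J_def partials(1-4) by (simp add: algebra_simps power2_eq_square)

lemma detABC_nonzero: "x \<in> V \<Longrightarrow> A x * C x - (B x)^2 \<noteq> 0"
  using m3[of x] m3_eq[of x] by auto

lemma det_ff:
  assumes x: "x \<in> V"
  shows "ff11 x * ff22 x - (ff12 x)^2 = (w x)^2 * (J x)^2 * (A x * C x - (B x)^2)^2"
  unfolding ff11_def ff12_def ff22_def w_pos(2) J_def partials(5,6)[OF x] partials(1-4)[OF x]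
  by algebra

lemma trace_forms:
  assumes x: "x \<in> V"
  shows "w x * (ff22 x * sf pu pu x - 2 * ff12 x * sf pv pu x + ff11 x * sf pv pv x)
    = (J x)^2 * (A x * C x - (B x)^2) * D1.T x"
proof -
  have e: "w x * sf pu pu x = pu f1 x * pu y1 x + pu f2 x * pu y2 x"
    "w x * sf pv pu x = pu f1 x * pv y1 x + pu f2 x * pv y2 x"
    "w x * sf pv pv x = pv f1 x * pv y1 x + pv f2 x * pv y2 x"
    using sf_eq[OF x] w_pos(1)[of x] by simp_all
  have "w x * (ff22 x * sf pu pu x - 2 * ff12 x * sf pv pu x + ff11 x * sf pv pv x)
    = ff22 x * (w x * sf pu pu x) - 2 * ff12 x * (w x * sf pv pu x) + ff11 x * (w x * sf pv pv x)"
    by (simp add: algebra_simps)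
  also have "\<dots> = (J x)^2 * (A x * C x - (B x)^2) * D1.T x"
    unfolding e ff11_def ff12_def ff22_def J_def D1.T_def partials(5,6)[OF x] partials(1-4)[OF x]
    by algebra
  finally show ?thesis .
qed

lemma w_eq: "D1.w = w"
  unfolding D1.w_def w_def ..

lemma P_nonzero: "x \<in> V \<Longrightarrow> D1.P x \<noteq> 0"
  unfolding D1.P_def w_eq using detABC_nonzero[of x] w_pos(1)[of x] by simp

text \<open>The parametrization enters numerators and denominators only through
  \<open>(J x)^2\<close>, which cancels; what remains depends on \<open>y\<close> and the second
  derivatives of \<open>\<sigma>\<close>.\<close>

lemma curvatures:
  assumes x: "x \<in> V"
  shows "Hf x = D1.s x / D1.P x" "Kf x = 1 / D1.P x"
proof -
  define d where "d = A x * C x - (B x)^2"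
  have d: "d \<noteq> 0" using detABC_nonzero[OF x] d_def by simp
  have W: "w x \<noteq> 0" using w_pos(1)[of x] by simp
  have "w x * (ff22 x * sf pu pu x - 2 * ff12 x * sf pv pu x + ff11 x * sf pv pv x) = (J x)^2 * d * D1.T x"
    using trace_forms[OF x] d_def by simp
  then have 1: "ff22 x * sf pu pu x - 2 * ff12 x * sf pv pu x + ff11 x * sf pv pv x = (J x)^2 * d * D1.T x / w x"
    using W by (simp add: field_simps)
  have 2: "ff11 x * ff22 x - (ff12 x)^2 = (w x)^2 * (J x)^2 * d^2"
    using det_ff[OF x] d_def by simp
  have "(w x)^2 * (sf pu pu x * sf pv pv x - (sf pv pu x)^2) = (J x)^2 * d"
    using det_sf[OF x] m3_eq[OF x] by (simp add: d_def power2_eq_square)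
  then have 3: "sf pu pu x * sf pv pv x - (sf pv pu x)^2 = (J x)^2 * d / (w x)^2"
    using W by (simp add: field_simps)
  show "Hf x = D1.s x / D1.P x" "Kf x = 1 / D1.P x"
    unfolding Hf_def Kf_def 1 2 3 D1.s_def D1.P_def w_eq d_def[symmetric]
    using J[OF x] d W by (simp_all add: divide_simps power_numeral_reduce)
qed

lemma flow_\<sigma>:
  assumes x: "x \<in> V"
    and flow: "pt f1 x = (Hf x / Kf x)^3 * (y1 x / w x)" "pt f2 x = (Hf x / Kf x)^3 * (y2 x / w x)" "pt f3 x = (Hf x / Kf x)^3 * (1 / w x)"
  shows "dird c3 \<sigma> x = D1.F x"
proof -
  have HK: "Hf x / Kf x = D1.s x" using curvatures[OF x] P_nonzero[OF x] by simp
  have "dird c3 \<sigma> x = D1.s x ^ 3 * ((1 + (y1 x)^2 + (y2 x)^2) / w x)"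
    unfolding dird_\<sigma>(3)[OF x] flow HK by (simp add: power2_eq_square add_divide_distrib algebra_simps)
  also have "\<dots> = D1.F x"
    unfolding w_pos(2)[symmetric] D1.F_def w_eq using w_pos(1)[of x] by (simp add: power2_eq_square)
  finally show ?thesis .
qed

end

section \<open>The estimate at a local maximum\<close>

text \<open>The inequality between trace and determinant for the inverse of \<open>g\<close> times
  \<open>h\<close>, an operator that is self-adjoint for the positive definite form
  \<open>g\<close>.\<close>

lemma mixed_discriminant:
  fixes g11 g12 g22 h11 h12 h22 :: real
  assumes "0 < g11" "0 < g11 * g22 - g12^2"
  shows "4 * (g11 * g22 - g12^2) * (h11 * h22 - h12^2) \<le> (g22 * h11 - 2 * g12 * h12 + g11 * h22)^2"
proof -
  let ?D = "g11 * g22 - g12^2" and ?T = "g22 * h11 - 2 * g12 * h12 + g11 * h22"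
  \<comment> \<open>Gram-Schmidt replaces the second basis vector \<open>e2\<close> by
    \<open>g11 * e2 - g12 * e1\<close>. In the new basis \<open>?n\<close> is the diagonal and
    \<open>?m\<close> the mixed entry of \<open>h\<close>, and
    \<open>g11 * ?T = ?n + ?D * h11\<close>.\<close>
  let ?n = "g11^2 * h22 - 2 * g11 * g12 * h12 + g12^2 * h11" and ?m = "g11 * h12 - g12 * h11"
  have "g11^2 * (?T^2 - 4 * ?D * (h11 * h22 - h12^2)) = (?n - ?D * h11)^2 + 4 * ?D * ?m^2"
    by algebra
  also have "0 \<le> \<dots>" using assms by simp
  finally show ?thesis using assms(1) by (simp add: zero_le_mult_iff)
qed

lemma dird_const_field_nonpos:
  fixes f :: "'a::euclidean_space \<Rightarrow> real"
  assumes "open U" "smooth_on U f" "x \<in> U"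
    and max: "\<And>h. x + h *\<^sub>R v \<in> U \<Longrightarrow> f (x + h *\<^sub>R v) \<le> f x"
  shows "frechet_derivative f (at x) v = 0" "dird (\<lambda>_. v) (dird (\<lambda>_. v) f) x \<le> 0"
proof -
  have cont: "((\<lambda>h. x + h *\<^sub>R v) \<longlongrightarrow> x) (at 0)"
    by (auto intro!: tendsto_eq_intros)
  then have ev: "\<forall>\<^sub>F h in at 0. x + h *\<^sub>R v \<in> U"
    using assms(1,3) by (rule topological_tendstoD)
  then obtain d where d: "d > 0" "\<And>h. h \<noteq> 0 \<Longrightarrow> \<bar>h\<bar> < d \<Longrightarrow> x + h *\<^sub>R v \<in> U"
    unfolding eventually_at by auto
  have le: "f (x + h *\<^sub>R v) \<le> f x" if "\<bar>h\<bar> < d" for h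
    using max[of h] d(2)[of h] that by (cases "h = 0") auto
  have "((\<lambda>h. x + h *\<^sub>R v) has_derivative (\<lambda>h. h *\<^sub>R v)) (at 0)"
    by (auto intro!: derivative_eq_intros)
  moreover have "(f has_derivative frechet_derivative f (at x)) (at (x + 0 *\<^sub>R v))"
    using smooth_on_has_derivative[OF assms(2,3)] by simp
  ultimately have "((\<lambda>h. f (x + h *\<^sub>R v)) has_derivative (\<lambda>h. frechet_derivative f (at x) (h *\<^sub>R v))) (at 0)"
    by (rule has_derivative_compose)
  then have der: "((\<lambda>h. f (x + h *\<^sub>R v)) has_real_derivative frechet_derivative f (at x) v) (at 0)"
    using linear_scale[OF linear_frechet_derivative[OF smooth_on_differentiable[OF assms(2,3)]]]
    by (simp add: has_field_derivative_def mult.commute[of _ "frechet_derivative _ _ _"])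
  show "frechet_derivative f (at x) v = 0"
    by (rule DERIV_local_max[OF der d(1)]) (use le in auto)
  define f' where "f' = (\<lambda>y. frechet_derivative f (at y) v)"
  have sf': "smooth_on U f'" unfolding f'_def by (rule smooth_on_frechet_derivative[OF assms(1,2)])
  \<comment> \<open>With the second vector equal to \<open>- v\<close>, the difference is twice the
    value at \<open>x\<close> minus the values on both sides, which is nonnegative at a
    maximum.\<close>
  have lim: "((\<lambda>h. (f (x + h *\<^sub>R v + h *\<^sub>R (- v)) - f (x + h *\<^sub>R v) - f (x + h *\<^sub>R (- v)) + f x) / h\<^sup>2)
    \<longlongrightarrow> frechet_derivative f' (at x) (- v)) (at_right 0)"
    unfolding f'_def by (rule second_difference_tendsto[OF assms(1-3)])
  have "\<forall>\<^sub>F h in at_right 0. 0 \<le> (f (x + h *\<^sub>R v + h *\<^sub>R (- v)) - f (x + h *\<^sub>R v) - f (x + h *\<^sub>R (- v)) + f x) / h\<^sup>2"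
    unfolding eventually_at_right_field
  proof (intro exI[of _ d] conjI d(1) allI impI)
    fix h assume "0 < h" "h < d"
    then show "0 \<le> (f (x + h *\<^sub>R v + h *\<^sub>R (- v)) - f (x + h *\<^sub>R v) - f (x + h *\<^sub>R (- v)) + f x) / h\<^sup>2"
      using le[of h] le[of "- h"] by simp
  qed
  then have "0 \<le> frechet_derivative f' (at x) (- v)"
    using tendsto_lowerbound[OF lim] by simp
  then show "dird (\<lambda>_. v) (dird (\<lambda>_. v) f) x \<le> 0"
    using linear_neg[OF linear_frechet_derivative[OF smooth_on_differentiable[OF sf' assms(3)]]]
    unfolding dird_def f'_def by simp
qed

section \<open>The quotient in terms of curvatures and of radii\<close>

definition curvature_quotient :: "real \<Rightarrow> real \<Rightarrow> real" where
  "curvature_quotient H K = H^6 * (H^2 - 4 * K) / (16 * (H^2 - 2 * K) * (H^2 - K) * K^3)"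

lemma curvature_quotient_radii:
  assumes "P \<noteq> 0"
  shows "curvature_quotient (s / P) (1 / P) = s^6 * (s^2 - 4 * P) / (16 * (P * (s^2 - 2 * P) * (s^2 - P)))"
proof -
  have e: "(s / P)^2 - a * (1 / P) = (s^2 - a * P) / P^2" for a
    using assms by (simp add: field_simps power2_eq_square)
  have num: "(s / P)^6 * ((s / P)^2 - 4 * (1 / P)) = s^6 * (s^2 - 4 * P) / P^8"
    unfolding e by (simp add: power_divide power_add[symmetric])
  have den: "16 * ((s / P)^2 - 2 * (1 / P)) * ((s / P)^2 - 1 * (1 / P)) * (1 / P)^3
    = 16 * (s^2 - 2 * P) * (s^2 - 1 * P) / P^7"
    unfolding e by (simp add: power_divide power_add[symmetric])
  have quot: "(X / P^8) / (Y / P^7) = X / (P * Y)" for X Y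
    using assms by (cases "Y = 0") (simp_all add: field_simps power_numeral_reduce)
  have "curvature_quotient (s / P) (1 / P)
    = (s / P)^6 * ((s / P)^2 - 4 * (1 / P)) / (16 * ((s / P)^2 - 2 * (1 / P)) * ((s / P)^2 - 1 * (1 / P)) * (1 / P)^3)"
    by (simp add: curvature_quotient_def)
  then show ?thesis unfolding num den quot by (simp add: mult.assoc mult.left_commute[of P])
qed

context regular_graph_coords
begin

lemma smooth_sP: "smooth_on V D1.s" "smooth_on V D1.P"
proof -
  have "smooth_on V w" unfolding w_def
    by (rule smooth_on_sqrt[OF V]) (intro smooth_on_add smooth_on_power smooth_y smooth_on_const, rule D1.pos)
  then show "smooth_on V D1.s" "smooth_on V D1.P"
    unfolding D1.s_def D1.P_def D1.T_def w_eq
    by (intro smooth_on_mult smooth_on_add smooth_on_diff smooth_on_power smooth_y smooth_ABC smooth_on_const; assumption)+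
qed

lemma smooth_\<Phi>: "smooth_on V (D1.\<Phi> k n)"
  unfolding D1.\<Phi>_def
  by (intro smooth_on_diff smooth_on_add smooth_on_mult smooth_on_power smooth_sP smooth_on_const)

text \<open>\<open>mixed_discriminant\<close> is applied with \<open>g\<close> the adjugate of the
  matrix \<open>1 + y y^T\<close>, so that its mixed expression is the trace \<open>T\<close>; the
  determinant of this matrix is \<open>w^2\<close>.\<close>

lemma s_P_ineq: "4 * D1.P x \<le> (D1.s x)^2"
proof -
  have "4 * ((1 + (y2 x)^2) * (1 + (y1 x)^2) - (- (y1 x * y2 x))^2) * (A x * C x - (B x)^2)
    \<le> ((1 + (y1 x)^2) * A x - 2 * (- (y1 x * y2 x)) * B x + (1 + (y2 x)^2) * C x)^2"
    by (rule mixed_discriminant) (auto simp: power_mult_distrib algebra_simps intro!: add_pos_nonneg)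
  moreover have "(1 + (y2 x)^2) * (1 + (y1 x)^2) - (- (y1 x * y2 x))^2 = (w x)^2"
    unfolding w_pos(2) by (simp add: power2_eq_square algebra_simps)
  moreover have "(1 + (y1 x)^2) * A x - 2 * (- (y1 x * y2 x)) * B x + (1 + (y2 x)^2) * C x = D1.T x"
    by (simp add: D1.T_def)
  ultimately have "4 * (w x)^2 * (A x * C x - (B x)^2) \<le> (D1.T x)^2" by (simp only:)
  then have "(w x)^2 * (4 * (w x)^2 * (A x * C x - (B x)^2)) \<le> (w x)^2 * (D1.T x)^2"
    by (rule mult_left_mono) simp
  then show ?thesis unfolding D1.s_def D1.P_def w_eq by (simp add: power_mult_distrib algebra_simps power_numeral_reduce)
qed

definition "den x = D1.P x * ((D1.s x)^2 - 2 * D1.P x) * ((D1.s x)^2 - D1.P x)"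
definition "num x = (D1.s x)^6 * ((D1.s x)^2 - 4 * D1.P x)"

lemma \<Phi>_num_den: "D1.\<Phi> k n x = k * num x - n * den x"
  unfolding D1.\<Phi>_def num_def den_def by algebra

lemma den_pos: "0 < D1.P x \<Longrightarrow> 0 < den x"
  unfolding den_def using s_P_ineq[of x] by (intro mult_pos_pos) auto

lemma quotient_eq: "x \<in> V \<Longrightarrow> curvature_quotient (Hf x) (Kf x) = num x / (16 * den x)"
  unfolding curvatures curvature_quotient_radii[OF P_nonzero] num_def den_def ..

text \<open>With the constants \<open>k = den x0\<close> and \<open>n = num x0\<close>, the function \<open>\<Phi>\<close> is a positive multiple of
  \<open>num / den - num x0 / den x0\<close>, so it has a spatial maximum at \<open>x0\<close> with value 0.\<close>
lemma backward_estimate: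
  assumes x0: "x0 \<in> V" and y0: "y1 x0 = 0" "y2 x0 = 0"
    and frame: "pv y2 x0 * pu f2 x0 = pu y2 x0 * pv f2 x0"
    and K: "\<And>x. x \<in> V \<Longrightarrow> 0 < Kf x" and H0: "0 < Hf x0"
    and flow: "\<And>x. x \<in> V \<Longrightarrow> pt f1 x = (Hf x / Kf x)^3 * (y1 x / w x)"
      "\<And>x. x \<in> V \<Longrightarrow> pt f2 x = (Hf x / Kf x)^3 * (y2 x / w x)"
      "\<And>x. x \<in> V \<Longrightarrow> pt f3 x = (Hf x / Kf x)^3 * (1 / w x)"
    and max: "\<And>x. x \<in> V \<Longrightarrow> snd (snd x) = snd (snd x0) \<Longrightarrow>
       curvature_quotient (Hf x) (Kf x) \<le> curvature_quotient (Hf x0) (Kf x0)"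
    and Q0: "curvature_quotient (Hf x0) (Kf x0) \<noteq> 0"
    and e: "0 < \<epsilon>"
  shows "\<forall>\<^sub>F h in at_right 0. curvature_quotient (Hf x0) (Kf x0) - \<epsilon> * h
       \<le> curvature_quotient (Hf (x0 - h *\<^sub>R (0, 0, 1))) (Kf (x0 - h *\<^sub>R (0, 0, 1)))"
proof -
  define \<Phi> where "\<Phi> = D1.\<Phi> (den x0) (num x0)"
  have s\<Phi>: "smooth_on V \<Phi>" unfolding \<Phi>_def by (rule smooth_\<Phi>)
  have Ppos: "0 < D1.P x" if "x \<in> V" for x using K[OF that] curvatures(2)[OF that] by simp
  have dpos: "0 < den x" if "x \<in> V" for x using den_pos[OF Ppos[OF that]] .
  have \<Phi>_eq: "\<Phi> x = 16 * den x * den x0 * (curvature_quotient (Hf x) (Kf x) - curvature_quotient (Hf x0) (Kf x0))"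
    if "x \<in> V" for x
    unfolding quotient_eq[OF that] quotient_eq[OF x0] \<Phi>_def \<Phi>_num_den
    using dpos[OF that] dpos[OF x0] by (simp add: field_simps)
  have \<Phi>0: "\<Phi> x0 = 0" using \<Phi>_eq[OF x0] by simp
  have \<Phi>max: "\<Phi> x \<le> \<Phi> x0" if "x \<in> V" "snd (snd x) = snd (snd x0)" for x
    unfolding \<Phi>0 \<Phi>_eq[OF that(1)] using max[OF that] dpos[OF that(1)] dpos[OF x0]
    by (simp add: mult_nonneg_nonpos)
  have line: "frechet_derivative \<Phi> (at x0) v = 0" "dird (\<lambda>_. v) (dird (\<lambda>_. v) \<Phi>) x0 \<le> 0"
    if v: "snd (snd v) = 0" for v
    by (rule dird_const_field_nonpos[OF V s\<Phi> x0]; rule \<Phi>max; simp add: v)+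
  \<comment> \<open>The derivative of \<open>c\<close> along itself is again spatial, and the
    spatial derivatives of \<open>\<Phi>\<close> vanish at \<open>x0\<close>. So \<open>c\<close>
    may be frozen at its value there, which reduces the claim to straight lines.\<close>
  have hess: "dird c (dird c \<Phi>) x0 \<le> 0" if c: "smooth_on V c" "\<And>x. snd (snd (c x)) = 0" for c
  proof -
    have "((\<lambda>x. snd (snd (c x))) has_derivative (\<lambda>h. snd (snd (frechet_derivative c (at x0) h)))) (at x0)"
      by (intro has_derivative_snd smooth_on_has_derivative[OF c(1) x0])
    then have "((\<lambda>x. 0) has_derivative (\<lambda>h. snd (snd (frechet_derivative c (at x0) h)))) (at x0)"
      by (simp add: c(2))
    then have "snd (snd (frechet_derivative c (at x0) h)) = 0" for h
      using has_derivative_unique[OF _ has_derivative_const] by metis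
    then have 1: "frechet_derivative \<Phi> (at x0) (frechet_derivative c (at x0) (c x0)) = 0"
      by (rule line(1))
    have 2: "frechet_derivative \<Phi> (at x0) (frechet_derivative (\<lambda>_. c x0) (at x0) (c x0)) = 0"
      by (rule line(1)) simp
    have "dird c (dird c \<Phi>) x0 = dird (\<lambda>_. c x0) (dird (\<lambda>_. c x0) \<Phi>) x0"
      unfolding dird_dird[OF V s\<Phi> c(1) x0] dird_dird[OF V s\<Phi> smooth_on_const x0] 1 2 ..
    then show ?thesis using line(2)[OF c(2)] by simp
  qed
  have crit: "dird c1 \<Phi> x0 = 0" "dird c2 \<Phi> x0 = 0"
    unfolding dird_def by (rule line(1), rule c_time)+
  have B0: "B x0 = 0" unfolding ABC_eq(2)[OF x0] dird_c(1)[OF x0 f(2)] using frame by simp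
  note v = D1.values_at[OF y0 B0]
  have "0 < D1.s x0" using H0 curvatures(1)[OF x0] Ppos[OF x0] by (simp add: zero_less_divide_iff)
  then have pos: "0 < A x0" "0 < C x0"
    using Ppos[OF x0] unfolding v by (auto simp: zero_less_mult_iff)
  have ne: "A x0 \<noteq> C x0"
  proof
    assume "A x0 = C x0"
    then have "num x0 = 0" unfolding num_def v by (simp add: power2_eq_square)
    then show False using Q0 quotient_eq[OF x0] by simp
  qed
  have "dird c3 \<Phi> x0 \<le> 0"
    unfolding \<Phi>_def
  proof (rule time_derivative_nonpos[OF _ x0 y0 B0 pos ne])
    show "dird c3 \<sigma> x = D1.F x" if "x \<in> V" for x by (rule flow_\<sigma>[OF that flow[OF that]])
  qed (use crit hess[OF smooth_c(1)] hess[OF smooth_c(2)] c_time in \<open>simp_all add: den_def num_def \<Phi>_def\<close>)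
  \<comment> \<open>The derivatives at fixed \<open>y\<close> and at a fixed parameter point differ
    by spatial derivatives, which vanish at the maximum.\<close>
  then have pt: "pt \<Phi> x0 \<le> 0" using dird_c(3)[OF x0 s\<Phi>] crit by simp
  \<comment> \<open>By \<open>\<Phi>_eq\<close> a fall of the quotient by more than
    \<open>\<epsilon> * h\<close> lowers \<open>\<Phi>\<close> by more than
    \<open>16 * den x * den x0 * \<epsilon> * h\<close>, where \<open>den x\<close> exceeds
    \<open>den x0 / 2\<close> near \<open>x0\<close>.\<close>
  define e1 where "e1 = \<epsilon> * 16 * den x0 * (den x0 / 2)"
  have e1: "e1 > 0" unfolding e1_def using e dpos[OF x0] by simp
  have lim0: "((\<lambda>h. x0 - h *\<^sub>R (0, 0, 1)) \<longlongrightarrow> x0) (at_right 0)"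
    by (auto intro!: tendsto_eq_intros simp: zero_prod_def)
  have ev1: "\<forall>\<^sub>F h in at_right 0. x0 - h *\<^sub>R (0, 0, 1) \<in> V"
    using lim0 V x0 by (rule topological_tendstoD)
  have "continuous_on V den" unfolding den_def
    by (intro continuous_intros smooth_on_continuous_on[OF smooth_sP(1)] smooth_on_continuous_on[OF smooth_sP(2)])
  then have "isCont den x0" using V x0 by (simp add: continuous_on_eq_continuous_at)
  then have "((\<lambda>h. den (x0 - h *\<^sub>R (0, 0, 1))) \<longlongrightarrow> den x0) (at_right 0)"
    by (rule isCont_tendsto_compose[OF _ lim0])
  then have ev2: "\<forall>\<^sub>F h in at_right 0. den x0 / 2 < den (x0 - h *\<^sub>R (0, 0, 1))"
    by (rule order_tendstoD(1)) (use dpos[OF x0] in simp)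
  have ev3: "\<forall>\<^sub>F h in at_right 0. - e1 * h \<le> \<Phi> (x0 - h *\<^sub>R (0, 0, 1))"
  proof -
    have "((\<lambda>h. x0 - h *\<^sub>R (0, 0, 1)) has_derivative (\<lambda>h. - (h *\<^sub>R (0, 0, 1)))) (at 0)"
      by (rule derivative_eq_intros refl | simp)+
    moreover have "(\<Phi> has_derivative frechet_derivative \<Phi> (at x0)) (at (x0 - 0 *\<^sub>R (0, 0, 1)))"
      using smooth_on_has_derivative[OF s\<Phi> x0] by (simp del: scaleR_Pair)
    ultimately have d: "((\<lambda>h. \<Phi> (x0 - h *\<^sub>R (0, 0, 1))) has_derivative (\<lambda>h. frechet_derivative \<Phi> (at x0) (- (h *\<^sub>R (0, 0, 1))))) (at 0)"
      by (rule has_derivative_compose)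
    have l: "linear (frechet_derivative \<Phi> (at x0))"
      by (rule linear_frechet_derivative[OF smooth_on_differentiable[OF s\<Phi> x0]])
    have eq: "(\<lambda>h. frechet_derivative \<Phi> (at x0) (- (h *\<^sub>R (0, 0, 1)))) = (*) (- pt \<Phi> x0)"
      by (rule ext) (simp add: linear_neg[OF l] linear_scale[OF l] dird_def mult.commute del: scaleR_Pair)
    have "((\<lambda>h. \<Phi> (x0 - h *\<^sub>R (0, 0, 1))) has_real_derivative - pt \<Phi> x0) (at 0)"
      using d unfolding eq has_field_derivative_def .
    then have "((\<lambda>h. \<Phi> (x0 - h *\<^sub>R (0, 0, 1)) / h) \<longlongrightarrow> - pt \<Phi> x0) (at 0)"
      by (simp add: DERIV_def \<Phi>0 del: scaleR_Pair)
    then have "((\<lambda>h. \<Phi> (x0 - h *\<^sub>R (0, 0, 1)) / h) \<longlongrightarrow> - pt \<Phi> x0) (at_right 0)"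
      by (rule tendsto_mono[rotated]) (rule at_le, simp)
    then have "\<forall>\<^sub>F h in at_right 0. - e1 < \<Phi> (x0 - h *\<^sub>R (0, 0, 1)) / h"
      by (rule order_tendstoD(1)) (use pt e1 in simp)
    then show ?thesis
      using eventually_at_right_less[of 0]
      by eventually_elim (simp add: pos_less_divide_eq)
  qed
  show ?thesis
    using ev1 ev2 ev3 eventually_at_right_less[of 0]
  proof eventually_elim
    case (elim h)
    let ?x = "x0 - h *\<^sub>R (0, 0, 1)"
    let ?d = "curvature_quotient (Hf ?x) (Kf ?x) - curvature_quotient (Hf x0) (Kf x0)"
    have "- (\<epsilon> * h) \<le> ?d"
    proof (rule ccontr)
      assume "\<not> - (\<epsilon> * h) \<le> ?d"
      then have d: "?d < - (\<epsilon> * h)" by simp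
      have "16 * den ?x * den x0 * ?d < 16 * den ?x * den x0 * (- (\<epsilon> * h))"
        using d dpos[OF elim(1)] dpos[OF x0] by (intro mult_strict_left_mono) auto
      also have "\<dots> \<le> 16 * (den x0 / 2) * den x0 * (- (\<epsilon> * h))"
        using elim(2,4) e dpos[OF x0] by (intro mult_right_mono_neg mult_right_mono) auto
      also have "\<dots> = - e1 * h" by (simp add: e1_def)
      finally show False using elim(3) \<Phi>_eq[OF elim(1)] by simp
    qed
    then show ?case by simp
  qed
qed

end

section \<open>The outer normal\<close>

lemma smooth_on_normalize:
  fixes V :: "'a::euclidean_space set"
  assumes "open V" "0 \<notin> V"
  shows "smooth_on V (\<lambda>z. z /\<^sub>R norm z)"
proof -
  have "smooth_on V (\<lambda>z::'a. inverse (sqrt (z \<bullet> z)) *\<^sub>R z)"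
    by (intro smooth_on_scaleR smooth_on_inverse_sqrt smooth_on_inner smooth_on_id)
      (use assms(2) in \<open>metis inner_gt_zero_iff\<close>)
  then show ?thesis
    by (simp add: norm_eq_sqrt_inner)
qed

lemma has_derivative_normalize:
  fixes p :: "'a::euclidean_space"
  assumes "norm p = 1"
  shows "((\<lambda>z. z /\<^sub>R norm z) has_derivative (\<lambda>v. v - (v \<bullet> p) *\<^sub>R p)) (at p)"
proof -
  have pp: "p \<bullet> p = 1" using assms by (simp add: norm_eq_1)
  have "((\<lambda>z. z \<bullet> z) has_derivative (\<lambda>v. 2 * (v \<bullet> p))) (at p)"
    by (auto intro!: derivative_eq_intros simp: inner_commute)
  moreover have "((\<lambda>s. inverse (sqrt s)) has_derivative (\<lambda>v. - v / 2)) (at (p \<bullet> p))"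
    by (auto intro!: derivative_eq_intros simp: pp)
  ultimately have "((\<lambda>z. inverse (sqrt (z \<bullet> z))) has_derivative (\<lambda>v. - (2 * (v \<bullet> p)) / 2)) (at p)"
    by (rule has_derivative_compose)
  from has_derivative_scaleR[OF this has_derivative_ident]
  have "((\<lambda>z. inverse (sqrt (z \<bullet> z)) *\<^sub>R z) has_derivative (\<lambda>v. v - (v \<bullet> p) *\<^sub>R p)) (at p)"
    by (simp add: pp)
  then show ?thesis by (simp add: norm_eq_sqrt_inner)
qed

lemma smooth_local_homeomorphism:
  fixes f :: "'a::euclidean_space \<Rightarrow> 'a"
  assumes "open U" "smooth_on U f" "x \<in> U" "inj (frechet_derivative f (at x))"
  obtains W where "open W" "x \<in> W" "W \<subseteq> U" "inj_on f W"
proof -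
  define f' where "f' = (\<lambda>x. Blinfun (frechet_derivative f (at x)))"
  have bl: "bounded_linear (frechet_derivative f (at z))" if "z \<in> U" for z
    using has_derivative_bounded_linear[OF smooth_on_has_derivative[OF assms(2) that]] .
  have app: "blinfun_apply (f' z) = frechet_derivative f (at z)" if "z \<in> U" for z
    unfolding f'_def by (rule bounded_linear_Blinfun_apply[OF bl[OF that]])
  have cont: "continuous_on U f'"
  proof (rule continuous_on_blinfun_componentwise)
    fix i :: 'a
    have "continuous_on U (\<lambda>z. frechet_derivative f (at z) i)"
      by (rule smooth_on_continuous_on[OF smooth_on_frechet_derivative[OF assms(1,2)]])
    then show "continuous_on U (\<lambda>z. blinfun_apply (f' z) i)"
      by (rule continuous_on_eq) (simp add: app)
  qed
  obtain g where g: "linear g" "\<And>v. g (frechet_derivative f (at x) v) = v"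
    using linear_injective_isomorphism[OF bounded_linear.linear[OF bl[OF assms(3)]] assms(4)] by metis
  have "Blinfun g o\<^sub>L f' x = id_blinfun"
  proof (rule blinfun_eqI)
    fix v
    have "bounded_linear g" using g(1) linear_conv_bounded_linear by blast
    then show "blinfun_apply (Blinfun g o\<^sub>L f' x) v = blinfun_apply id_blinfun v"
      by (simp add: bounded_linear_Blinfun_apply app[OF assms(3)] g(2))
  qed
  from inverse_function_theorem[OF assms(1) _ cont assms(3) this]
  obtain W V' h where "open W" "W \<subseteq> U" "x \<in> W" "homeomorphism W V' f h"
    using smooth_on_has_derivative[OF assms(2)] app by metis
  then show ?thesis
    using that[of W] by (metis homeomorphism_def inj_on_inverseI)
qed

text \<open>Supplies the witness for the \<open>SOME\<close> in \<open>outer_normal\<close>. A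
  collar map straightens the surface near \<open>Y p\<close>, so the complement there consists of
  two half-balls. The surface is the frontier of its outside, hence one half-ball meets the outside
  and, being connected and off the surface, lies in it entirely.\<close>

lemma normal_side_outside:
  fixes Y :: "'a::euclidean_space \<Rightarrow> 'a"
  assumes dim: "2 \<le> DIM('a)"
    and O: "open O'" "sphere 0 1 \<subseteq> O'" "smooth_on O' Y"
    and inj: "inj_on Y (sphere 0 1)" and p: "norm p = 1"
    and imm: "inj_on (frechet_derivative Y (at p)) {v. v \<bullet> p = 0}"
    and n: "norm n = 1" "\<And>v. v \<bullet> p = 0 \<Longrightarrow> frechet_derivative Y (at p) v \<bullet> n = 0"
  obtains m e where "m = n \<or> m = - n" "0 < e"
    "\<And>s. 0 < s \<Longrightarrow> s < e \<Longrightarrow> Y p + s *\<^sub>R m \<in> outside (Y ` sphere 0 1)"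
proof -
  define M where "M = Y ` sphere 0 1"
  define G where "G = (\<lambda>z::'a. z /\<^sub>R norm z)"
  \<comment> \<open>The tangent plane \<open>z \<bullet> p = 1\<close> is sent to the surface by
    radial projection, and the distance from that plane becomes displacement along \<open>n\<close>.
    At \<open>p\<close> the derivative is injective.\<close>
  define F where "F = (\<lambda>z. Y (G z) + (z \<bullet> p - 1) *\<^sub>R n)"
  define N where "N = UNIV - {0::'a}"
  have N: "open N" "0 \<notin> N" by (auto simp: N_def)
  have sG: "smooth_on N G" unfolding G_def by (rule smooth_on_normalize[OF N])
  have Gs: "G z \<in> sphere 0 1" if "z \<noteq> 0" for z using that by (simp add: G_def)
  have sF: "smooth_on N F"
    unfolding F_def
    by (intro smooth_on_add smooth_on_scaleR smooth_on_diff smooth_on_inner smooth_on_id smooth_on_const smooth_on_compose[OF O(3) sG])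
      (use subsetD[OF O(2) Gs] in \<open>auto simp: N_def\<close>)
  have pp: "p \<bullet> p = 1" using p by (simp add: norm_eq_1)
  have p0: "p \<in> N" using p by (auto simp: N_def)
  have Gp: "G p = p" using p by (simp add: G_def)
  have YD: "(Y has_derivative frechet_derivative Y (at p)) (at p)"
    by (rule smooth_on_has_derivative[OF O(3)]) (use O(2) p in auto)
  have "(F has_derivative (\<lambda>v. frechet_derivative Y (at p) (v - (v \<bullet> p) *\<^sub>R p) + (v \<bullet> p) *\<^sub>R n)) (at p)"
  proof -
    have "(G has_derivative (\<lambda>v. v - (v \<bullet> p) *\<^sub>R p)) (at p)" unfolding G_def by (rule has_derivative_normalize[OF p])
    moreover have "(Y has_derivative frechet_derivative Y (at p)) (at (G p))" using YD Gp by simp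
    ultimately have "((\<lambda>z. Y (G z)) has_derivative (\<lambda>v. frechet_derivative Y (at p) (v - (v \<bullet> p) *\<^sub>R p))) (at p)"
      by (rule has_derivative_compose)
    moreover have "((\<lambda>z. (z \<bullet> p - 1) *\<^sub>R n) has_derivative (\<lambda>v. (v \<bullet> p) *\<^sub>R n)) (at p)"
      by (auto intro!: derivative_eq_intros)
    ultimately show ?thesis unfolding F_def by (rule has_derivative_add)
  qed
  then have FD: "frechet_derivative F (at p) = (\<lambda>v. frechet_derivative Y (at p) (v - (v \<bullet> p) *\<^sub>R p) + (v \<bullet> p) *\<^sub>R n)"
    by (rule frechet_derivative_at[symmetric])
  have lY: "linear (frechet_derivative Y (at p))" using has_derivative_bounded_linear[OF YD] bounded_linear.linear by blast
  have "inj (frechet_derivative F (at p))"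
  proof -
    have l: "linear (frechet_derivative F (at p))"
      by (rule linear_frechet_derivative[OF smooth_on_differentiable[OF sF p0]])
    have "v = 0" if v: "frechet_derivative F (at p) v = 0" for v
    proof -
      have perp: "(v - (v \<bullet> p) *\<^sub>R p) \<bullet> p = 0" by (simp add: inner_diff_left pp)
      have "frechet_derivative F (at p) v \<bullet> n = v \<bullet> p"
        unfolding FD using n(2)[OF perp] n(1) by (simp add: inner_add_left norm_eq_1)
      then have vp: "v \<bullet> p = 0" using v by simp
      then have "frechet_derivative Y (at p) v = frechet_derivative Y (at p) 0" using v linear_0[OF lY] unfolding FD by simp
      then show "v = 0" using inj_onD[OF imm] vp by simp
    qed
    then show ?thesis using linear_injective_0[OF l] by blast
  qed
  from smooth_local_homeomorphism[OF N(1) sF p0 this]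
  obtain W where W: "open W" "p \<in> W" "W \<subseteq> N" "inj_on F W" by blast
  \<comment> \<open>Radial projection of a hemisphere to the plane \<open>z \<bullet> p = 1\<close>,
    inverse to \<open>G\<close> there.\<close>
  define H where "H = (\<lambda>q. q /\<^sub>R (q \<bullet> p))"
  define S1 where "S1 = {q. q \<bullet> p > 0}"
  have S1: "open S1" unfolding S1_def by (simp add: open_Collect_less continuous_intros)
  have contH: "continuous_on S1 H" unfolding H_def S1_def by (intro continuous_intros) auto
  define Oq where "Oq = S1 \<inter> H -` W"
  have Oq: "open Oq" unfolding Oq_def by (rule continuous_open_preimage[OF contH S1 W(1)])
  have pOq: "p \<in> Oq" using W(2) by (simp add: Oq_def S1_def H_def pp)
  have contY: "continuous_on (sphere 0 1) Y"
    using smooth_on_continuous_on[OF O(3)] O(2) continuous_on_subset by blast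
  \<comment> \<open>Injectivity excludes \<open>Y p\<close> from the image of the part of the sphere
    away from \<open>p\<close>. This image is compact, so a whole neighbourhood of
    \<open>Y p\<close> avoids it and only the sheet through \<open>Y p\<close> matters.\<close>
  have "compact (Y ` (sphere 0 1 - Oq))"
    by (intro compact_continuous_image continuous_on_subset[OF contY] compact_diff Oq) auto
  then have cl: "open (- (Y ` (sphere 0 1 - Oq)))" using compact_imp_closed by blast
  have "Y p \<notin> Y ` (sphere 0 1 - Oq)"
    using inj pOq p by (auto simp: inj_on_def)
  moreover have Fp: "F p = Y p" unfolding F_def by (simp add: Gp pp)
  moreover have contF: "continuous_on W F" using smooth_on_continuous_on[OF sF] W(3) continuous_on_subset by blast
  ultimately have "open (W \<inter> F -` (- (Y ` (sphere 0 1 - Oq))))" "p \<in> W \<inter> F -` (- (Y ` (sphere 0 1 - Oq)))"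
    using continuous_open_preimage[OF contF W(1) cl] W(2) by auto
  then obtain r0 where r0: "r0 > 0" "ball p r0 \<subseteq> W \<inter> F -` (- (Y ` (sphere 0 1 - Oq)))"
    using openE by blast
  \<comment> \<open>The bound 1 keeps \<open>1 + sg * s\<close> positive below, so that the points
    on the normal line project radially to \<open>p\<close>.\<close>
  define r where "r = min r0 1"
  have r: "r > 0" "ball p r \<subseteq> W \<inter> F -` (- (Y ` (sphere 0 1 - Oq)))"
    using r0 by (auto simp: r_def)
  have off: "F z \<notin> M" if z: "z \<in> ball p r" "z \<bullet> p \<noteq> 1" for z
  proof
    assume "F z \<in> M"
    then obtain q where q: "norm q = 1" "F z = Y q" by (auto simp: M_def)
    then have "q \<in> Oq" using r(2) z(1) by force
    then have q1: "q \<bullet> p > 0" "H q \<in> W" by (auto simp: Oq_def S1_def)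
    have "H q \<bullet> p = 1" "G (H q) = q" using q1 q(1) by (auto simp: H_def G_def)
    then have "F (H q) = Y q" unfolding F_def by simp
    then have "F (H q) = F z" using q(2) by simp
    then have "H q = z" using W(4) q1(2) r(2) z(1) inj_onD by fastforce
    then show False using \<open>H q \<bullet> p = 1\<close> z(2) by simp
  qed
  have bM: "bounded M" unfolding M_def by (intro compact_imp_bounded compact_continuous_image contY compact_sphere)
  have hom: "M homeomorphic sphere (0::'a) 1"
    unfolding M_def using homeomorphic_compact[OF compact_sphere contY refl inj] homeomorphic_sym by blast
  have "outside M \<in> components (- M)"
    unfolding outside_in_components using connected_outside[OF bM dim] outside_bounded_nonempty[OF bM] by simp
  then have fr: "frontier (outside M) = M" by (rule Jordan_Brouwer_frontier[OF hom _ dim])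
  have "open (F ` ball p r)"
    by (rule invariance_of_domain) (use r(2) contF W(4) in \<open>auto intro: continuous_on_subset inj_on_subset\<close>)
  moreover have "Y p \<in> F ` ball p r" using Fp r(1) by (intro image_eqI[of _ F p]) auto
  moreover have "Y p \<in> closure (outside M)" using fr p by (auto simp: frontier_def M_def)
  ultimately obtain z where z: "z \<in> ball p r" "F z \<in> outside M"
    using closure_iff_nhds_not_empty[of "Y p" "outside M"] by blast
  have zp: "z \<bullet> p \<noteq> 1"
  proof
    assume "z \<bullet> p = 1"
    then have "z \<noteq> 0" "F z = Y (G z)" by (auto simp: F_def)
    then have "F z \<in> M" using Gs by (auto simp: M_def)
    then show False using z(2) outside_no_overlap by blast
  qed
  \<comment> \<open>The half-ball containing the outside point \<open>z\<close> decides which of the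
    two normals points outward.\<close>
  define sg where "sg = (if z \<bullet> p > 1 then 1 else - 1 :: real)"
  define Wp where "Wp = ball p r \<inter> {z. sg * (z \<bullet> p - 1) > 0}"
  have "convex {z. sg * (z \<bullet> p - 1) > 0}"
  proof -
    have eq: "{z. sg * (z \<bullet> p - 1) > 0} = {z. (sg *\<^sub>R p) \<bullet> z > sg}"
      by (auto simp: inner_commute algebra_simps)
    show ?thesis unfolding eq by (rule convex_halfspace_gt)
  qed
  then have "connected Wp" unfolding Wp_def by (intro convex_connected convex_Int convex_ball)
  moreover have "Wp \<subseteq> W" using r(2) by (auto simp: Wp_def)
  ultimately have "connected (F ` Wp)" using contF by (intro connected_continuous_image) (auto intro: continuous_on_subset)
  moreover have "F ` Wp \<subseteq> - M"
  proof -
    have "F x \<notin> M" if "x \<in> Wp" for x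
      by (rule off) (use that in \<open>auto simp: Wp_def\<close>)
    then show ?thesis by auto
  qed
  moreover have "F z \<in> F ` Wp" using z(1) zp by (auto simp: Wp_def sg_def)
  ultimately have out: "x \<in> outside M" if "x \<in> F ` Wp" for x
    using outside_same_component[OF _ z(2)] that unfolding connected_component_def by blast
  show ?thesis
  proof (rule that[of "sg *\<^sub>R n" r])
    show "sg *\<^sub>R n = n \<or> sg *\<^sub>R n = - n" by (simp add: sg_def)
    show "0 < r" by (rule r(1))
    fix s assume s: "0 < s" "s < r"
    let ?z = "(1 + sg * s) *\<^sub>R p"
    have pos: "0 < 1 + sg * s" using s by (auto simp: sg_def r_def)
    have zp: "?z \<bullet> p = 1 + sg * s" by (simp add: pp)
    have "dist p ?z = s" using s p by (simp add: dist_norm scaleR_add_left sg_def)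
    then have zin: "?z \<in> Wp" using s unfolding Wp_def mem_Collect_eq Int_iff zp by (auto simp: sg_def)
    have "G ?z = p" using p pos by (simp add: G_def)
    then have "F ?z = Y p + s *\<^sub>R (sg *\<^sub>R n)" unfolding F_def zp by (simp add: mult.commute)
    then show "Y p + s *\<^sub>R sg *\<^sub>R n \<in> outside (Y ` sphere 0 1)"
      using out zin unfolding M_def by fastforce
  qed
qed

section \<open>Charts of the sphere\<close>

definition orthonormal3 :: "real^3 \<Rightarrow> real^3 \<Rightarrow> real^3 \<Rightarrow> bool" where
  "orthonormal3 a b c \<longleftrightarrow> a \<bullet> a = 1 \<and> b \<bullet> b = 1 \<and> c \<bullet> c = 1 \<and> a \<bullet> b = 0 \<and> a \<bullet> c = 0 \<and> b \<bullet> c = 0"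

lemma orthonormal3_expand:
  assumes "orthonormal3 a b c"
  shows "v = (v \<bullet> a) *\<^sub>R a + (v \<bullet> b) *\<^sub>R b + (v \<bullet> c) *\<^sub>R c"
proof -
  note o = assms[unfolded orthonormal3_def]
  have ne: "a \<noteq> b" "a \<noteq> c" "b \<noteq> c" "a \<noteq> 0" "b \<noteq> 0" "c \<noteq> 0" using o by auto
  have "pairwise orthogonal {a, b, c}"
    using o by (auto simp: pairwise_def orthogonal_def inner_commute)
  then have "independent {a, b, c}"
    using pairwise_orthogonal_independent ne by auto
  moreover have "card {a, b, c} = DIM(real^3)" using ne by simp
  ultimately have sp: "span {a, b, c} = UNIV"
    by (metis dim_eq_card_independent dim_eq_full)
  define w where "w = v - ((v \<bullet> a) *\<^sub>R a + (v \<bullet> b) *\<^sub>R b + (v \<bullet> c) *\<^sub>R c)"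
  have "w \<bullet> a = 0" "w \<bullet> b = 0" "w \<bullet> c = 0"
    using o by (auto simp: w_def inner_diff_left inner_diff_right inner_add_left inner_add_right inner_commute)
  then have "orthogonal w y" if "y \<in> {a, b, c}" for y using that by (auto simp: orthogonal_def)
  then have "orthogonal w w" using orthogonal_to_span[of w "{a, b, c}" w] sp by auto
  then show ?thesis by (simp add: w_def orthogonal_self)
qed

lemma orthonormal3_inner:
  assumes "orthonormal3 a b c"
  shows "u \<bullet> v = (u \<bullet> a) * (v \<bullet> a) + (u \<bullet> b) * (v \<bullet> b) + (u \<bullet> c) * (v \<bullet> c)"
proof -
  have "u \<bullet> v = u \<bullet> ((v \<bullet> a) *\<^sub>R a + (v \<bullet> b) *\<^sub>R b + (v \<bullet> c) *\<^sub>R c)"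
    by (rule arg_cong[OF orthonormal3_expand[OF assms, of v]])
  then show ?thesis by (simp add: inner_add_right mult.commute)
qed

lemma orthonormal3_exists:
  assumes "norm c = 1"
  obtains a b where "orthonormal3 a b c"
proof -
  obtain y where y: "y \<noteq> 0" "orthogonal c y"
    using orthogonal_to_vector_exists[of c] by auto
  define a where "a = y /\<^sub>R norm y"
  have a: "a \<bullet> a = 1" "a \<bullet> c = 0"
    using y by (auto simp: a_def orthogonal_def inner_commute dot_square_norm power2_eq_square)
  have cc: "c \<bullet> c = 1" using assms by (simp add: norm_eq_1)
  have "(norm (cross3 c a))^2 = 1"
    using norm_cross_dot[of c a] a cc by (simp add: inner_commute dot_square_norm power_mult_distrib)
  then have "cross3 c a \<bullet> cross3 c a = 1" by (simp add: dot_square_norm)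
  then have "orthonormal3 a (cross3 c a) c"
    unfolding orthonormal3_def using a cc by (simp add: dot_cross_self inner_commute)
  then show ?thesis using that by blast
qed

definition te1 where "te1 p = fst (tframe p)"
definition te2 where "te2 p = snd (tframe p)"

lemma tframe:
  assumes "norm p = 1"
  shows "orthonormal3 (te1 p) (te2 p) p"
proof -
  obtain a b where "orthonormal3 a b p" using orthonormal3_exists[OF assms] by blast
  then have "\<exists>z. case z of (e1, e2) \<Rightarrow> e1 \<bullet> p = 0 \<and> e2 \<bullet> p = 0 \<and> e1 \<bullet> e2 = 0 \<and> norm e1 = 1 \<and> norm e2 = 1"
    by (intro exI[of _ "(a, b)"]) (auto simp: orthonormal3_def norm_eq_1)
  from someI_ex[OF this] show ?thesis
    unfolding tframe_def[symmetric] te1_def te2_def orthonormal3_def using assms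
    by (auto simp: norm_eq_1 split: prod.splits)
qed

definition chart_vec :: "real^3 \<Rightarrow> coords \<Rightarrow> real^3" where
  "chart_vec p x = p + fst x *\<^sub>R te1 p + fst (snd x) *\<^sub>R te2 p"

lemma chart_eq: "chart p (fst x) (fst (snd x)) = chart_vec p x /\<^sub>R norm (chart_vec p x)"
  by (simp add: chart_def chart_vec_def te1_def te2_def Let_def)

lemma chart_vec_inner:
  assumes "norm p = 1"
  shows "chart_vec p x \<bullet> p = 1" "chart_vec p x \<bullet> te1 p = fst x" "chart_vec p x \<bullet> te2 p = fst (snd x)" "chart_vec p x \<noteq> 0"
proof -
  show 1: "chart_vec p x \<bullet> p = 1" "chart_vec p x \<bullet> te1 p = fst x" "chart_vec p x \<bullet> te2 p = fst (snd x)"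
    using tframe[OF assms] by (auto simp: orthonormal3_def chart_vec_def inner_add_left inner_add_right inner_commute)
  show "chart_vec p x \<noteq> 0" using 1(1) by auto
qed

lemma smooth_chart_vec: "smooth_on V (chart_vec p)"
proof -
  have "smooth_on V (\<lambda>x. p + fst x *\<^sub>R te1 p + fst (snd x) *\<^sub>R te2 p)"
    by (intro smooth_on_add smooth_on_scaleR smooth_on_fst smooth_on_snd smooth_on_id smooth_on_const)
  then show ?thesis by (simp add: chart_vec_def[abs_def])
qed

definition chart_map :: "real^3 \<Rightarrow> coords \<Rightarrow> (real^3) \<times> real" where
  "chart_map p x = (chart p (fst x) (fst (snd x)), snd (snd x))"

lemma smooth_chart_map:
  assumes "norm p = 1"
  shows "smooth_on UNIV (chart_map p)"
proof -
  have "smooth_on UNIV (\<lambda>x. chart_vec p x /\<^sub>R norm (chart_vec p x))"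
    by (rule smooth_on_compose[OF smooth_on_normalize[of "UNIV - {0}"] smooth_chart_vec])
      (use chart_vec_inner(4)[OF assms] in auto)
  then show ?thesis unfolding chart_map_def[abs_def] chart_eq
    by (intro smooth_on_Pair smooth_on_snd smooth_on_id)
qed

lemma norm_chart:
  assumes "norm p = 1"
  shows "norm (chart p u v) = 1"
  using chart_eq[of p "(u, v, 0)"] chart_vec_inner(4)[OF assms, of "(u, v, 0)"] by simp

lemma chart_0: "norm p = 1 \<Longrightarrow> chart p 0 0 = p"
  by (simp add: chart_def)

text \<open>Quotients make this independent of the length of \<open>w\<close>, so the unnormalised
  \<open>chart_vec\<close> of another chart can be inserted directly.\<close>

definition chart_inv :: "real^3 \<Rightarrow> real^3 \<Rightarrow> real \<Rightarrow> coords" where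
  "chart_inv p w t = ((w \<bullet> te1 p) / (w \<bullet> p), (w \<bullet> te2 p) / (w \<bullet> p), t)"

lemma chart_chart_inv:
  assumes "norm p = 1" "0 < w \<bullet> p"
  shows "chart p (fst (chart_inv p w t)) (fst (snd (chart_inv p w t))) = w /\<^sub>R norm w"
proof -
  have "w /\<^sub>R (w \<bullet> p) = ((w \<bullet> te1 p) *\<^sub>R te1 p + (w \<bullet> te2 p) *\<^sub>R te2 p + (w \<bullet> p) *\<^sub>R p) /\<^sub>R (w \<bullet> p)"
    by (rule arg_cong[OF orthonormal3_expand[OF tframe[OF assms(1)], of w]])
  also have "\<dots> = chart_vec p (chart_inv p w t)"
    using assms(2) by (simp add: chart_vec_def chart_inv_def scaleR_add_right divide_inverse_commute)
  finally have "chart_vec p (chart_inv p w t) = w /\<^sub>R (w \<bullet> p)" ..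
  then show ?thesis unfolding chart_eq using assms(2) by simp
qed

section \<open>Derivatives of the parametrized family\<close>

definition param :: "(real^3 \<Rightarrow> real \<Rightarrow> real^3) \<Rightarrow> real^3 \<Rightarrow> coords \<Rightarrow> real^3" where
  "param X p x = X (chart p (fst x) (fst (snd x))) (snd (snd x))"

definition vd :: "coords \<Rightarrow> (coords \<Rightarrow> real^3) \<Rightarrow> coords \<Rightarrow> real^3" where
  "vd e Z x = frechet_derivative Z (at x) e"

text \<open>The shift by \<open>s0\<close> matches the coordinate lines of \<open>Yu\<close> and
  \<open>Yv\<close>, which are differentiated at the coordinate itself and not at 0.\<close>

lemma vd_line:
  assumes "smooth_on D Z" "x \<in> D"
  shows "vector_derivative (\<lambda>s. Z (x + (s - s0) *\<^sub>R e)) (at s0) = vd e Z x"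
proof -
  have "((\<lambda>s. x + (s - s0) *\<^sub>R e) has_derivative (\<lambda>h. h *\<^sub>R e)) (at s0)"
    by (auto intro!: derivative_eq_intros)
  moreover have "(Z has_derivative frechet_derivative Z (at x)) (at (x + (s0 - s0) *\<^sub>R e))"
    using smooth_on_has_derivative[OF assms] by simp
  ultimately have "((\<lambda>s. Z (x + (s - s0) *\<^sub>R e)) has_derivative (\<lambda>h. frechet_derivative Z (at x) (h *\<^sub>R e))) (at s0)"
    by (rule has_derivative_compose)
  then have "((\<lambda>s. Z (x + (s - s0) *\<^sub>R e)) has_vector_derivative vd e Z x) (at s0)"
    using linear_scale[OF linear_frechet_derivative[OF smooth_on_differentiable[OF assms]]]
    by (simp add: has_vector_derivative_def vd_def)
  then show ?thesis by (rule vector_derivative_at)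
qed

lemma smooth_vd: "open D \<Longrightarrow> smooth_on D Z \<Longrightarrow> smooth_on D (vd e Z)"
  unfolding vd_def[abs_def] by (rule smooth_on_frechet_derivative)

lemma vd_component:
  assumes "smooth_on D Z" "x \<in> D"
  shows "dird (\<lambda>_. e) (\<lambda>x. Z x \<bullet> E) x = vd e Z x \<bullet> E"
proof -
  have "((\<lambda>x. Z x \<bullet> E) has_derivative (\<lambda>h. frechet_derivative Z (at x) h \<bullet> E)) (at x)"
    by (rule has_derivative_inner_left[OF smooth_on_has_derivative[OF assms]])
  then show ?thesis unfolding dird_def vd_def by (simp add: frechet_derivative_at[symmetric])
qed

lemma vd_vd_component:
  assumes "open D" "smooth_on D Z" "x \<in> D"
  shows "dird (\<lambda>_. d) (dird (\<lambda>_. e) (\<lambda>x. Z x \<bullet> E)) x = vd d (vd e Z) x \<bullet> E"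
proof -
  have s: "smooth_on D (\<lambda>x. Z x \<bullet> E)" by (rule smooth_on_inner[OF assms(2) smooth_on_const])
  have "dird (\<lambda>_. d) (dird (\<lambda>_. e) (\<lambda>x. Z x \<bullet> E)) x = dird (\<lambda>_. d) (\<lambda>x. vd e Z x \<bullet> E) x"
    by (rule dird_cong[OF assms(1) vd_component[OF assms(2)] assms(3)
          smooth_on_differentiable[OF smooth_on_dird[OF assms(1) s smooth_on_const] assms(3)]])
  also have "\<dots> = vd d (vd e Z) x \<bullet> E"
    by (rule vd_component[OF smooth_vd[OF assms(1,2)] assms(3)])
  finally show ?thesis .
qed

abbreviation eu :: coords where "eu \<equiv> (1, 0, 0)"
abbreviation ev :: coords where "ev \<equiv> (0, 1, 0)"

locale embedded_family =
  fixes X :: "real^3 \<Rightarrow> real \<Rightarrow> real^3" and a b :: real and U :: "((real^3) \<times> real) set"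
  assumes U: "open U" "sphere 0 1 \<times> {a<..<b} \<subseteq> U"
    and smooth: "smooth_on U (\<lambda>z. X (fst z) (snd z))"
    and embedded: "\<forall>t\<in>{a<..<b}. inj_on (\<lambda>p. X p t) (sphere 0 1)"
    and immersed: "\<forall>t\<in>{a<..<b}. \<forall>p\<in>sphere 0 1.
                     inj_on (frechet_derivative (\<lambda>q. X q t) (at p)) {v. v \<bullet> p = 0}"
begin

definition "chart_dom p = chart_map p -` U"

lemma open_chart_dom: "norm p = 1 \<Longrightarrow> open (chart_dom p)"
  unfolding chart_dom_def
  by (rule open_vimage[OF U(1)]) (rule smooth_on_continuous_on[OF smooth_chart_map])

lemma smooth_param:
  assumes "norm p = 1"
  shows "smooth_on (chart_dom p) (param X p)"
proof -
  have "smooth_on (chart_dom p) (\<lambda>x. X (fst (chart_map p x)) (snd (chart_map p x)))"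
    by (rule smooth_on_compose[OF smooth smooth_on_subset[OF smooth_chart_map[OF assms]]])
      (auto simp: chart_dom_def)
  then show ?thesis by (simp add: chart_map_def param_def[abs_def])
qed

lemma in_chart_dom: "norm p = 1 \<Longrightarrow> t \<in> {a<..<b} \<Longrightarrow> (u, v, t) \<in> chart_dom p"
  using U(2) norm_chart[of p u v] by (auto simp: chart_dom_def chart_map_def)

lemma Y_first:
  assumes "norm p = 1" "t \<in> {a<..<b}"
  shows "Yu X p t u v = vd eu (param X p) (u, v, t)" "Yv X p t u v = vd ev (param X p) (u, v, t)"
  using vd_line[OF smooth_param[OF assms(1)] in_chart_dom[OF assms], of u v u eu]
    vd_line[OF smooth_param[OF assms(1)] in_chart_dom[OF assms], of u v v ev]
  by (simp_all add: Yu_def Yv_def locY_def param_def)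

lemma Y_second:
  assumes "norm p = 1" "t \<in> {a<..<b}"
  shows "Yuu X p t = vd eu (vd eu (param X p)) (0, 0, t)" "Yuv X p t = vd ev (vd eu (param X p)) (0, 0, t)"
    "Yvv X p t = vd ev (vd ev (param X p)) (0, 0, t)"
  using vd_line[OF smooth_vd[OF open_chart_dom[OF assms(1)] smooth_param[OF assms(1)], of eu] in_chart_dom[OF assms], of 0 0 0 eu]
    vd_line[OF smooth_vd[OF open_chart_dom[OF assms(1)] smooth_param[OF assms(1)], of eu] in_chart_dom[OF assms], of 0 0 0 ev]
    vd_line[OF smooth_vd[OF open_chart_dom[OF assms(1)] smooth_param[OF assms(1)], of ev] in_chart_dom[OF assms], of 0 0 0 ev]
  by (simp_all add: Yuu_def Yuv_def Yvv_def Y_first[OF assms])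

lemma smooth_slice: "smooth_on {z. (z, t) \<in> U} (\<lambda>q. X q t)"
proof -
  have "smooth_on {z. (z, t) \<in> U} (\<lambda>z. X (fst (z, t)) (snd (z, t)))"
    by (rule smooth_on_compose[OF smooth]) (auto intro: smooth_on_Pair)
  then show ?thesis by simp
qed

lemma open_slice: "open {z. (z, t) \<in> U}"
proof -
  have "open ((\<lambda>z. (z, t)) -` U)" by (intro open_vimage U continuous_intros)
  then show ?thesis by (simp add: vimage_def)
qed

lemma Y_frechet:
  assumes p: "norm p = 1" and t: "t \<in> {a<..<b}"
  shows "Yu X p t 0 0 = frechet_derivative (\<lambda>q. X q t) (at p) (te1 p)"
    "Yv X p t 0 0 = frechet_derivative (\<lambda>q. X q t) (at p) (te2 p)"
proof -
  have *: "vector_derivative (\<lambda>s. X ((p + s *\<^sub>R e) /\<^sub>R norm (p + s *\<^sub>R e)) t) (at 0) = frechet_derivative (\<lambda>q. X q t) (at p) e"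
    if e: "e \<bullet> p = 0" for e
  proof -
    let ?D = "frechet_derivative (\<lambda>q. X q t) (at p)"
    have pU: "p \<in> {z. (z, t) \<in> U}" using U(2) p t by auto
    have X: "((\<lambda>q. X q t) has_derivative ?D) (at p)" by (rule smooth_on_has_derivative[OF smooth_slice pU])
    have "((\<lambda>s. p + s *\<^sub>R e) has_derivative (\<lambda>h. h *\<^sub>R e)) (at 0)" by (auto intro!: derivative_eq_intros)
    moreover have "((\<lambda>z. z /\<^sub>R norm z) has_derivative (\<lambda>v. v - (v \<bullet> p) *\<^sub>R p)) (at (p + 0 *\<^sub>R e))"
      using has_derivative_normalize[OF p] by simp
    ultimately have "((\<lambda>s. (p + s *\<^sub>R e) /\<^sub>R norm (p + s *\<^sub>R e)) has_derivative (\<lambda>h. h *\<^sub>R e - ((h *\<^sub>R e) \<bullet> p) *\<^sub>R p)) (at 0)"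
      by (rule has_derivative_compose)
    moreover have "((\<lambda>q. X q t) has_derivative ?D) (at ((p + 0 *\<^sub>R e) /\<^sub>R norm (p + 0 *\<^sub>R e)))" using X p by simp
    ultimately have "((\<lambda>s. X ((p + s *\<^sub>R e) /\<^sub>R norm (p + s *\<^sub>R e)) t) has_derivative (\<lambda>h. ?D (h *\<^sub>R e - ((h *\<^sub>R e) \<bullet> p) *\<^sub>R p))) (at 0)"
      by (rule has_derivative_compose)
    moreover have "linear ?D" using has_derivative_bounded_linear[OF X] bounded_linear.linear by blast
    ultimately have "((\<lambda>s. X ((p + s *\<^sub>R e) /\<^sub>R norm (p + s *\<^sub>R e)) t) has_vector_derivative ?D e) (at 0)"
      using e by (simp add: has_vector_derivative_def linear_scale)
    then show ?thesis by (rule vector_derivative_at)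
  qed
  have o: "te1 p \<bullet> p = 0" "te2 p \<bullet> p = 0" using tframe[OF p] by (auto simp: orthonormal3_def)
  show "Yu X p t 0 0 = frechet_derivative (\<lambda>q. X q t) (at p) (te1 p)"
    "Yv X p t 0 0 = frechet_derivative (\<lambda>q. X q t) (at p) (te2 p)"
    using *[OF o(1)] *[OF o(2)] by (simp_all add: Yu_def Yv_def locY_def chart_def Let_def te1_def te2_def)
qed

lemma linear_frechet_slice:
  assumes p: "norm p = 1" and t: "t \<in> {a<..<b}"
  shows "linear (frechet_derivative (\<lambda>q. X q t) (at p))"
  by (rule linear_frechet_derivative[OF smooth_on_differentiable[OF smooth_slice]]) (use U(2) p t in auto)

lemma gram_pos:
  assumes p: "norm p = 1" and t: "t \<in> {a<..<b}"
  shows "0 < g11 X p t" "0 < g11 X p t * g22 X p t - (g12 X p t)^2"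
proof -
  let ?D = "frechet_derivative (\<lambda>q. X q t) (at p)"
  note l = linear_frechet_slice[OF p t]
  have inj: "v = 0" if "?D v = 0" "v \<bullet> p = 0" for v
    using immersed[rule_format, OF t, of p] p that linear_0[OF l] by (auto simp: inj_on_def)
  note o = tframe[OF p, unfolded orthonormal3_def]
  define A where "A = Yu X p t 0 0"
  define B where "B = Yv X p t 0 0"
  have g: "g11 X p t = A \<bullet> A" "g12 X p t = A \<bullet> B" "g22 X p t = B \<bullet> B"
    by (simp_all add: g11_def g12_def g22_def A_def B_def)
  have AB: "A = ?D (te1 p)" "B = ?D (te2 p)" unfolding A_def B_def by (rule Y_frechet[OF p t])+
  have comb: "x = 0 \<and> y = 0" if "x *\<^sub>R A + y *\<^sub>R B = 0" for x y
  proof -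
    have "?D (x *\<^sub>R te1 p + y *\<^sub>R te2 p) = 0" using that unfolding AB by (simp add: linear_add[OF l] linear_scale[OF l])
    then have z: "x *\<^sub>R te1 p + y *\<^sub>R te2 p = 0" by (rule inj) (use o in \<open>simp add: inner_add_left\<close>)
    have "(x *\<^sub>R te1 p + y *\<^sub>R te2 p) \<bullet> te1 p = x" "(x *\<^sub>R te1 p + y *\<^sub>R te2 p) \<bullet> te2 p = y"
      using o by (simp_all add: inner_add_left inner_add_right inner_commute)
    then show ?thesis unfolding z by simp
  qed
  have "A \<noteq> 0" using comb[of 1 0] by auto
  then show A0: "0 < g11 X p t" unfolding g by simp
  \<comment> \<open>The part of \<open>B\<close> orthogonal to \<open>A\<close>, multiplied by
    \<open>A \<bullet> A\<close> to avoid a division; its squared length contains the Gram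
    determinant as a factor.\<close>
  define z where "z = - (A \<bullet> B) *\<^sub>R A + (A \<bullet> A) *\<^sub>R B"
  have "z \<noteq> 0" using comb[of "- (A \<bullet> B)" "A \<bullet> A"] A0 unfolding z_def g by auto
  then have "0 < z \<bullet> z" by simp
  also have "z \<bullet> z = (A \<bullet> A) * ((A \<bullet> A) * (B \<bullet> B) - (A \<bullet> B)^2)"
    unfolding z_def by (simp add: inner_add_left inner_add_right inner_commute algebra_simps power2_eq_square)
  finally show "0 < g11 X p t * g22 X p t - (g12 X p t)^2"
    using A0 unfolding g by (simp add: zero_less_mult_iff)
qed

text \<open>The properties of a \<open>SOME\<close> term follow only from existence. The normalised
  cross product or its negative is a witness, by \<open>normal_side_outside\<close>.\<close>

lemma outer_normal:
  assumes p: "norm p = 1" and t: "t \<in> {a<..<b}"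
  shows "norm (outer_normal X p t) = 1" "outer_normal X p t \<bullet> Yu X p t 0 0 = 0" "outer_normal X p t \<bullet> Yv X p t 0 0 = 0"
proof -
  let ?A = "Yu X p t 0 0" and ?B = "Yv X p t 0 0"
  define c where "c = cross3 ?A ?B"
  have "c \<noteq> 0"
  proof
    assume "c = 0"
    then have "(?A \<bullet> ?B)^2 = (norm ?A * norm ?B)^2" using norm_cross_dot[of ?A ?B] by (simp add: c_def)
    then show False using gram_pos(2)[OF p t]
      by (simp add: g11_def g12_def g22_def power_mult_distrib dot_square_norm)
  qed
  define n where "n = c /\<^sub>R norm c"
  have n: "norm n = 1" "?A \<bullet> n = 0" "?B \<bullet> n = 0"
    using \<open>c \<noteq> 0\<close> by (simp_all add: n_def c_def dot_cross_self)
  have perp: "frechet_derivative (\<lambda>q. X q t) (at p) v \<bullet> n = 0" if "v \<bullet> p = 0" for v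
  proof -
    note l = linear_frechet_slice[OF p t]
    have "frechet_derivative (\<lambda>q. X q t) (at p) v
       = frechet_derivative (\<lambda>q. X q t) (at p) ((v \<bullet> te1 p) *\<^sub>R te1 p + (v \<bullet> te2 p) *\<^sub>R te2 p + (v \<bullet> p) *\<^sub>R p)"
      by (rule arg_cong[OF orthonormal3_expand[OF tframe[OF p], of v]])
    also have "\<dots> = (v \<bullet> te1 p) *\<^sub>R ?A + (v \<bullet> te2 p) *\<^sub>R ?B"
      unfolding Y_frechet[OF p t] using that by (simp add: linear_add[OF l] linear_scale[OF l])
    finally show ?thesis using n by (simp add: inner_add_left)
  qed
  obtain m e where m: "m = n \<or> m = - n" "0 < e"
    "\<And>s. 0 < s \<Longrightarrow> s < e \<Longrightarrow> X p t + s *\<^sub>R m \<in> outside ((\<lambda>q. X q t) ` sphere 0 1)"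
  proof (rule normal_side_outside[of "{z. (z, t) \<in> U}" "\<lambda>q. X q t" p n])
    show "sphere 0 1 \<subseteq> {z. (z, t) \<in> U}" using U(2) t by auto
    show "inj_on (\<lambda>q. X q t) (sphere 0 1)" using embedded t by blast
    show "inj_on (frechet_derivative (\<lambda>q. X q t) (at p)) {v. v \<bullet> p = 0}"
      using immersed t p by simp
  qed (use open_slice smooth_slice p n(1) perp in \<open>simp_all\<close>)
  have "\<exists>n. norm n = 1 \<and> n \<bullet> ?A = 0 \<and> n \<bullet> ?B = 0 \<and> (\<exists>e>0. \<forall>s\<in>{0<..<e}. X p t + s *\<^sub>R n \<in> outside ((\<lambda>q. X q t) ` sphere 0 1))"
    by (rule exI[of _ m]) (use m n in \<open>auto simp: inner_commute\<close>)
  from someI_ex[OF this]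
  show "norm (outer_normal X p t) = 1" "outer_normal X p t \<bullet> Yu X p t 0 0 = 0" "outer_normal X p t \<bullet> Yv X p t 0 0 = 0"
    unfolding outer_normal_def[symmetric] by simp_all
qed

end

section \<open>Change of chart\<close>

lemma spatial_chain:
  fixes \<phi>1 \<phi>2 \<psi> :: "coords \<Rightarrow> real"
  assumes \<phi>: "smooth_on D \<phi>1" "smooth_on D \<phi>2" and \<psi>: "smooth_on V \<psi>"
    and x: "x \<in> D" "(\<phi>1 x, \<phi>2 x, snd (snd x)) \<in> V" and d: "snd (snd d) = 0"
  shows "dird (\<lambda>_. d) (\<lambda>x. \<psi> (\<phi>1 x, \<phi>2 x, snd (snd x))) x
    = dird (\<lambda>_. d) \<phi>1 x * pu \<psi> (\<phi>1 x, \<phi>2 x, snd (snd x)) + dird (\<lambda>_. d) \<phi>2 x * pv \<psi> (\<phi>1 x, \<phi>2 x, snd (snd x))"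
proof -
  let ?\<Theta> = "\<lambda>x. (\<phi>1 x, \<phi>2 x, snd (snd x))"
  have "(?\<Theta> has_derivative (\<lambda>h. (frechet_derivative \<phi>1 (at x) h, frechet_derivative \<phi>2 (at x) h, snd (snd h)))) (at x)"
    by (intro has_derivative_Pair smooth_on_has_derivative[OF \<phi>(1) x(1)] smooth_on_has_derivative[OF \<phi>(2) x(1)]
        has_derivative_snd has_derivative_ident)
  from has_derivative_compose[OF this smooth_on_has_derivative[OF \<psi> x(2)]]
  have "frechet_derivative (\<lambda>x. \<psi> (?\<Theta> x)) (at x)
     = (\<lambda>h. frechet_derivative \<psi> (at (?\<Theta> x)) (frechet_derivative \<phi>1 (at x) h, frechet_derivative \<phi>2 (at x) h, snd (snd h)))"
    by (rule frechet_derivative_at[symmetric])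
  then show ?thesis
    unfolding dird_def[of "\<lambda>_. d"] by (simp add: frechet_coords[OF smooth_on_differentiable[OF \<psi> x(2)]] d)
qed

text \<open>Second derivatives of the coordinate change occur only multiplied by first derivatives
  of \<open>\<psi>\<close>, which vanish at \<open>y\<close>. There the second derivative transforms
  as a bilinear form.\<close>

lemma spatial_chain_second:
  fixes \<phi>1 \<phi>2 \<psi> :: "coords \<Rightarrow> real"
  assumes D: "open D" and V: "open V" and \<phi>: "smooth_on D \<phi>1" "smooth_on D \<phi>2" and \<psi>: "smooth_on V \<psi>"
    and into: "\<And>x. x \<in> D \<Longrightarrow> (\<phi>1 x, \<phi>2 x, snd (snd x)) \<in> V" and x: "x \<in> D" and d: "snd (snd d) = 0" and e: "snd (snd e) = 0"
    and y: "y = (\<phi>1 x, \<phi>2 x, snd (snd x))" and crit: "pu \<psi> y = 0" "pv \<psi> y = 0"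
  shows "dird (\<lambda>_. e) (dird (\<lambda>_. d) (\<lambda>x. \<psi> (\<phi>1 x, \<phi>2 x, snd (snd x)))) x
    = dird (\<lambda>_. d) \<phi>1 x * (dird (\<lambda>_. e) \<phi>1 x * pu (pu \<psi>) y + dird (\<lambda>_. e) \<phi>2 x * pv (pu \<psi>) y)
    + dird (\<lambda>_. d) \<phi>2 x * (dird (\<lambda>_. e) \<phi>1 x * pu (pv \<psi>) y + dird (\<lambda>_. e) \<phi>2 x * pv (pv \<psi>) y)"
proof -
  let ?\<Theta> = "\<lambda>x. (\<phi>1 x, \<phi>2 x, snd (snd x))"
  have s\<Theta>: "smooth_on D ?\<Theta>" using \<phi> by (intro smooth_on_Pair smooth_on_snd smooth_on_id)
  have im: "?\<Theta> ` D \<subseteq> V" using into by auto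
  have sp: "smooth_on V (pu \<psi>)" "smooth_on V (pv \<psi>)" by (rule smooth_on_dird[OF V \<psi> smooth_on_const])+
  let ?g = "\<lambda>x. dird (\<lambda>_. d) \<phi>1 x * pu \<psi> (?\<Theta> x) + dird (\<lambda>_. d) \<phi>2 x * pv \<psi> (?\<Theta> x)"
  have sc: "smooth_on D (\<lambda>x. pu \<psi> (?\<Theta> x))" "smooth_on D (\<lambda>x. pv \<psi> (?\<Theta> x))"
    by (rule smooth_on_compose[OF sp(1) s\<Theta> im], rule smooth_on_compose[OF sp(2) s\<Theta> im])
  have sd: "smooth_on D (dird (\<lambda>_. d) \<phi>1)" "smooth_on D (dird (\<lambda>_. d) \<phi>2)"
    by (intro smooth_on_dird D \<phi> smooth_on_const)+
  have s\<psi>: "smooth_on D (\<lambda>x. \<psi> (?\<Theta> x))" by (rule smooth_on_compose[OF \<psi> s\<Theta> im])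
  have "dird (\<lambda>_. e) (dird (\<lambda>_. d) (\<lambda>x. \<psi> (?\<Theta> x))) x = dird (\<lambda>_. e) ?g x"
    by (rule dird_cong[OF D spatial_chain[OF \<phi> \<psi> _ into d] x
          smooth_on_differentiable[OF smooth_on_dird[OF D s\<psi> smooth_on_const] x]])
  also have "\<dots> = (dird (\<lambda>_. d) \<phi>1 x * dird (\<lambda>_. e) (\<lambda>x. pu \<psi> (?\<Theta> x)) x + dird (\<lambda>_. e) (dird (\<lambda>_. d) \<phi>1) x * pu \<psi> (?\<Theta> x))
     + (dird (\<lambda>_. d) \<phi>2 x * dird (\<lambda>_. e) (\<lambda>x. pv \<psi> (?\<Theta> x)) x + dird (\<lambda>_. e) (dird (\<lambda>_. d) \<phi>2) x * pv \<psi> (?\<Theta> x))"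
    by (rule has_dird_imp_dird[OF has_dird_add[OF has_dird_mult[OF has_dird_dird[OF sd(1)] has_dird_dird[OF sc(1)]]
          has_dird_mult[OF has_dird_dird[OF sd(2)] has_dird_dird[OF sc(2)]]] x])
  finally show ?thesis
    unfolding spatial_chain[OF \<phi> sp(1) x into[OF x] e] spatial_chain[OF \<phi> sp(2) x into[OF x] e] y[symmetric] crit by simp
qed

text \<open>\<open>meanH\<close> evaluates only at the centre of a chart and with the chosen normal;
  here the point of the chart and the normal are free.\<close>

definition form_H :: "(coords \<Rightarrow> real^3) \<Rightarrow> coords \<Rightarrow> real^3 \<Rightarrow> real" where
  "form_H Z x n = ((vd ev Z x \<bullet> vd ev Z x) * (- (vd eu (vd eu Z) x \<bullet> n))
     - 2 * (vd eu Z x \<bullet> vd ev Z x) * (- (vd ev (vd eu Z) x \<bullet> n))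
     + (vd eu Z x \<bullet> vd eu Z x) * (- (vd ev (vd ev Z) x \<bullet> n)))
   / ((vd eu Z x \<bullet> vd eu Z x) * (vd ev Z x \<bullet> vd ev Z x) - (vd eu Z x \<bullet> vd ev Z x)^2)"

definition form_K :: "(coords \<Rightarrow> real^3) \<Rightarrow> coords \<Rightarrow> real^3 \<Rightarrow> real" where
  "form_K Z x n = ((vd eu (vd eu Z) x \<bullet> n) * (vd ev (vd ev Z) x \<bullet> n) - (vd ev (vd eu Z) x \<bullet> n)^2)
   / ((vd eu Z x \<bullet> vd eu Z x) * (vd ev Z x \<bullet> vd ev Z x) - (vd eu Z x \<bullet> vd ev Z x)^2)"

text \<open>The bilinear form below is, up to a factor, the mixed entry of \<open>D\<^sup>2\<sigma>\<close> in the frame; a rotation by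
  \<open>\<pi>/2\<close> changes its sign.\<close>
lemma rotate_frame:
  fixes A B c :: "real^3" and l11 l12 l22 :: real
  assumes "norm c = 1"
  obtains E1 E2 where "orthonormal3 E1 E2 c"
    "(A \<bullet> E1) * (A \<bullet> E2) * l22 - ((B \<bullet> E1) * (A \<bullet> E2) + (A \<bullet> E1) * (B \<bullet> E2)) * l12 + (B \<bullet> E1) * (B \<bullet> E2) * l11 = 0"
proof -
  obtain F1 F2 where F: "orthonormal3 F1 F2 c" using orthonormal3_exists[OF assms] by blast
  define \<beta> where "\<beta> v w = (A \<bullet> v) * (A \<bullet> w) * l22 - ((B \<bullet> v) * (A \<bullet> w) + (A \<bullet> v) * (B \<bullet> w)) * l12 + (B \<bullet> v) * (B \<bullet> w) * l11" for v w
  define G1 where "G1 \<theta> = cos \<theta> *\<^sub>R F1 + sin \<theta> *\<^sub>R F2" for \<theta> :: real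
  define G2 where "G2 \<theta> = - sin \<theta> *\<^sub>R F1 + cos \<theta> *\<^sub>R F2" for \<theta> :: real
  have on: "orthonormal3 (G1 \<theta>) (G2 \<theta>) c" for \<theta>
  proof -
    have "cos \<theta> * cos \<theta> + sin \<theta> * sin \<theta> = 1" "sin \<theta> * sin \<theta> + cos \<theta> * cos \<theta> = 1"
      using sin_cos_squared_add[of \<theta>] by (simp_all add: power2_eq_square)
    then show ?thesis using F unfolding orthonormal3_def G1_def G2_def
      by (simp add: inner_add_left inner_add_right inner_diff_left inner_diff_right inner_commute)
  qed
  define h where "h \<theta> = \<beta> (G1 \<theta>) (G2 \<theta>)" for \<theta>
  have cont: "continuous_on {0..pi/2} h"
    unfolding h_def \<beta>_def G1_def G2_def by (intro continuous_intros)
  have h0: "h 0 = \<beta> F1 F2" by (simp add: h_def G1_def G2_def)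
  have h1: "h (pi/2) = - \<beta> F1 F2" by (simp add: h_def G1_def G2_def \<beta>_def algebra_simps)
  have "\<exists>\<theta>. h \<theta> = 0"
  proof (cases "\<beta> F1 F2 \<le> 0")
    case True
    then show ?thesis using IVT'[of h 0 0 "pi/2"] h0 h1 cont by auto
  next
    case False
    then show ?thesis using IVT2'[of h "pi/2" 0 0] h0 h1 cont by auto
  qed
  then obtain \<theta> where "h \<theta> = 0" by blast
  then show ?thesis using that[OF on[of \<theta>]] unfolding h_def \<beta>_def by simp
qed

context embedded_family
begin

lemma curvature_forms:
  assumes "norm p = 1" "t \<in> {a<..<b}"
  shows "meanH X p t = form_H (param X p) (0, 0, t) (outer_normal X p t)"
    "gaussK X p t = form_K (param X p) (0, 0, t) (outer_normal X p t)"
  unfolding meanH_def gaussK_def form_H_def form_K_def g11_def g12_def g22_def h11_def h12_def h22_def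
    Y_first[OF assms] Y_second[OF assms] by simp_all

text \<open>Moves the curvatures at \<open>q\<close>, defined in the chart around \<open>q\<close>,
  to the chart around \<open>p\<close>. With \<open>n\<close> held fixed, the function
  \<open>X \<bullet> n\<close> is critical at the point, so its second derivatives change like the
  first fundamental form.\<close>

lemma chart_change:
  assumes p: "norm p = 1" and q: "norm q = 1" and pq: "0 < q \<bullet> p" and t: "t \<in> {a<..<b}"
  defines "x \<equiv> chart_inv p q t" and "n \<equiv> outer_normal X q t"
  shows "n \<bullet> vd eu (param X p) x = 0" "n \<bullet> vd ev (param X p) x = 0"
    "meanH X q t = form_H (param X p) x n" "gaussK X q t = form_K (param X p) x n"
    "0 < (vd eu (param X p) x \<bullet> vd eu (param X p) x) * (vd ev (param X p) x \<bullet> vd ev (param X p) x) - (vd eu (param X p) x \<bullet> vd ev (param X p) x)^2"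
proof -
  define D where "D = {x. 0 < chart_vec q x \<bullet> p} \<inter> chart_dom q"
  \<comment> \<open>The transition between two gnomonic charts, a quotient of affine
    functions.\<close>
  define \<phi>1 where "\<phi>1 = (\<lambda>x. (chart_vec q x \<bullet> te1 p) / (chart_vec q x \<bullet> p))"
  define \<phi>2 where "\<phi>2 = (\<lambda>x. (chart_vec q x \<bullet> te2 p) / (chart_vec q x \<bullet> p))"
  define x0 :: coords where "x0 = (0, 0, t)"
  have "continuous_on UNIV (chart_vec q)" by (rule smooth_on_continuous_on[OF smooth_chart_vec])
  then have "open {x. 0 < chart_vec q x \<bullet> p}" by (intro open_Collect_less continuous_intros)
  then have D: "open D" unfolding D_def using open_chart_dom[OF q] by blast
  have x0: "x0 \<in> D" unfolding D_def x0_def using in_chart_dom[OF q t] pq by (simp add: chart_vec_def)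
  have s\<phi>: "smooth_on D \<phi>1" "smooth_on D \<phi>2"
    unfolding \<phi>1_def \<phi>2_def
    by (intro smooth_on_divide smooth_on_inner smooth_chart_vec smooth_on_const; simp add: D_def)+
  have \<Theta>: "(\<phi>1 z, \<phi>2 z, snd (snd z)) = chart_inv p (chart_vec q z) (snd (snd z))" for z
    by (simp add: chart_inv_def \<phi>1_def \<phi>2_def)
  have x: "x = (\<phi>1 x0, \<phi>2 x0, snd (snd x0))" unfolding \<Theta> x_def x0_def by (simp add: chart_vec_def)
  have cm: "chart_map p (\<phi>1 z, \<phi>2 z, snd (snd z)) = chart_map q z" if "z \<in> D" for z
  proof -
    have "chart p (\<phi>1 z) (\<phi>2 z) = chart q (fst z) (fst (snd z))"
      using chart_chart_inv[OF p, of "chart_vec q z" "snd (snd z)"] that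
      unfolding chart_eq[of q] D_def by (simp add: chart_inv_def \<phi>1_def \<phi>2_def)
    then show ?thesis by (simp add: chart_map_def)
  qed
  have into: "(\<phi>1 z, \<phi>2 z, snd (snd z)) \<in> chart_dom p" if "z \<in> D" for z
    using cm[OF that] that unfolding chart_dom_def D_def by simp
  have par: "param X q z = param X p (\<phi>1 z, \<phi>2 z, snd (snd z))" if "z \<in> D" for z
    using cm[OF that] unfolding chart_map_def param_def by simp
  note sp = smooth_param[OF p] and sq = smooth_on_subset[OF smooth_param[OF q], of D]
  have sqD: "smooth_on D (param X q)" by (rule sq) (simp add: D_def)
  note op = open_chart_dom[OF p]
  have xd: "x \<in> chart_dom p" unfolding x by (rule into[OF x0])
  let ?f = "\<lambda>E x. param X p x \<bullet> E"
  have sf: "smooth_on (chart_dom p) (?f E)" for E by (rule smooth_on_inner[OF sp smooth_on_const])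
  have sfq: "smooth_on D (\<lambda>x. param X q x \<bullet> E)" for E by (rule smooth_on_inner[OF sqD smooth_on_const])
  have first: "vd d (param X q) x0 = dird (\<lambda>_. d) \<phi>1 x0 *\<^sub>R vd eu (param X p) x + dird (\<lambda>_. d) \<phi>2 x0 *\<^sub>R vd ev (param X p) x"
    if d: "snd (snd d) = 0" for d
  proof (rule euclidean_eqI)
    fix E :: "real^3"
    have "vd d (param X q) x0 \<bullet> E = dird (\<lambda>_. d) (\<lambda>z. param X q z \<bullet> E) x0"
      by (rule vd_component[OF sqD x0, symmetric])
    also have "\<dots> = dird (\<lambda>_. d) (\<lambda>z. ?f E (\<phi>1 z, \<phi>2 z, snd (snd z))) x0"
      by (rule dird_cong[OF D _ x0 smooth_on_differentiable[OF sfq x0]]) (simp add: par)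
    also have "\<dots> = dird (\<lambda>_. d) \<phi>1 x0 * (vd eu (param X p) x \<bullet> E) + dird (\<lambda>_. d) \<phi>2 x0 * (vd ev (param X p) x \<bullet> E)"
      unfolding spatial_chain[OF s\<phi> sf x0 into[OF x0] d] x[symmetric] vd_component[OF sp xd] ..
    finally show "vd d (param X q) x0 \<bullet> E = (dird (\<lambda>_. d) \<phi>1 x0 *\<^sub>R vd eu (param X p) x + dird (\<lambda>_. d) \<phi>2 x0 *\<^sub>R vd ev (param X p) x) \<bullet> E"
      by (simp add: inner_add_left)
  qed
  define A where "A = vd eu (param X p) x"
  define B where "B = vd ev (param X p) x"
  define a11 a21 a12 a22 where "a11 = pu \<phi>1 x0" and "a21 = pu \<phi>2 x0" and "a12 = pv \<phi>1 x0" and "a22 = pv \<phi>2 x0"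
  note as = this
  have Yu: "vd eu (param X q) x0 = a11 *\<^sub>R A + a21 *\<^sub>R B" and Yv: "vd ev (param X q) x0 = a12 *\<^sub>R A + a22 *\<^sub>R B"
    using first[of eu] first[of ev] by (simp_all add: A_def B_def as)
  \<comment> \<open>Jacobian of the transition. The Gram determinant and both curvature numerators
    acquire the factor \<open>\<delta>^2\<close>, which cancels.\<close>
  define \<delta> where "\<delta> = a11 * a22 - a21 * a12"
  let ?gr = "\<lambda>u v::real^3. (u \<bullet> u) * (v \<bullet> v) - (u \<bullet> v)^2"
  have gr: "?gr (vd eu (param X q) x0) (vd ev (param X q) x0) = \<delta>^2 * ?gr A B"
    unfolding Yu Yv \<delta>_def inner_add_left inner_add_right inner_scaleR_left inner_scaleR_right inner_commute[of B A]
    by algebra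
  have grp: "0 < ?gr (vd eu (param X q) x0) (vd ev (param X q) x0)"
    using gram_pos(2)[OF q t] unfolding g11_def g12_def g22_def Y_first[OF q t] x0_def .
  then have \<delta>: "\<delta> \<noteq> 0" unfolding gr by auto
  show "0 < ?gr (vd eu (param X p) x) (vd ev (param X p) x)"
    using grp unfolding gr A_def[symmetric] B_def[symmetric] by (simp add: zero_less_mult_iff)
  have "n \<bullet> (a11 *\<^sub>R A + a21 *\<^sub>R B) = 0" "n \<bullet> (a12 *\<^sub>R A + a22 *\<^sub>R B) = 0"
    unfolding Yu[symmetric] Yv[symmetric] n_def x0_def Y_first[OF q t, symmetric] by (rule outer_normal[OF q t])+
  then have "a11 * (n \<bullet> A) + a21 * (n \<bullet> B) = 0" "a12 * (n \<bullet> A) + a22 * (n \<bullet> B) = 0"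
    by (simp_all add: inner_add_right)
  from linear_system_trivial[OF this \<delta>[unfolded \<delta>_def]]
  have nA: "n \<bullet> A = 0" and nB: "n \<bullet> B = 0" .
  show "n \<bullet> vd eu (param X p) x = 0" "n \<bullet> vd ev (param X p) x = 0"
    using nA nB by (simp_all add: A_def B_def)
  have crit: "pu (?f n) x = 0" "pv (?f n) x = 0"
    unfolding vd_component[OF sp xd] using nA nB by (simp_all add: A_def B_def inner_commute)
  define l11 l12 l22 where "l11 = vd eu (vd eu (param X p)) x \<bullet> n" and "l12 = vd ev (vd eu (param X p)) x \<bullet> n"
    and "l22 = vd ev (vd ev (param X p)) x \<bullet> n"
  note ls = this
  have l21: "pu (pv (?f n)) x = l12"
    unfolding ls vd_vd_component[OF op sp xd, symmetric] dird_def
    by (rule frechet_derivative_commute[OF op sf xd])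
  have second: "vd e (vd d (param X q)) x0 \<bullet> n
    = dird (\<lambda>_. d) \<phi>1 x0 * (dird (\<lambda>_. e) \<phi>1 x0 * l11 + dird (\<lambda>_. e) \<phi>2 x0 * l12)
    + dird (\<lambda>_. d) \<phi>2 x0 * (dird (\<lambda>_. e) \<phi>1 x0 * l12 + dird (\<lambda>_. e) \<phi>2 x0 * l22)"
    if d: "snd (snd d) = 0" "snd (snd e) = 0" for d e
  proof -
    have "vd e (vd d (param X q)) x0 \<bullet> n = dird (\<lambda>_. e) (dird (\<lambda>_. d) (\<lambda>z. param X q z \<bullet> n)) x0"
      by (rule vd_vd_component[OF D sqD x0, symmetric])
    also have "\<dots> = dird (\<lambda>_. e) (dird (\<lambda>_. d) (\<lambda>z. ?f n (\<phi>1 z, \<phi>2 z, snd (snd z)))) x0"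
      by (rule dird_cong2[OF D _ x0 sfq smooth_on_const]) (simp add: par)
    also have "\<dots> = dird (\<lambda>_. d) \<phi>1 x0 * (dird (\<lambda>_. e) \<phi>1 x0 * pu (pu (?f n)) x + dird (\<lambda>_. e) \<phi>2 x0 * pv (pu (?f n)) x)
      + dird (\<lambda>_. d) \<phi>2 x0 * (dird (\<lambda>_. e) \<phi>1 x0 * pu (pv (?f n)) x + dird (\<lambda>_. e) \<phi>2 x0 * pv (pv (?f n)) x)"
      by (rule spatial_chain_second[OF D op s\<phi> sf into x0 d x crit])
    finally show ?thesis
      unfolding l21 unfolding vd_vd_component[OF op sp xd] ls .
  qed
  note H = curvature_forms[OF q t, folded x0_def n_def]
  have u: "snd (snd eu) = 0" "snd (snd ev) = 0" by simp_all
  note sec = second[OF u(1) u(1)] second[OF u(1) u(2)] second[OF u(2) u(2)]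
  note sec' = sec[folded as]
  have numH: "(vd ev (param X q) x0 \<bullet> vd ev (param X q) x0) * (- (vd eu (vd eu (param X q)) x0 \<bullet> n))
     - 2 * (vd eu (param X q) x0 \<bullet> vd ev (param X q) x0) * (- (vd ev (vd eu (param X q)) x0 \<bullet> n))
     + (vd eu (param X q) x0 \<bullet> vd eu (param X q) x0) * (- (vd ev (vd ev (param X q)) x0 \<bullet> n))
    = \<delta>^2 * ((B \<bullet> B) * (- l11) - 2 * (A \<bullet> B) * (- l12) + (A \<bullet> A) * (- l22))"
    unfolding sec' Yu Yv \<delta>_def inner_add_left inner_add_right inner_scaleR_left inner_scaleR_right inner_commute[of B A]
    by algebra
  have numK: "(vd eu (vd eu (param X q)) x0 \<bullet> n) * (vd ev (vd ev (param X q)) x0 \<bullet> n) - (vd ev (vd eu (param X q)) x0 \<bullet> n)^2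
    = \<delta>^2 * (l11 * l22 - l12^2)"
    unfolding sec' \<delta>_def by algebra
  show "meanH X q t = form_H (param X p) x n" "gaussK X q t = form_K (param X p) x n"
    unfolding H form_H_def form_K_def gr numH numK unfolding A_def[symmetric] B_def[symmetric] ls[symmetric]
    using \<delta> by simp_all
qed

end

section \<open>The maximum principle\<close>

text \<open>The level \<open>M t2\<close>, relaxed linearly backward in time, is attained on a
  compact set of points and times, which has an earliest time. Were this later than
  \<open>t1\<close>, the backward estimate at a maximiser of that time would produce an earlier
  one.\<close>

lemma Sup_nonincreasing_of_backward_estimate:
  fixes q :: "'a::metric_space \<times> real \<Rightarrow> real"
  assumes S: "compact S" "S \<noteq> {}" and cont: "continuous_on (S \<times> {a<..<b}) q"
    and backward: "\<And>t p \<epsilon>. t \<in> {a<..<b} \<Longrightarrow> p \<in> S \<Longrightarrow> (\<And>p'. p' \<in> S \<Longrightarrow> q (p', t) \<le> q (p, t)) \<Longrightarrow> 0 < \<epsilon>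
      \<Longrightarrow> \<forall>\<^sub>F h in at_right 0. q (p, t) - \<epsilon> * h \<le> q (p, t - h)"
    and t: "a < t1" "t1 \<le> t2" "t2 < b"
  shows "Sup ((\<lambda>p. q (p, t2)) ` S) \<le> Sup ((\<lambda>p. q (p, t1)) ` S)"
proof -
  define M where "M t = Sup ((\<lambda>p. q (p, t)) ` S)" for t
  have contt: "continuous_on S (\<lambda>p. q (p, t))" if "t \<in> {a<..<b}" for t
    by (rule continuous_on_compose2[OF cont]) (use that in \<open>auto intro!: continuous_intros\<close>)
  have M: "\<exists>p\<in>S. M t = q (p, t) \<and> (\<forall>p'\<in>S. q (p', t) \<le> q (p, t))" if "t \<in> {a<..<b}" for t
  proof -
    note ct = contt[OF that]
    obtain p where p: "p \<in> S" "\<forall>p'\<in>S. q (p', t) \<le> q (p, t)"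
      using continuous_attains_sup[OF S ct] by blast
    have "M t = q (p, t)" unfolding M_def
      by (rule cSup_eq_maximum) (use p in auto)
    then show ?thesis using p by blast
  qed
  have le: "q (p, t) \<le> M t" if "t \<in> {a<..<b}" "p \<in> S" for p t
    using M[OF that(1)] that(2) by auto
  have "M t2 \<le> M t1 + \<epsilon>" if e: "0 < \<epsilon>" for \<epsilon>
  proof -
    \<comment> \<open>The summand 1 covers \<open>t1 = t2\<close> and keeps the total loss
      \<open>e' * (t2 - t1)\<close> below \<open>\<epsilon>\<close>.\<close>
    define e' where "e' = \<epsilon> / (t2 - t1 + 1)"
    have e': "0 < e'" using e t by (simp add: e'_def)
    define C where "C = (S \<times> {t1..t2}) \<inter> (\<lambda>z. q z + e' * (t2 - snd z)) -` {M t2..}"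
    have sub: "S \<times> {t1..t2} \<subseteq> S \<times> {a<..<b}" using t by auto
    have cq: "continuous_on (S \<times> {t1..t2}) (\<lambda>z. q z + e' * (t2 - snd z))"
      by (intro continuous_intros continuous_on_subset[OF cont sub])
    have cS: "compact (S \<times> {t1..t2})" using S by (intro compact_Times) auto
    have "closed C" unfolding C_def
      by (rule continuous_closed_preimage[OF cq compact_imp_closed[OF cS] closed_atLeast])
    then have "compact C" using cS unfolding C_def by (metis compact_Int_closed inf.left_idem)
    then have cA: "compact (snd ` C)" by (intro compact_continuous_image continuous_intros)
    have "t2 \<in> {a<..<b}" using t by auto
    then obtain p2 where "p2 \<in> S" "M t2 = q (p2, t2)" using M by blast
    then have "(p2, t2) \<in> C" using t by (auto simp: C_def)
    then have "snd ` C \<noteq> {}" by blast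
    then obtain \<tau> where \<tau>: "\<tau> \<in> snd ` C" "\<And>s. s \<in> snd ` C \<Longrightarrow> \<tau> \<le> s"
      using compact_attains_inf[OF cA] by blast
    then obtain p0 where p0: "p0 \<in> S" "t1 \<le> \<tau>" "\<tau> \<le> t2" "M t2 \<le> q (p0, \<tau>) + e' * (t2 - \<tau>)"
      by (auto simp: C_def)
    have \<tau>ab: "\<tau> \<in> {a<..<b}" using p0 t by auto
    obtain p where p: "p \<in> S" "M \<tau> = q (p, \<tau>)" "\<And>p'. p' \<in> S \<Longrightarrow> q (p', \<tau>) \<le> q (p, \<tau>)"
      using M[OF \<tau>ab] by blast
    have Mt: "M t2 \<le> q (p, \<tau>) + e' * (t2 - \<tau>)" using p0(4) p(3)[OF p0(1)] by linarith
    have "\<tau> = t1"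
    proof (rule ccontr)
      assume "\<tau> \<noteq> t1"
      then have lt: "t1 < \<tau>" using p0(2) by simp
      have "\<forall>\<^sub>F h in at_right 0. h < \<tau> - t1"
        using lt by (auto simp: eventually_at_right_field intro: exI[of _ "\<tau> - t1"])
      moreover have "\<forall>\<^sub>F h in at_right 0. q (p, \<tau>) - e' * h \<le> q (p, \<tau> - h)"
        by (rule backward[OF \<tau>ab p(1) _ e']) (rule p(3))
      ultimately have "\<forall>\<^sub>F h in at_right 0. q (p, \<tau>) - e' * h \<le> q (p, \<tau> - h) \<and> h < \<tau> - t1 \<and> 0 < h"
        using eventually_at_right_less[of 0] by eventually_elim auto
      then obtain h where h: "q (p, \<tau>) - e' * h \<le> q (p, \<tau> - h)" "h < \<tau> - t1" "0 < h"
        using eventually_happens'[OF trivial_limit_at_right_real] by blast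
      have "M t2 \<le> q (p, \<tau> - h) + e' * (t2 - (\<tau> - h))" using Mt h(1) by (simp add: algebra_simps)
      then have "(p, \<tau> - h) \<in> C" using p(1) h p0 by (auto simp: C_def)
      then have "\<tau> - h \<in> snd ` C" by force
      from \<tau>(2)[OF this] h(3) show False by simp
    qed
    then have "M t2 \<le> M t1 + e' * (t2 - t1)" using Mt p(2) by simp
    also have "e' * (t2 - t1) \<le> \<epsilon>" using e t by (simp add: e'_def divide_le_eq mult_left_mono)
    finally show ?thesis by simp
  qed
  then have "M t2 \<le> M t1" by (rule field_le_epsilon)
  then show ?thesis by (simp add: M_def)
qed

section \<open>The quotient along the flow\<close>

lemma Qfun_symmetric_functions:
  "Qfun k l = curvature_quotient (k + l) (k * l)"
proof -
  have "(k + l)^2 - 4 * (k * l) = (k - l)^2" "(k + l)^2 - 2 * (k * l) = k^2 + l^2" "(k + l)^2 - k * l = k^2 + k * l + l^2"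
    by algebra+
  then show ?thesis unfolding Qfun_def curvature_quotient_def by (simp add: power_mult_distrib mult.assoc)
qed

lemma curvature_quotient_nonneg:
  assumes "0 < K" "4 * K \<le> H^2"
  shows "0 \<le> curvature_quotient H K"
  unfolding curvature_quotient_def using assms by (intro divide_nonneg_nonneg mult_nonneg_nonneg) auto

lemma curvature_quotient_minus [simp]: "curvature_quotient (- H) K = curvature_quotient H K"
  by (simp add: curvature_quotient_def)

lemma form_minus: "form_H Z x (- n) = - form_H Z x n" "form_K Z x (- n) = form_K Z x n"
proof -
  have "(- c) / d = - (c / d)" for c d :: real by simp
  then show "form_H Z x (- n) = - form_H Z x n"
    unfolding form_H_def minus_divide_left by (simp add: algebra_simps)
  show "form_K Z x (- n) = form_K Z x n"
    unfolding form_K_def by simp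
qed

locale convex_flow = embedded_family +
  assumes strictly_convex: "\<forall>t\<in>{a<..<b}. \<forall>p\<in>sphere 0 1. kappa1 X p t > 0 \<and> kappa2 X p t > 0"
    and flow: "\<forall>t\<in>{a<..<b}. \<forall>p\<in>sphere 0 1.
                 ((\<lambda>s. X p s) has_vector_derivative
                    ((meanH X p t ^ 3 / gaussK X p t ^ 3) *\<^sub>R outer_normal X p t)) (at t)"
begin

definition "Qt q t = curvature_quotient (meanH X q t) (gaussK X q t)"

text \<open>By \<open>mixed_discriminant\<close> the radicand in \<open>kappa1\<close> and
  \<open>kappa2\<close> is nonnegative, so \<open>sqrt\<close> is a true root and the two have sum
  \<open>H\<close> and product \<open>K\<close>.\<close>

lemma curvature_facts:
  assumes p: "norm p = 1" and t: "t \<in> {a<..<b}"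
  shows "0 < gaussK X p t" "0 < meanH X p t" "4 * gaussK X p t \<le> (meanH X p t)^2"
    "Qfun (kappa1 X p t) (kappa2 X p t) = Qt p t"
proof -
  define d where "d = g11 X p t * g22 X p t - (g12 X p t)^2"
  define m where "m = g22 X p t * h11 X p t - 2 * g12 X p t * h12 X p t + g11 X p t * h22 X p t"
  define e where "e = h11 X p t * h22 X p t - (h12 X p t)^2"
  have d: "0 < d" using gram_pos(2)[OF p t] by (simp add: d_def)
  have "4 * d * e \<le> m^2" unfolding d_def e_def m_def by (rule mixed_discriminant[OF gram_pos[OF p t]])
  then have "4 * d * e / d^2 \<le> m^2 / d^2" by (rule divide_right_mono) simp
  moreover have "4 * d * e / d^2 = 4 * (e / d)" using d by (simp add: power2_eq_square)
  ultimately have le: "4 * (e / d) \<le> (m / d)^2" by (simp add: power_divide)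
  have HK: "meanH X p t = m / d" "gaussK X p t = e / d"
    by (simp_all add: meanH_def gaussK_def m_def d_def e_def)
  show disc: "4 * gaussK X p t \<le> (meanH X p t)^2" using le HK by simp
  define r where "r = sqrt ((meanH X p t)^2 - 4 * gaussK X p t)"
  have r: "r * r = (meanH X p t)^2 - 4 * gaussK X p t" using disc by (simp add: r_def)
  have k: "kappa1 X p t = (meanH X p t + r) / 2" "kappa2 X p t = (meanH X p t - r) / 2"
    by (simp_all add: kappa1_def kappa2_def r_def)
  have sum: "kappa1 X p t + kappa2 X p t = meanH X p t" unfolding k by (simp add: field_simps)
  have "kappa1 X p t * kappa2 X p t = ((meanH X p t)^2 - r * r) / 4"
    unfolding k by (simp add: power2_eq_square algebra_simps)
  then have prod: "kappa1 X p t * kappa2 X p t = gaussK X p t" unfolding r by simp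
  have "kappa1 X p t > 0" "kappa2 X p t > 0" using strictly_convex p t by auto
  then show "0 < gaussK X p t" "0 < meanH X p t" using prod sum mult_pos_pos add_pos_pos by metis+
  show "Qfun (kappa1 X p t) (kappa2 X p t) = Qt p t"
    unfolding Qfun_symmetric_functions sum prod Qt_def ..
qed

lemma Qt_nonneg: "norm p = 1 \<Longrightarrow> t \<in> {a<..<b} \<Longrightarrow> 0 \<le> Qt p t"
  unfolding Qt_def by (intro curvature_quotient_nonneg curvature_facts)

text \<open>Continuity is not visible from the definition, since the normal is a choice. It follows
  from the local expression \<open>num x / (16 * den x)\<close>, in which the sign of the normal has
  cancelled.\<close>

lemma local_estimate:
  assumes p: "norm p = 1" and t0: "t0 \<in> {a<..<b}"
  shows "isCont (\<lambda>x. Qt (chart p (fst x) (fst (snd x))) (snd (snd x))) (0, 0, t0)"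
    and "\<lbrakk>\<And>q. norm q = 1 \<Longrightarrow> Qt q t0 \<le> Qt p t0; Qt p t0 \<noteq> 0; 0 < \<epsilon>\<rbrakk>
      \<Longrightarrow> \<forall>\<^sub>F h in at_right 0. Qt p t0 - \<epsilon> * h \<le> Qt p (t0 - h)"
proof -
  define x0 :: coords where "x0 = (0, 0, t0)"
  define Z where "Z = param X p"
  define E3 where "E3 = outer_normal X p t0"
  have nE3: "norm E3 = 1" unfolding E3_def by (rule outer_normal[OF p t0])
  \<comment> \<open>The third axis is the normal at \<open>p\<close>, which puts the base point at
    \<open>y = 0\<close>; the other two are rotated so that the mixed entry of the second
    derivatives of \<open>\<sigma>\<close> vanishes there.\<close>
  obtain E1 E2 where E: "orthonormal3 E1 E2 E3" and frame:
    "(vd eu Z x0 \<bullet> E1) * (vd eu Z x0 \<bullet> E2) * (- (vd ev (vd ev Z) x0 \<bullet> E3))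
      - ((vd ev Z x0 \<bullet> E1) * (vd eu Z x0 \<bullet> E2) + (vd eu Z x0 \<bullet> E1) * (vd ev Z x0 \<bullet> E2)) * (- (vd ev (vd eu Z) x0 \<bullet> E3))
      + (vd ev Z x0 \<bullet> E1) * (vd ev Z x0 \<bullet> E2) * (- (vd eu (vd eu Z) x0 \<bullet> E3)) = 0"
    by (rule rotate_frame[OF nE3])
  note par = orthonormal3_inner[OF E]
  define f1 f2 f3 where "f1 = (\<lambda>x. Z x \<bullet> E1)" and "f2 = (\<lambda>x. Z x \<bullet> E2)" and "f3 = (\<lambda>x. Z x \<bullet> E3)"
  note fs = this
  define V0 where "V0 = chart_dom p \<inter> {x. snd (snd x) \<in> {a<..<b}}"
  have oV0: "open V0"
  proof -
    have "open ((\<lambda>x::coords. snd (snd x)) -` {a<..<b})" by (intro open_vimage continuous_intros)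
    then show ?thesis unfolding V0_def using open_chart_dom[OF p] by (auto simp: vimage_def)
  qed
  have sZ: "smooth_on V0 Z" unfolding Z_def by (rule smooth_on_subset[OF smooth_param[OF p]]) (simp add: V0_def)
  have sf: "smooth_on V0 f1" "smooth_on V0 f2" "smooth_on V0 f3"
    unfolding fs by (rule smooth_on_inner[OF sZ smooth_on_const])+
  define mm where "mm = (\<lambda>x. pu f1 x * pv f2 x - pv f1 x * pu f2 x)"
  have "smooth_on V0 mm" unfolding mm_def
    by (intro smooth_on_diff smooth_on_mult smooth_on_dird[OF oV0] sf smooth_on_const)
  then have cmm: "continuous_on V0 mm" by (rule smooth_on_continuous_on)
  \<comment> \<open>Restriction to the points where the normal has a nonzero component along
    \<open>E3\<close>.\<close>
  define V where "V = V0 \<inter> mm -` (- {0})"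
  have oV: "open V" unfolding V_def by (rule continuous_open_preimage[OF cmm oV0]) auto
  have VV0: "V \<subseteq> V0" by (simp add: V_def)
  have sZV: "smooth_on V Z" by (rule smooth_on_subset[OF sZ VV0])
  interpret graph_coords V f1 f2 f3
    by unfold_locales (use oV smooth_on_subset[OF _ VV0] sf in \<open>auto simp: V_def mm_def\<close>)
  have comp: "dird (\<lambda>_. d) f1 x = vd d Z x \<bullet> E1" "dird (\<lambda>_. d) f2 x = vd d Z x \<bullet> E2" "dird (\<lambda>_. d) f3 x = vd d Z x \<bullet> E3"
    if "x \<in> V" for d x
    unfolding fs by (rule vd_component[OF sZV that])+
  have comp2: "dird (\<lambda>_. e) (dird (\<lambda>_. d) f1) x = vd e (vd d Z) x \<bullet> E1" "dird (\<lambda>_. e) (dird (\<lambda>_. d) f2) x = vd e (vd d Z) x \<bullet> E2"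
    "dird (\<lambda>_. e) (dird (\<lambda>_. d) f3) x = vd e (vd d Z) x \<bullet> E3"
    if "x \<in> V" for d e x
    unfolding fs by (rule vd_vd_component[OF oV sZV that])+
  define N where "N x = (y1 x *\<^sub>R E1 + y2 x *\<^sub>R E2 + E3) /\<^sub>R w x" for x
  note o = E[unfolded orthonormal3_def]
  have NE: "N x \<bullet> E1 = y1 x / w x" "N x \<bullet> E2 = y2 x / w x" "N x \<bullet> E3 = 1 / w x" for x
    using o by (simp_all add: N_def inner_add_left inner_add_right inner_commute divide_inverse_commute)
  have inN: "v \<bullet> N x = ((v \<bullet> E1) * y1 x + (v \<bullet> E2) * y2 x + v \<bullet> E3) / w x" for v x
    unfolding par[of v "N x"] NE by (simp add: add_divide_distrib)
  have forms: "Hf x = form_H Z x (N x)" "Kf x = form_K Z x (N x)" if x: "x \<in> V" for x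
  proof -
    have g: "ff11 x = vd eu Z x \<bullet> vd eu Z x" "ff12 x = vd eu Z x \<bullet> vd ev Z x" "ff22 x = vd ev Z x \<bullet> vd ev Z x"
      unfolding ff11_def ff12_def ff22_def comp[OF x] par[of "vd eu Z x" "vd eu Z x"] par[of "vd eu Z x" "vd ev Z x"]
        par[of "vd ev Z x" "vd ev Z x"] by (simp_all add: power2_eq_square)
    have s: "sf (dird (\<lambda>_. e)) (dird (\<lambda>_. d)) x = - (vd e (vd d Z) x \<bullet> N x)" for d e
      unfolding sf_def comp2[OF x] inN by (simp only: minus_divide_left)
    show "Hf x = form_H Z x (N x)" "Kf x = form_K Z x (N x)"
      unfolding Hf_def Kf_def form_H_def form_K_def g s by simp_all
  qed
  define q where "q x = chart p (fst x) (fst (snd x))" for x :: coords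
  have q: "norm (q x) = 1" for x unfolding q_def by (rule norm_chart[OF p])
  have tV: "snd (snd x) \<in> {a<..<b}" if "x \<in> V" for x using that VV0 by (auto simp: V0_def)
  have qi: "0 < q x \<bullet> p" "chart_inv p (q x) (snd (snd x)) = x" for x
  proof -
    note c = chart_vec_inner[OF p, of x]
    have "0 < norm (chart_vec p x)" using c(4) by simp
    then show "0 < q x \<bullet> p" "chart_inv p (q x) (snd (snd x)) = x"
      unfolding q_def chart_eq chart_inv_def by (simp_all add: c prod_eq_iff)
  qed
  have change: "outer_normal X (q x) (snd (snd x)) \<bullet> vd eu Z x = 0" "outer_normal X (q x) (snd (snd x)) \<bullet> vd ev Z x = 0"
    "meanH X (q x) (snd (snd x)) = form_H Z x (outer_normal X (q x) (snd (snd x)))"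
    "gaussK X (q x) (snd (snd x)) = form_K Z x (outer_normal X (q x) (snd (snd x)))" if "x \<in> V" for x
    using chart_change[OF p q[of x] qi(1)[of x] tV[OF that], unfolded qi(2), folded Z_def] by blast+
  define n where "n x = outer_normal X (q x) (snd (snd x))" for x
  \<comment> \<open>Both vectors are unit normals of the same tangent plane. The sign may depend on
    \<open>x\<close>.\<close>
  have n_N: "n x = N x \<or> n x = - N x" if x: "x \<in> V" for x
  proof -
    have t: "n x \<bullet> vd eu Z x = 0" "n x \<bullet> vd ev Z x = 0" unfolding n_def by (rule change[OF x])+
    define n1 n2 n3 where "n1 = n x \<bullet> E1" and "n2 = n x \<bullet> E2" and "n3 = n x \<bullet> E3"
    have f3: "pu f3 x = - (pu f1 x * y1 x + pu f2 x * y2 x)" "pv f3 x = - (pv f1 x * y1 x + pv f2 x * y2 x)"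
      using tangent[OF x] by simp_all
    have "pu f1 x * (n1 - n3 * y1 x) + pu f2 x * (n2 - n3 * y2 x) = 0" "pv f1 x * (n1 - n3 * y1 x) + pv f2 x * (n2 - n3 * y2 x) = 0"
      using t unfolding par[of "n x" "vd eu Z x"] par[of "n x" "vd ev Z x"] comp[OF x, symmetric] f3 n1_def[symmetric] n2_def[symmetric] n3_def[symmetric]
      by (simp_all add: algebra_simps)
    moreover have "pu f1 x * pv f2 x - pu f2 x * pv f1 x \<noteq> 0" using graph[OF x] by (simp add: mult.commute)
    ultimately have n12: "n1 - n3 * y1 x = 0" "n2 - n3 * y2 x = 0" by (rule linear_system_trivial)+
    define k where "k = n3 * w x"
    have "n x = n1 *\<^sub>R E1 + n2 *\<^sub>R E2 + n3 *\<^sub>R E3"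
      unfolding n1_def n2_def n3_def by (rule orthonormal3_expand[OF E])
    also have "\<dots> = n3 *\<^sub>R (y1 x *\<^sub>R E1 + y2 x *\<^sub>R E2 + E3)"
      using n12 by (simp add: scaleR_add_right)
    also have "\<dots> = k *\<^sub>R N x"
      using w_pos(1)[of x] by (simp add: N_def k_def mult.assoc)
    finally have nk: "n x = k *\<^sub>R N x" .
    have "N x \<bullet> N x = (1 + (y1 x)^2 + (y2 x)^2) / (w x)^2"
      unfolding par[of "N x" "N x"] NE by (simp add: power2_eq_square add_divide_distrib)
    then have NN: "N x \<bullet> N x = 1" unfolding w_pos(2)[symmetric, of x] using w_pos(1)[of x] by simp
    have "n x \<bullet> n x = 1" unfolding n_def using outer_normal(1)[OF q tV[OF x]] by (simp add: norm_eq_1)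
    then have "k * k = 1" unfolding nk using NN by simp
    then have "k = 1 \<or> k = - 1" by (simp add: square_eq_1_iff)
    then show ?thesis using nk by auto
  qed
  have HK: "(meanH X (q x) (snd (snd x)) = Hf x \<and> n x = N x \<or> meanH X (q x) (snd (snd x)) = - Hf x \<and> n x = - N x)
     \<and> gaussK X (q x) (snd (snd x)) = Kf x" if x: "x \<in> V" for x
    using n_N[OF x] change(3,4)[OF x] unfolding n_def[symmetric] forms[OF x] by (auto simp: form_minus)
  have Kpos: "0 < Kf x" if x: "x \<in> V" for x
    using HK[OF x] curvature_facts(1)[OF q tV[OF x]] by metis
  have J: "J x \<noteq> 0" if x: "x \<in> V" for x
  proof
    assume "J x = 0"
    then have "sf pu pu x * sf pv pv x - (sf pv pu x)^2 = 0" using det_sf[OF x] w_pos(1)[of x] by simp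
    then show False using Kpos[OF x] unfolding Kf_def by simp
  qed
  interpret regular_graph_coords V f1 f2 f3 by unfold_locales (rule J)
  have Q: "Qt (q x) (snd (snd x)) = curvature_quotient (Hf x) (Kf x)" if x: "x \<in> V" for x
    using HK[OF x] unfolding Qt_def by auto
  have x0V0: "x0 \<in> V0" unfolding V0_def x0_def using in_chart_dom[OF p t0] t0 by simp
  have qx0: "q x0 = p" by (simp add: q_def x0_def chart_0[OF p])
  have perp0: "E3 \<bullet> vd eu Z x0 = 0" "E3 \<bullet> vd ev Z x0 = 0"
    and gr0: "0 < (vd eu Z x0 \<bullet> vd eu Z x0) * (vd ev Z x0 \<bullet> vd ev Z x0) - (vd eu Z x0 \<bullet> vd ev Z x0)^2"
    using chart_change[OF p q qi(1), of t0 x0] t0 qi(2)[of x0] unfolding qx0 Z_def E3_def by (simp_all add: x0_def)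
  have comp0: "dird (\<lambda>_. d) f1 x0 = vd d Z x0 \<bullet> E1" "dird (\<lambda>_. d) f2 x0 = vd d Z x0 \<bullet> E2" "dird (\<lambda>_. d) f3 x0 = vd d Z x0 \<bullet> E3" for d
    unfolding fs by (rule vd_component[OF sZ x0V0])+
  have f30: "pu f3 x0 = 0" "pv f3 x0 = 0" unfolding comp0 using perp0 by (simp_all add: inner_commute)
  \<comment> \<open>At \<open>x0\<close> the tangent vectors have no \<open>E3\<close> component, so
    the Gram determinant is the square of a two-dimensional determinant.\<close>
  have "(mm x0)^2 = (vd eu Z x0 \<bullet> vd eu Z x0) * (vd ev Z x0 \<bullet> vd ev Z x0) - (vd eu Z x0 \<bullet> vd ev Z x0)^2"
    unfolding mm_def par[of "vd eu Z x0" "vd eu Z x0"] par[of "vd eu Z x0" "vd ev Z x0"]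
      par[of "vd ev Z x0" "vd ev Z x0"] comp0[symmetric] f30 by algebra
  then have x0: "x0 \<in> V" using x0V0 gr0 by (auto simp: V_def)
  have y0: "y1 x0 = 0" "y2 x0 = 0" unfolding y1_def y2_def m1_def m2_def f30 by simp_all
  have w0: "w x0 = 1" by (simp add: w_def y0)
  have N0: "N x0 = E3" by (simp add: N_def y0 w0)
  \<comment> \<open>This excludes the negative sign at \<open>x0\<close>, where \<open>n\<close> and
    \<open>N\<close> both equal \<open>E3\<close>, so \<open>Hf\<close> is positive there.\<close>
  have "E3 \<noteq> - E3"
  proof
    assume "E3 = - E3"
    then have "E3 \<bullet> E3 = - E3 \<bullet> E3" by (rule arg_cong)
    then show False using o by simp
  qed
  moreover have "n x0 = E3" unfolding n_def qx0 E3_def by (simp add: x0_def)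
  ultimately have "meanH X (q x0) (snd (snd x0)) = Hf x0" using HK[OF x0] N0 by auto
  then have H0: "0 < Hf x0" using curvature_facts(2)[OF p t0] unfolding qx0 by (simp add: x0_def)
  have fr: "pv y2 x0 * pu f2 x0 = pu y2 x0 * pv f2 x0"
  proof -
    have s: "sf (dird (\<lambda>_. e)) (dird (\<lambda>_. d)) x0 = - (vd e (vd d Z) x0 \<bullet> E3)" for d e
      unfolding sf_def comp2[OF x0] y0 w0 by simp
    have "pu f1 x0 * pu f2 x0 * sf pv pv x0 - (pv f1 x0 * pu f2 x0 + pu f1 x0 * pv f2 x0) * sf pv pu x0
      + pv f1 x0 * pv f2 x0 * sf pu pu x0 = 0"
      using frame unfolding s comp0 .
    moreover have "pu f1 x0 * pu f2 x0 * sf pv pv x0 - (pv f1 x0 * pu f2 x0 + pu f1 x0 * pv f2 x0) * sf pv pu x0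
      + pv f1 x0 * pv f2 x0 * sf pu pu x0 = m3 x0 * (pv y2 x0 * pu f2 x0 - pu y2 x0 * pv f2 x0)"
    proof -
      have "sf pv pu x0 = pu f1 x0 * pv y1 x0 + pu f2 x0 * pv y2 x0" "sf pv pu x0 = pv f1 x0 * pu y1 x0 + pv f2 x0 * pu y2 x0"
        "sf pu pu x0 = pu f1 x0 * pu y1 x0 + pu f2 x0 * pu y2 x0" "sf pv pv x0 = pv f1 x0 * pv y1 x0 + pv f2 x0 * pv y2 x0"
        using sf_eq[OF x0] sf_sym[OF x0] w0 by simp_all
      then show ?thesis unfolding m3_def by algebra
    qed
    ultimately show ?thesis using m3[OF x0] by simp
  qed
  have flowf: "pt f1 x = (Hf x / Kf x)^3 * (y1 x / w x)" "pt f2 x = (Hf x / Kf x)^3 * (y2 x / w x)"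
    "pt f3 x = (Hf x / Kf x)^3 * (1 / w x)" if x: "x \<in> V" for x
  proof -
    let ?t = "snd (snd x)"
    have "x + (s - ?t) *\<^sub>R (0, 0, 1) = (fst x, fst (snd x), s)" for s by (simp add: prod_eq_iff)
    then have "vd (0, 0, 1) Z x = vector_derivative (\<lambda>s. X (q x) s) (at ?t)"
      using vd_line[OF sZV x, of ?t "(0, 0, 1)"] by (simp add: Z_def param_def q_def)
    also have "\<dots> = (meanH X (q x) ?t ^ 3 / gaussK X (q x) ?t ^ 3) *\<^sub>R n x"
      unfolding n_def by (rule vector_derivative_at) (use flow tV[OF x] q[of x] in auto)
    \<comment> \<open>The exponent 3 is odd: if the normal is reversed, the signs of
      \<open>H^3\<close> and of the normal cancel.\<close>
    also have "\<dots> = (Hf x / Kf x)^3 *\<^sub>R N x"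
      using HK[OF x] by (auto simp: power_divide)
    finally have e: "vd (0, 0, 1) Z x = (Hf x / Kf x)^3 *\<^sub>R N x" .
    show "pt f1 x = (Hf x / Kf x)^3 * (y1 x / w x)" "pt f2 x = (Hf x / Kf x)^3 * (y2 x / w x)"
      "pt f3 x = (Hf x / Kf x)^3 * (1 / w x)"
      unfolding comp[OF x] e by (simp_all add: NE)
  qed
  have Ppos: "0 < D1.P x" if "x \<in> V" for x using Kpos[OF that] curvatures(2)[OF that] by simp
  have "continuous_on V (\<lambda>x. num x / (16 * den x))"
    unfolding num_def den_def
    using den_pos[OF Ppos] unfolding den_def
    by (intro continuous_intros smooth_on_continuous_on[OF smooth_sP(1)] smooth_on_continuous_on[OF smooth_sP(2)]) force
  then have "continuous_on V (\<lambda>x. Qt (q x) (snd (snd x)))"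
    by (rule continuous_on_eq) (simp add: Q quotient_eq)
  then show "isCont (\<lambda>x. Qt (chart p (fst x) (fst (snd x))) (snd (snd x))) (0, 0, t0)"
    using x0 oV unfolding x0_def[symmetric] by (simp add: continuous_on_eq_continuous_at q_def)
  assume max: "\<And>q. norm q = 1 \<Longrightarrow> Qt q t0 \<le> Qt p t0" and ne: "Qt p t0 \<noteq> 0" and e: "0 < \<epsilon>"
  have Q0: "curvature_quotient (Hf x0) (Kf x0) = Qt p t0"
    using Q[OF x0] qx0 by (simp add: x0_def)
  have maxV: "curvature_quotient (Hf x) (Kf x) \<le> curvature_quotient (Hf x0) (Kf x0)" if "x \<in> V" "snd (snd x) = snd (snd x0)" for x
    unfolding Q0 Q[OF that(1), symmetric] that(2) using max[OF q] by (simp add: x0_def)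
  have "\<forall>\<^sub>F h in at_right 0. curvature_quotient (Hf x0) (Kf x0) - \<epsilon> * h
       \<le> curvature_quotient (Hf (x0 - h *\<^sub>R (0, 0, 1))) (Kf (x0 - h *\<^sub>R (0, 0, 1)))"
    by (rule backward_estimate[OF x0 y0 fr Kpos H0 flowf maxV _ e]) (use Q0 ne in simp_all)
  moreover have "\<forall>\<^sub>F h in at_right 0. x0 - h *\<^sub>R (0, 0, 1) \<in> V"
  proof (rule topological_tendstoD[OF _ oV x0])
    show "((\<lambda>h. x0 - h *\<^sub>R (0, 0, 1)) \<longlongrightarrow> x0) (at_right 0)"
      by (auto intro!: tendsto_eq_intros simp: zero_prod_def)
  qed
  ultimately show "\<forall>\<^sub>F h in at_right 0. Qt p t0 - \<epsilon> * h \<le> Qt p (t0 - h)"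
  proof eventually_elim
    case (elim h)
    have "x0 - h *\<^sub>R (0, 0, 1) = (0, 0, t0 - h)" by (simp add: x0_def)
    then have "Qt (q (x0 - h *\<^sub>R (0, 0, 1))) (snd (snd (x0 - h *\<^sub>R (0, 0, 1)))) = Qt p (t0 - h)"
      by (simp add: q_def chart_0[OF p])
    then show ?case using elim Q[OF elim(2)] Q0 by simp
  qed
qed

text \<open>Near \<open>p\<close> every point of the sphere is the chart image of its gnomonic
  coordinates, which converge to 0 at \<open>p\<close>; so continuity in the chart suffices.\<close>

lemma Qt_continuous: "continuous_on (sphere 0 1 \<times> {a<..<b}) (\<lambda>z. Qt (fst z) (snd z))"
  unfolding continuous_on_def
proof
  fix z assume z: "z \<in> sphere (0::real^3) 1 \<times> {a<..<b}"
  define p where "p = fst z"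
  define t where "t = snd z"
  have p: "norm p = 1" and t: "t \<in> {a<..<b}" using z by (auto simp: p_def t_def)
  let ?F = "at z within sphere 0 1 \<times> {a<..<b}"
  have lim: "(fst \<longlongrightarrow> p) ?F" "(snd \<longlongrightarrow> t) ?F" unfolding p_def t_def by (intro tendsto_intros)+
  have pp: "p \<bullet> p = 1" "p \<bullet> te1 p = 0" "p \<bullet> te2 p = 0"
    using tframe[OF p] by (simp_all add: orthonormal3_def inner_commute)
  have "((\<lambda>z. chart_inv p (fst z) (snd z)) \<longlongrightarrow> ((p \<bullet> te1 p) / (p \<bullet> p), (p \<bullet> te2 p) / (p \<bullet> p), t)) ?F"
    unfolding chart_inv_def by (intro tendsto_intros lim) (simp_all add: pp)
  then have "((\<lambda>z. chart_inv p (fst z) (snd z)) \<longlongrightarrow> (0, 0, t)) ?F" by (simp add: pp)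
  from isCont_tendsto_compose[OF local_estimate(1)[OF p t] this]
  have "((\<lambda>z. Qt (chart p (fst (chart_inv p (fst z) (snd z))) (fst (snd (chart_inv p (fst z) (snd z))))) (snd (snd (chart_inv p (fst z) (snd z)))))
     \<longlongrightarrow> Qt p t) ?F" by (simp add: chart_0[OF p])
  moreover have "\<forall>\<^sub>F z in ?F. Qt (chart p (fst (chart_inv p (fst z) (snd z))) (fst (snd (chart_inv p (fst z) (snd z))))) (snd (snd (chart_inv p (fst z) (snd z))))
     = Qt (fst z) (snd z)"
  proof -
    have "((\<lambda>z. fst z \<bullet> p) \<longlongrightarrow> p \<bullet> p) ?F" by (intro tendsto_intros lim)
    then have "\<forall>\<^sub>F z in ?F. 0 < fst z \<bullet> p" by (rule order_tendstoD(1)) (simp add: pp)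
    moreover have "\<forall>\<^sub>F z in ?F. z \<in> sphere 0 1 \<times> {a<..<b}"
      by (auto simp: eventually_at_filter)
    ultimately show ?thesis
    proof eventually_elim
      case (elim y)
      then have "norm (fst y) = 1" by auto
      then show ?case unfolding chart_chart_inv[OF p elim(1)] by (simp add: chart_inv_def)
    qed
  qed
  ultimately show "((\<lambda>z. Qt (fst z) (snd z)) \<longlongrightarrow> Qt (fst z) (snd z)) ?F"
    unfolding p_def t_def by (rule Lim_transform_eventually)
qed

lemma Sup_Qt_nonincreasing:
  assumes "a < t1" "t1 \<le> t2" "t2 < b"
  shows "Sup ((\<lambda>p. Qt p t2) ` sphere 0 1) \<le> Sup ((\<lambda>p. Qt p t1) ` sphere 0 1)"
proof -
  have "Sup ((\<lambda>p. Qt (fst (p, t2)) (snd (p, t2))) ` sphere 0 1) \<le> Sup ((\<lambda>p. Qt (fst (p, t1)) (snd (p, t1))) ` sphere 0 1)"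
  proof (rule Sup_nonincreasing_of_backward_estimate[OF _ _ Qt_continuous _ assms])
    show "sphere (0::real^3) 1 \<noteq> {}" by simp
    fix t p and \<epsilon> :: real
    assume t: "t \<in> {a<..<b}" and p: "p \<in> sphere (0::real^3) 1" and e: "0 < \<epsilon>"
      and max: "\<And>p'. p' \<in> sphere 0 1 \<Longrightarrow> Qt (fst (p', t)) (snd (p', t)) \<le> Qt (fst (p, t)) (snd (p, t))"
    have np: "norm p = 1" using p by simp
    have mx: "Qt q t \<le> Qt p t" if "norm q = 1" for q using max[of q] that by simp
    show "\<forall>\<^sub>F h in at_right 0. Qt (fst (p, t)) (snd (p, t)) - \<epsilon> * h \<le> Qt (fst (p, t - h)) (snd (p, t - h))"
    proof (cases "Qt p t = 0")
      case False
      then show ?thesis using local_estimate(2)[OF np t mx _ e] by simp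
    next
      \<comment> \<open>The quotient is nonnegative everywhere, so a maximum equal to 0 cannot
        exceed earlier values.\<close>
      case True
      have "\<forall>\<^sub>F h in at_right 0. h < t - a"
        using t by (auto simp: eventually_at_right_field intro: exI[of _ "t - a"])
      then show ?thesis using eventually_at_right_less[of 0]
      proof eventually_elim
        case (elim h)
        then have "0 \<le> Qt p (t - h)" using t by (intro Qt_nonneg np) auto
        moreover have "0 \<le> \<epsilon> * h" using e elim by simp
        ultimately show ?case using True by simp
      qed
    qed
  qed simp
  then show ?thesis by simp
qed

end

theorem theorem10p4:
  fixes X :: "real^3 \<Rightarrow> real \<Rightarrow> real^3" and a b :: real and U :: "((real^3) \<times> real) set"
  assumes "a < b"
    and "open U" and "sphere 0 1 \<times> {a<..<b} \<subseteq> U"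
    and smooth: "smooth_on U (\<lambda>z. X (fst z) (snd z))"
    and embedded: "\<forall>t\<in>{a<..<b}. inj_on (\<lambda>p. X p t) (sphere 0 1)"
    and immersed: "\<forall>t\<in>{a<..<b}. \<forall>p\<in>sphere 0 1.
                     inj_on (frechet_derivative (\<lambda>q. X q t) (at p)) {v. v \<bullet> p = 0}"
    and strictly_convex: "\<forall>t\<in>{a<..<b}. \<forall>p\<in>sphere 0 1. kappa1 X p t > 0 \<and> kappa2 X p t > 0"
    and flow: "\<forall>t\<in>{a<..<b}. \<forall>p\<in>sphere 0 1.
                 ((\<lambda>s. X p s) has_vector_derivative
                    ((meanH X p t ^ 3 / gaussK X p t ^ 3) *\<^sub>R outer_normal X p t)) (at t)"
  shows "\<forall>t1 t2. a < t1 \<and> t1 \<le> t2 \<and> t2 < b \<longrightarrow>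
           Sup ((\<lambda>p. Qfun (kappa1 X p t2) (kappa2 X p t2)) ` sphere 0 1)
             \<le> Sup ((\<lambda>p. Qfun (kappa1 X p t1) (kappa2 X p t1)) ` sphere 0 1)"
proof (intro allI impI, elim conjE)
  fix t1 t2 assume t: "a < t1" "t1 \<le> t2" "t2 < b"
  interpret convex_flow X a b U by unfold_locales fact+
  have Q: "(\<lambda>p. Qfun (kappa1 X p t) (kappa2 X p t)) ` sphere 0 1 = (\<lambda>p. Qt p t) ` sphere 0 1" if "t \<in> {a<..<b}" for t
    by (rule image_cong) (use that curvature_facts(4) in auto)
  show "Sup ((\<lambda>p. Qfun (kappa1 X p t2) (kappa2 X p t2)) ` sphere 0 1)
             \<le> Sup ((\<lambda>p. Qfun (kappa1 X p t1) (kappa2 X p t1)) ` sphere 0 1)"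
    using Sup_Qt_nonincreasing[OF t] Q[of t1] Q[of t2] t by simp
qed

end
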